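(* Fix $r>1$ and let $(W,f),(V,g)\in\mathcal{WS}_r$ be two graphon-signals. Then the following statements are equivalent: (1) $\delta_p((W,f),(V,g))=0$ for any $p\in[1,\infty)$; (2) $\delta_\square((W,f),(V,g))=0$; (3) $t((F,\boldsymbol d),(W,f))=t((F,\boldsymbol d),(V,g))$ for all multigraphs $F$ and all $\boldsymbol d\in\mathbb N_0^{v(F)}$; (4) $t((F,\boldsymbol d),(W,f))=t((F,\boldsymbol d),(V,g))$ for all simple graphs $F$ and all $\boldsymbol d\in\mathbb N_0^{v(F)}$; (5) $\mathbb H_k(W,f)\overset{\mathcal D}{=}\mathbb H_k(V,g)$ (equality in distribution) for all $k\in\mathbb N$; (6) $\mathbb G_k(W,f)\overset{\mathcal D}{=}\mathbb G_k(V,g)$ (equality in distribution) for all $k\in\mathbb N$.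
   Context: $\lambda^m$ is $m$-dimensional Lebesgue measure, $\lambda=\lambda^1$. A kernel is a bounded symmetric measurable function $W:[0,1]^2\to\mathbb R$; a graphon is a kernel with values in $[0,1]$. For $r>0$, $\mathcal{WS}_r$ is the set of graphon-signals: pairs $(W,f)$ with $W$ a graphon and $f\in L^\infty[0,1]$, $\|f\|_\infty\le r$. Cut norms: $\|W\|_\square=\sup_{S,T\subseteq[0,1]}\left|\int_{S\times T}W\,d\lambda^2\right|$ for kernels and $\|f\|_\square=\sup_{S\subseteq[0,1]}\left|\int_S f\,d\lambda\right|$ for signals ($S,T$ measurable). Let $S_{[0,1]}$ be the set of Lebesgue-measure preserving maps $\varphi:[0,1]\to[0,1]$ that are bijective almost everywhere (bijections between co-null sets); $W^\varphi(x,y)=W(\varphi(x),\varphi(y))$, $f^\varphi(x)=f(\varphi(x))$. Define $\delta_\square((W,f),(V,g))=\inf_{\varphi\in S_{[0,1]}}\left(\|W-V^\varphi\|_\square+\|f-g^\varphi\|_\square\right)$ and $\delta_p((W,f),(V,g))=\inf_{\varphi\in S_{[0,1]}}\left(\|W-V^\varphi\|_p+\|f-g^\varphi\|_p\right)$ with the $L^p$ norms. In (1), "for any $p$" means for every $p\in[1,\infty)$. A simple graph is a finite undirected graph without loops or parallel edges; in a multigraph the edges form a finite multiset of two-element subsets of the (finite) vertex set (no loops). $v(F)$ is the number of vertices. For a multigraph $F$ with $V(F)=[k]$, $\boldsymbol d\in\mathbb N_0^k$, the signal-weighted homomorphism density is $$t((F,\boldsymbol d),(W,f))=\int_{[0,1]^k}\Big(\prod_{i\in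 V(F)}f(x_i)^{d_i}\Big)\Big(\prod_{\{i,j\}\in E(F)}W(x_i,x_j)\Big)d\lambda^k(\boldsymbol x),$$ factors being repeated according to edge multiplicity. Sampling: let $X_1,\dots,X_k$ be i.i.d. uniform on $[0,1]$. $\mathbb H_k(W,f)$ is the distribution of the weighted graph on $[k]$ with edge weights $W(X_i,X_j)$ ($i\ne j$) together with the node signal $(f(X_1),\dots,f(X_k))$. $\mathbb G_k(W,f)$ is the distribution of the random simple graph on $[k]$ in which, conditionally on $X$, each edge $\{i,j\}$ is present independently with probability $W(X_i,X_j)$, together with the node signal $(f(X_1),\dots,f(X_k))$. *)

theory Defs
  imports "HOL-Probability.Probability"
begin

text \<open>
  Measurability and measures are taken in the sense of Lebesgue throughout. Kernels and signals
  are total functions of which only the values on the unit square and on the unit interval matter.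
\<close>

abbreviation unit_interval :: "real measure" where
  "unit_interval \<equiv> lebesgue_on {0..1}"

abbreviation unit_square :: "(real \<times> real) measure" where
  "unit_square \<equiv> lebesgue_on ({0..1} \<times> {0..1})"

type_synonym kernel = "real \<times> real \<Rightarrow> real"
type_synonym signal = "real \<Rightarrow> real"

definition is_kernel :: "kernel \<Rightarrow> bool" where
  "is_kernel W \<longleftrightarrow>
     W \<in> borel_measurable unit_square \<and>
     (\<exists>C. \<forall>x\<in>{0..1}. \<forall>y\<in>{0..1}. \<bar>W (x, y)\<bar> \<le> C) \<and>
     (\<forall>x\<in>{0..1}. \<forall>y\<in>{0..1}. W (x, y) = W (y, x))"

definition is_graphon :: "kernel \<Rightarrow> bool" where
  "is_graphon W \<longleftrightarrow> is_kernel W \<and> (\<forall>x\<in>{0..1}. \<forall>y\<in>{0..1}. W (x, y) \<in> {0..1})"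

definition graphon_signals :: "real \<Rightarrow> (kernel \<times> signal) set" where
  "graphon_signals r =
     {(W, f). is_graphon W \<and> f \<in> borel_measurable unit_interval \<and>
              esssup unit_interval (\<lambda>x. ereal \<bar>f x\<bar>) \<le> ereal r}"


subsection \<open>Norms and distances\<close>

definition cut_norm_kernel :: "kernel \<Rightarrow> real" where
  "cut_norm_kernel W =
     (SUP (S, T) \<in> sets unit_interval \<times> sets unit_interval. \<bar>LINT z:S \<times> T|lebesgue. W z\<bar>)"

definition cut_norm_signal :: "signal \<Rightarrow> real" where
  "cut_norm_signal f = (SUP S \<in> sets unit_interval. \<bar>LINT x:S|lebesgue. f x\<bar>)"

definition Lp_norm :: "'a measure \<Rightarrow> real \<Rightarrow> ('a \<Rightarrow> real) \<Rightarrow> real" where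
  "Lp_norm M p h = (LINT z|M. \<bar>h z\<bar> powr p) powr (1 / p)"

definition ae_bijections :: "(real \<Rightarrow> real) set" where
  "ae_bijections =
     {\<phi>. \<phi> \<in> unit_interval \<rightarrow>\<^sub>M unit_interval \<and>
          distr unit_interval unit_interval \<phi> = unit_interval \<and>
          (\<exists>A B. A \<subseteq> {0..1} \<and> B \<subseteq> {0..1} \<and>
                 {0..1} - A \<in> null_sets lebesgue \<and> {0..1} - B \<in> null_sets lebesgue \<and>
                 bij_betw \<phi> A B)}"

definition kernel_pullback :: "kernel \<Rightarrow> (real \<Rightarrow> real) \<Rightarrow> kernel" where
  "kernel_pullback W \<phi> = (\<lambda>(x, y). W (\<phi> x, \<phi> y))"

definition signal_pullback :: "signal \<Rightarrow> (real \<Rightarrow> real) \<Rightarrow> signal" where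
  "signal_pullback f \<phi> = (\<lambda>x. f (\<phi> x))"

fun cut_distance :: "kernel \<times> signal \<Rightarrow> kernel \<times> signal \<Rightarrow> real" where
  "cut_distance (W, f) (V, g) =
     (INF \<phi> \<in> ae_bijections.
        cut_norm_kernel (\<lambda>z. W z - kernel_pullback V \<phi> z) +
        cut_norm_signal (\<lambda>x. f x - signal_pullback g \<phi> x))"

fun Lp_distance :: "real \<Rightarrow> kernel \<times> signal \<Rightarrow> kernel \<times> signal \<Rightarrow> real" where
  "Lp_distance p (W, f) (V, g) =
     (INF \<phi> \<in> ae_bijections.
        Lp_norm unit_square p (\<lambda>z. W z - kernel_pullback V \<phi> z) +
        Lp_norm unit_interval p (\<lambda>x. f x - signal_pullback g \<phi> x))"


subsection \<open>Graphs and homomorphism densities\<close>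

definition vertex_pairs :: "nat \<Rightarrow> nat set set" where
  "vertex_pairs k = {e. e \<subseteq> {1..k} \<and> card e = 2}"

text \<open>A graph is given by its number of vertices \<open>k\<close>, the vertex set being \<open>{1..k}\<close>, and the
  multiset of its edges.\<close>

definition is_multigraph :: "nat \<Rightarrow> nat set multiset \<Rightarrow> bool" where
  "is_multigraph k E \<longleftrightarrow> set_mset E \<subseteq> vertex_pairs k"

definition is_simple_graph :: "nat \<Rightarrow> nat set multiset \<Rightarrow> bool" where
  "is_simple_graph k E \<longleftrightarrow> is_multigraph k E \<and> (\<forall>e. count E e \<le> 1)"

text \<open>The number \<open>W (x i, x j)\<close> for \<open>e = {i, j}\<close>. Since kernels are symmetric, the order in which
  the two end points are listed is immaterial; see the lemma below.\<close>

definition edge_value :: "kernel \<Rightarrow> (nat \<Rightarrow> real) \<Rightarrow> nat set \<Rightarrow> real" where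
  "edge_value W x e = W (x (Min e), x (Max e))"

lemma edge_value_pair:
  assumes "is_kernel W" "x i \<in> {0..1}" "x j \<in> {0..1}"
  shows "edge_value W x {i, j} = W (x i, x j)"
  using assms by (cases "i \<le> j") (auto simp: edge_value_def is_kernel_def min_def max_def)

text \<open>Lebesgue measure on the \<open>k\<close>-dimensional unit cube, that is, the completion of the product
  of the one-dimensional Borel-Lebesgue measures. Without the completion, functions such as
  \<open>\<lambda>x. W (x i, x j)\<close> need not be measurable for a Lebesgue measurable \<open>W\<close>.\<close>

definition unit_cube :: "nat \<Rightarrow> (nat \<Rightarrow> real) measure" where
  "unit_cube k = completion (Pi\<^sub>M {1..k} (\<lambda>_. restrict_space lborel {0..1}))"

fun hom_density ::
    "nat \<Rightarrow> nat set multiset \<Rightarrow> (nat \<Rightarrow> nat) \<Rightarrow> kernel \<times> signal \<Rightarrow> real" where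
  "hom_density k E d (W, f) =
     (LINT x|unit_cube k. (\<Prod>i\<in>{1..k}. f (x i) ^ d i) * (\<Prod>e\<in>#E. edge_value W x e))"


subsection \<open>Sampling\<close>

text \<open>The coordinates of a point of the unit cube are i.i.d. uniform on \<open>{0..1}\<close>, so the cube
  serves as the probability space carrying the sample \<open>X\<^sub>1, \<dots>, X\<^sub>k\<close>.\<close>

definition node_signal :: "nat \<Rightarrow> signal \<Rightarrow> (nat \<Rightarrow> real) \<Rightarrow> nat \<Rightarrow> real" where
  "node_signal k f x = (\<lambda>i\<in>{1..k}. f (x i))"

fun sampled_weighted_graph ::
    "nat \<Rightarrow> kernel \<times> signal \<Rightarrow> ((nat set \<Rightarrow> real) \<times> (nat \<Rightarrow> real)) measure" where
  "sampled_weighted_graph k (W, f) =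
     distr (unit_cube k) (Pi\<^sub>M (vertex_pairs k) (\<lambda>_. borel) \<Otimes>\<^sub>M Pi\<^sub>M {1..k} (\<lambda>_. borel))
       (\<lambda>x. (\<lambda>e\<in>vertex_pairs k. edge_value W x e, node_signal k f x))"

definition random_edges :: "nat \<Rightarrow> kernel \<Rightarrow> (nat \<Rightarrow> real) \<Rightarrow> nat set set pmf" where
  "random_edges k W x =
     map_pmf (\<lambda>b. {e \<in> vertex_pairs k. b e})
       (Pi_pmf (vertex_pairs k) False (\<lambda>e. bernoulli_pmf (edge_value W x e)))"

text \<open>A simple graph on \<open>{1..k}\<close> is represented here by its set of edges.\<close>

fun sampled_simple_graph ::
    "nat \<Rightarrow> kernel \<times> signal \<Rightarrow> (nat set set \<times> (nat \<Rightarrow> real)) measure" where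
  "sampled_simple_graph k (W, f) =
     unit_cube k \<bind>
       (\<lambda>x. distr (measure_pmf (random_edges k W x))
              (count_space (Pow (vertex_pairs k)) \<Otimes>\<^sub>M Pi\<^sub>M {1..k} (\<lambda>_. borel))
              (\<lambda>E. (E, node_signal k f x)))"

end

theory Submission
  imports Defs
begin

text \<open>
  All conditions are compared with the statement that for every \<open>\<epsilon> > 0\<close> some \<open>\<phi>\<close> makes both
  \<open>W - V\<^sup>\<phi>\<close> and \<open>f - g\<^sup>\<phi>\<close> smaller than \<open>\<epsilon>\<close> in \<open>L\<^sup>1\<close>. As all functions are bounded, this is the same as
  \<open>\<delta>\<^sub>p = 0\<close>, and it implies \<open>\<delta>\<^sub>\<box> = 0\<close>. Conversely, the cut norm of a signal is equivalent to its
  \<open>L\<^sup>1\<close> norm, while for the kernels \<open>\<parallel>W - V\<^sup>\<phi>\<parallel>\<^sub>2\<^sup>2 = \<langle>W - V\<^sup>\<phi>, W\<rangle> - \<langle>W - V\<^sup>\<phi>, V\<^sup>\<phi>\<rangle>\<close>; approximating \<open>W\<close> and \<open>V\<close>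
  by step functions bounds both inner products by a multiple of the cut norm, up to a small error.

  \<open>L\<^sup>1\<close> closeness gives equal multigraph densities, since these are Lipschitz in the kernel and the
  signal. The multigraph densities are the joint moments of the entries of the sampled weighted
  graph, so they determine its law, and conversely. The simple graph densities are in the same way,
  by inclusion-exclusion over the edges, the moments of the sampled simple graph.

  Finally, let the sampled simple graphs be equal in law. By Hoeffding's inequality and the
  law of large numbers, a large sample from \<open>(W, f)\<close> can with probability above \<open>1 / 2\<close> be arranged,
  by a bijection of its nodes with the cells of a fine partition of \<open>[0, 1]\<close>, so that it agrees with
  a step function approximation of \<open>(W, f)\<close> when tested against step functions; similarly for
  \<open>(V, g)\<close>. Hence some graph can be arranged in both ways. The two arrangements differ by a
  permutation of the cells, and the corresponding interval exchange \<open>\<phi>\<close> is as required, by the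
  same \<open>L\<^sup>2\<close> argument for the step functions.
\<close>

subsection \<open>Measure-preserving maps of the unit interval, square and cube\<close>

text \<open>Passing from equal sampled simple graphs back to the graphon-signals needs neither a
  regularity lemma nor compactness of a space of graphons: no arrangement of a given graph has to be
  found, because the sample points themselves provide one. What has to be controlled is the
  discrepancy between two arrangements of the same graph. Expanding the square of the difference of
  the two arranged step functions leaves tests of the graph against each of them, and the second
  arrangement is unknown when the first graph is analysed. Hence the tests run over all maps from
  the nodes to \<open>m\<close> blocks. There are \<open>m ^ k\<close> of these, while
  \<open>k\<close> nodes carry about \<open>k^2 / 2\<close> independent edges, so a bound of the
  form \<open>exp (- c * k^2)\<close> beats the number of tests.

  A second obstacle is measurability. The maps in \<open>ae_bijections\<close> are only Lebesgue
  measurable, and Lebesgue measure on the square and the cube is the completion of a product, not a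
  product of completions. Products of maps are therefore formed from Borel versions and corrected on
  null sets.\<close>

definition measure_preserving :: "'a measure \<Rightarrow> 'b measure \<Rightarrow> ('a \<Rightarrow> 'b) \<Rightarrow> bool" where
  "measure_preserving M N T \<longleftrightarrow> T \<in> M \<rightarrow>\<^sub>M N \<and> distr M N T = N"

lemma mpD: assumes "measure_preserving M N T" shows "T \<in> M \<rightarrow>\<^sub>M N" "distr M N T = N"
  using assms by (auto simp: measure_preserving_def)

lemma mp_integral:
  fixes h :: "'b \<Rightarrow> real"
  assumes "measure_preserving M N T" "h \<in> borel_measurable N"
  shows "(\<integral>x. h (T x) \<partial>M) = (\<integral>y. h y \<partial>N)"
  using integral_distr[of T M N h] assms by (simp add: measure_preserving_def)

lemma mp_measurable:
  assumes "measure_preserving M N T" "h \<in> N \<rightarrow>\<^sub>M L"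
  shows "(\<lambda>x. h (T x)) \<in> M \<rightarrow>\<^sub>M L"
  using assms by (auto simp: measure_preserving_def intro: measurable_compose)


lemma mp_AE:
  assumes "measure_preserving M N T" "AE y in N. P y"
  shows "AE x in M. P (T x)"
  using assms by (metis mpD AE_distrD)

lemma mp_emeasure:
  assumes "measure_preserving M N T" "A \<in> sets N"
  shows "emeasure M (T -` A \<inter> space M) = emeasure N A"
  using emeasure_distr[of T M N A] assms by (simp add: measure_preserving_def)

lemma mp_comp:
  assumes "measure_preserving M N T" "measure_preserving N L S"
  shows "measure_preserving M L (\<lambda>x. S (T x))"
proof -
  have "distr M L (S \<circ> T) = distr (distr M N T) L S"
    using assms by (intro distr_distr[symmetric]) (auto simp: measure_preserving_def)
  then show ?thesis
    using assms by (auto simp: measure_preserving_def comp_def intro: measurable_compose)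
qed

text \<open>Preimages of null sets have to be null; measure preservation, and not measurability
  alone, guarantees this, so \<open>T\<close> stays measurable after both sides are
  completed.\<close>

lemma mp_completion:
  assumes "measure_preserving M N T"
  shows "measure_preserving (completion M) (completion N) T"
proof -
  have T: "T \<in> completion M \<rightarrow>\<^sub>M N"
    using assms by (auto simp: measure_preserving_def intro: measurable_completion)
  have d: "distr (completion M) N T = N"
    using assms by (simp add: measure_preserving_def distr_completion)
  show ?thesis
    unfolding measure_preserving_def using completion.completion_distr_eq[OF T] completion.measurable_completion2[OF T] by (simp add: d)
qed

text \<open>In a complete space a change on a null set keeps measurability. The last hypothesis
  concerns every point: on the exceptional null set \<open>T'\<close> must still take values in the
  space of \<open>N\<close>.\<close>

lemma mp_cong_AE:
  assumes "measure_preserving (completion M) N T" "AE x in completion M. T x = T' x"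
    and "\<And>x. x \<in> space M \<Longrightarrow> T' x \<in> space N"
  shows "measure_preserving (completion M) N T'"
proof -
  obtain Z where Z: "Z \<in> null_sets (completion M)"
      "\<And>x. x \<in> space (completion M) - Z \<Longrightarrow> T x = T' x"
    using AE_E3[OF assms(2)] by blast
  have T: "T \<in> completion M \<rightarrow>\<^sub>M N" "distr (completion M) N T = N" using assms by (auto simp: measure_preserving_def)
  have eq: "T' -` A \<inter> space (completion M) =
     (T -` A \<inter> space (completion M) - Z) \<union> (T' -` A \<inter> space (completion M) \<inter> Z)" for A
    using Z(2) by auto
  have n: "T' -` A \<inter> space (completion M) \<inter> Z \<in> null_sets (completion M)" for A
    using completion.complete2[of "T' -` A \<inter> space (completion M) \<inter> Z" Z] Z(1) by auto
  have m: "T' \<in> completion M \<rightarrow>\<^sub>M N"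
  proof (rule measurableI)
    fix A assume A: "A \<in> sets N"
    have "T -` A \<inter> space (completion M) - Z \<in> sets (completion M)"
      by (intro sets.Diff measurable_sets[OF T(1) A] null_setsD2[OF Z(1)])
    then show "T' -` A \<inter> space (completion M) \<in> sets (completion M)"
      by (subst eq) (intro sets.Un null_setsD2[OF n])
  qed (use assms(3) in auto)
  have "distr (completion M) N T' = distr (completion M) N T"
    using assms(2) m T(1) by (intro distr_cong_AE) (auto elim: AE_mp)
  then show ?thesis using m T by (simp add: measure_preserving_def)
qed

text \<open>Lets Lebesgue measure on a subset be obtained by restricting the Borel measure and
  completing afterwards. A set of the completion is a measurable set together with part of a null
  set, and both pieces can be kept inside \<open>S\<close>.\<close>

lemma restrict_space_completion:
  assumes S: "S \<in> sets M"
  shows "restrict_space (completion M) S = completion (restrict_space M S)"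
proof -
  have Sc: "S \<inter> space (completion M) \<in> sets (completion M)" "S \<inter> space M \<in> sets M"
    using S by (auto intro!: sets.Int sets_completionI_sets)
  \<comment> \<open>\<open>V\<close> is null for both measures at once, so both values at
    \<open>A\<close> reduce to the value at the common part \<open>U\<close>.\<close>
  have 1: "\<exists>U V. A = U \<union> V \<and> U \<subseteq> S \<and> U \<in> sets M \<and> V \<in> null_sets (completion M)
      \<and> V \<in> null_sets (completion (restrict_space M S))"
    if "A \<in> sets (restrict_space (completion M) S)" for A
  proof -
    from that have A: "A \<subseteq> S" "A \<in> sets (completion M)"
      using sets_restrict_space_iff[OF Sc(1)] by auto
    obtain U N N' where U: "A = U \<union> N" "N \<subseteq> N'" "N' \<in> null_sets M" "U \<in> sets M"
      using A(2) by (rule sets_completionE)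
    have "N' \<inter> S \<in> null_sets (restrict_space M S)"
      using U S Sc by (intro null_setsI)
        (auto simp: emeasure_restrict_space sets_restrict_space_iff
              intro!: null_setsD1 null_set_Int2)
    then have "N \<in> null_sets (completion (restrict_space M S))"
      by (rule null_sets_completion_subset[rotated, OF null_sets_completionI]) (use U A in auto)
    moreover have "N \<in> null_sets (completion M)"
      by (rule null_sets_completion_subset[rotated, OF null_sets_completionI]) (use U A in auto)
    ultimately show ?thesis using U A by blast
  qed
  have 2: "A \<in> sets (restrict_space (completion M) S)"
    if A: "A \<in> sets (completion (restrict_space M S))" for A
  proof -
    obtain U N N' where U: "A = U \<union> N" "N \<subseteq> N'" "N' \<in> null_sets (restrict_space M S)"
        "U \<in> sets (restrict_space M S)"
      using A by (rule sets_completionE)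
    have "N' \<in> null_sets M"
      using null_sets_restrict_space[OF S] U by auto
    then have "N \<in> null_sets (completion M)"
      by (rule null_sets_completion_subset[rotated, OF null_sets_completionI]) (use U in auto)
    moreover have "N \<subseteq> S"
      using U null_sets_restrict_space[OF S] by (auto simp: space_restrict_space)
    moreover have "U \<in> sets M" "U \<subseteq> S"
      using U(4) by (auto simp: sets_restrict_space_iff[OF Sc(2)])
    ultimately show ?thesis
      using U(1) by (auto simp: sets_restrict_space_iff[OF Sc(1)] intro: null_setsD2)
  qed
  show ?thesis
  proof (rule measure_eqI)
    show "sets (restrict_space (completion M) S) = sets (completion (restrict_space M S))"
    proof (intro subset_antisym subsetI)
      fix A assume "A \<in> sets (restrict_space (completion M) S)"
      then obtain U V where UV: "A = U \<union> V" "U \<subseteq> S" "U \<in> sets M"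
         "V \<in> null_sets (completion (restrict_space M S))" using 1 by metis
      then have "U \<in> sets (restrict_space M S)" by (simp add: sets_restrict_space_iff[OF Sc(2)])
      then show "A \<in> sets (completion (restrict_space M S))"
        unfolding UV(1) using UV(4) by (intro sets.Un) auto
    qed (rule 2)
    fix A assume "A \<in> sets (restrict_space (completion M) S)"
    then obtain U V where UV: "A = U \<union> V" "U \<subseteq> S" "U \<in> sets M" "V \<in> null_sets (completion M)"
         "V \<in> null_sets (completion (restrict_space M S))" "A \<subseteq> S" using 1
      by (metis Int_iff sets_restrict_space_iff[OF Sc(1)])
    then have U: "U \<in> sets (restrict_space M S)" by (simp add: sets_restrict_space_iff[OF Sc(2)])
    have "emeasure (restrict_space (completion M) S) A = emeasure (completion M) (U \<union> V)"
      using UV by (subst emeasure_restrict_space[OF Sc(1)]) auto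
    also have "\<dots> = emeasure M U"
      using UV by (subst emeasure_Un_null_set) auto
    also have "\<dots> = emeasure (restrict_space M S) U"
      using UV by (subst emeasure_restrict_space[OF Sc(2)]) auto
    also have "\<dots> = emeasure (completion (restrict_space M S)) (U \<union> V)"
      using UV U by (subst emeasure_Un_null_set) auto
    finally show "emeasure (restrict_space (completion M) S) A =
        emeasure (completion (restrict_space M S)) A" using UV by simp
  qed
qed

section \<open>Interval, square and cube as completions of Borel products\<close>

abbreviation borel_interval :: "real measure" where
  "borel_interval \<equiv> restrict_space lborel {0..1}"

lemma space_borel_interval [simp]: "space borel_interval = {0..1}"
  by (simp add: space_restrict_space)

lemma prob_space_borel_interval: "prob_space borel_interval"
  by (rule prob_spaceI) (simp add: emeasure_restrict_space)

interpretation BI: prob_space borel_interval by (rule prob_space_borel_interval)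

lemma unit_interval_eq: "unit_interval = completion borel_interval"
  by (simp add: restrict_space_completion)

text \<open>The product is taken before completing: the product of two Lebesgue sigma-algebras is
  strictly smaller than the Lebesgue sigma-algebra of the square.\<close>

lemma unit_square_eq: "unit_square = completion (borel_interval \<Otimes>\<^sub>M borel_interval)"
proof -
  have "borel_interval \<Otimes>\<^sub>M borel_interval = restrict_space (lborel \<Otimes>\<^sub>M lborel) ({0..1} \<times> {0..1})"
  proof (rule pair_measure_eqI)
    let ?P = "borel_interval \<Otimes>\<^sub>M borel_interval"
    let ?R = "restrict_space (lborel \<Otimes>\<^sub>M lborel :: (real \<times> real) measure) ({0..1} \<times> {0..1})"
    have sp: "space ?P = {0..1} \<times> {0..1}" "space ?R = {0..1} \<times> {0..1}"
      by (simp_all add: space_pair_measure space_restrict_space)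
    \<comment> \<open>The sigma-algebras are identified through measurability of the identity in
      both directions.\<close>
    have 1: "(\<lambda>z. z) \<in> ?R \<rightarrow>\<^sub>M ?P"
    proof -
      have "(\<lambda>z. (fst z, snd z)) \<in> ?R \<rightarrow>\<^sub>M ?P"
        by (intro measurable_Pair measurable_restrict_space2 measurable_restrict_space1)
           (auto simp: space_restrict_space)
      then show ?thesis by simp
    qed
    have 2: "(\<lambda>z. z) \<in> ?P \<rightarrow>\<^sub>M ?R"
    proof (rule measurable_restrict_space2)
      have "(\<lambda>z. (fst z, snd z)) \<in> ?P \<rightarrow>\<^sub>M lborel \<Otimes>\<^sub>M lborel"
        by (intro measurable_Pair measurable_compose[OF measurable_fst]
            measurable_compose[OF measurable_snd] measurable_restrict_space1) auto
      then show "(\<lambda>z. z) \<in> ?P \<rightarrow>\<^sub>M lborel \<Otimes>\<^sub>M lborel" by simp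
    qed (auto simp: space_pair_measure)
    show "sets ?P = sets ?R"
    proof (intro subset_antisym subsetI)
      fix X assume X: "X \<in> sets ?P"
      show "X \<in> sets ?R"
        using measurable_sets[OF 1 X] sets.sets_into_space[OF X] sp by (simp add: Int_absorb2)
    next
      fix X assume X: "X \<in> sets ?R"
      show "X \<in> sets ?P"
        using measurable_sets[OF 2 X] sets.sets_into_space[OF X] sp by (simp add: Int_absorb2)
    qed
    fix A B assume "A \<in> sets borel_interval" "B \<in> sets borel_interval"
    then have "A \<subseteq> {0..1}" "A \<in> sets lborel" "B \<subseteq> {0..1}" "B \<in> sets lborel"
      by (auto simp: sets_restrict_space_iff)
    then show "emeasure borel_interval A * emeasure borel_interval B =
         emeasure (restrict_space (lborel \<Otimes>\<^sub>M lborel) ({0..1} \<times> {0..1})) (A \<times> B)"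
      by (subst (3) emeasure_restrict_space)
         (auto simp: emeasure_restrict_space lborel.emeasure_pair_measure_Times)
  qed (auto intro: BI.sigma_finite_measure_axioms)
  moreover have "{0..1} \<times> {0..1} \<in> sets (lborel \<Otimes>\<^sub>M lborel :: (real \<times> real) measure)"
    by (intro pair_measureI) auto
  ultimately show ?thesis
    by (subst restrict_space_completion) (simp_all add: lborel_prod flip: lborel_prod)
qed

abbreviation borel_cube :: "nat \<Rightarrow> (nat \<Rightarrow> real) measure" where
  "borel_cube k \<equiv> Pi\<^sub>M {1..k} (\<lambda>_. borel_interval)"

interpretation BC: product_prob_space "\<lambda>_::nat. borel_interval" "I" for I
  by (intro product_prob_spaceI prob_space_borel_interval)

interpretation I: prob_space unit_interval
  unfolding unit_interval_eq by (rule BI.prob_space_completion)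

interpretation BQ: prob_space "borel_interval \<Otimes>\<^sub>M borel_interval"
  by (intro prob_space_pair prob_space_borel_interval)

interpretation Q: prob_space unit_square
  unfolding unit_square_eq by (rule BQ.prob_space_completion)

lemma prob_space_unit_cube: "prob_space (unit_cube k)"
  unfolding unit_cube_def
  by (intro prob_space.prob_space_completion prob_space_PiM prob_space_borel_interval)

interpretation C: prob_space "unit_cube k" for k
  by (rule prob_space_unit_cube)

lemma space_unit_interval [simp]: "space unit_interval = {0..1}"
  by simp

lemma space_unit_square [simp]: "space unit_square = {0..1} \<times> {0..1}"
  by simp

lemma space_unit_cube: "space (unit_cube k) = {1..k} \<rightarrow>\<^sub>E {0..1}"
  by (simp add: unit_cube_def space_PiM)

lemma mp_coord:
  assumes "i \<in> {1..k}"
  shows "measure_preserving (unit_cube k) unit_interval (\<lambda>x. x i)"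
  unfolding unit_cube_def unit_interval_eq
  by (intro mp_completion) (use assms BC.PiM_component[of i "{1..k}"] in \<open>auto simp: measure_preserving_def\<close>)

text \<open>The indices must differ: for \<open>i = j\<close> the image lies in the diagonal, a null
  set. A rectangle \<open>A \<times> B\<close> pulls back to a cylinder restricting two
  coordinates.\<close>

lemma mp_coord_pair:
  assumes ij: "i \<in> {1..k}" "j \<in> {1..k}" "i \<noteq> j"
  shows "measure_preserving (unit_cube k) unit_square (\<lambda>x. (x i, x j))"
  unfolding unit_cube_def unit_square_eq
proof (intro mp_completion)
  have m: "(\<lambda>x. (x i, x j)) \<in> borel_cube k \<rightarrow>\<^sub>M borel_interval \<Otimes>\<^sub>M borel_interval"
    using ij by (auto intro!: measurable_Pair)
  have "borel_interval \<Otimes>\<^sub>M borel_interval =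
      distr (borel_cube k) (borel_interval \<Otimes>\<^sub>M borel_interval) (\<lambda>x. (x i, x j))"
  proof (rule pair_measure_eqI)
    fix A B assume AB: "A \<in> sets borel_interval" "B \<in> sets borel_interval"
    let ?X = "\<lambda>l. if l = i then A else B"
    have "emeasure (borel_cube k) {x \<in> space (borel_cube k). \<forall>l\<in>{i, j}. x l \<in> ?X l}
       = (\<Prod>l\<in>{i, j}. emeasure borel_interval (?X l))"
      by (rule BC.emeasure_PiM_Collect) (use ij AB in auto)
    also have "{x \<in> space (borel_cube k). \<forall>l\<in>{i, j}. x l \<in> ?X l} =
         (\<lambda>x. (x i, x j)) -` (A \<times> B) \<inter> space (borel_cube k)"
      using ij by auto
    finally show "emeasure borel_interval A * emeasure borel_interval B =
       emeasure (distr (borel_cube k) (borel_interval \<Otimes>\<^sub>M borel_interval) (\<lambda>x. (x i, x j))) (A \<times> B)"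
      using ij AB m by (subst emeasure_distr) auto
  qed (auto intro: BI.sigma_finite_measure_axioms)
  with m show "measure_preserving (borel_cube k) (borel_interval \<Otimes>\<^sub>M borel_interval) (\<lambda>x. (x i, x j))"
    by (simp add: measure_preserving_def)
qed

lemma mp_fst: "measure_preserving unit_square unit_interval fst"
  unfolding unit_square_eq unit_interval_eq
proof (intro mp_completion)
  have "distr (borel_interval \<Otimes>\<^sub>M borel_interval) borel_interval fst = borel_interval"
  proof (rule measure_eqI)
    fix A assume "A \<in> sets (distr (borel_interval \<Otimes>\<^sub>M borel_interval) borel_interval fst)"
    then have A: "A \<in> sets borel_interval" by simp
    have "fst -` A \<inter> space (borel_interval \<Otimes>\<^sub>M borel_interval) = A \<times> {0..1}"
      using sets.sets_into_space[OF A] by (auto simp: space_pair_measure)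
    then show "emeasure (distr (borel_interval \<Otimes>\<^sub>M borel_interval) borel_interval fst) A =
        emeasure borel_interval A"
      using A BI.emeasure_space_1
      by (simp add: emeasure_distr BI.emeasure_pair_measure_Times sets_restrict_space_iff)
  qed simp
  then show "measure_preserving (borel_interval \<Otimes>\<^sub>M borel_interval) borel_interval fst" by (simp add: measure_preserving_def)
qed

lemma mp_swap: "measure_preserving unit_square unit_square (\<lambda>(x, y). (y, x))"
  unfolding unit_square_eq
proof (intro mp_completion)
  interpret pair_sigma_finite borel_interval borel_interval ..
  show "measure_preserving (borel_interval \<Otimes>\<^sub>M borel_interval) (borel_interval \<Otimes>\<^sub>M borel_interval) (\<lambda>(x, y). (y, x))"
    using distr_pair_swap by (auto simp: measure_preserving_def case_prod_beta)
qed

lemma mp_snd: "measure_preserving unit_square unit_interval snd"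
  using mp_comp[OF mp_swap mp_fst] by (simp add: case_prod_beta)

text \<open>Product measurability is available for Borel maps only. A real Lebesgue measurable
  function has a Borel version, and the two have the same distribution since they agree almost
  everywhere.\<close>

lemma mp_borel_version:
  assumes "measure_preserving unit_interval unit_interval \<phi>"
  obtains \<psi> where "measure_preserving borel_interval borel_interval \<psi>" "AE x in unit_interval. \<phi> x = \<psi> x"
proof -
  have id: "(\<lambda>x. x) \<in> borel_measurable unit_interval"
    by (intro measurable_restrict_space1 measurable_completion) auto
  have "\<phi> \<in> borel_measurable (completion borel_interval)"
    using mp_measurable[OF assms id] by (simp add: unit_interval_eq)
  from completion_ex_borel_measurable_real[OF this] obtain h
    where h: "h \<in> borel_measurable borel_interval" "AE x in borel_interval. \<phi> x = h x" by auto
  \<comment> \<open>Clamping forces all values into the interval; it changes nothing where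
    \<open>h\<close> agrees with \<open>\<phi>\<close>, whose values already lie there.\<close>
  define \<psi> where "\<psi> x = max 0 (min 1 (h x))" for x
  have m: "\<psi> \<in> borel_interval \<rightarrow>\<^sub>M borel_interval"
    by (rule measurable_restrict_space2) (use h(1) in \<open>auto simp: \<psi>_def[abs_def]\<close>)
  have m': "\<psi> \<in> unit_interval \<rightarrow>\<^sub>M borel_interval"
    unfolding unit_interval_eq using m by (rule measurable_completion)
  have sp: "\<phi> x \<in> {0..1}" if "x \<in> {0..1}" for x
    using measurable_space[OF mpD(1)[OF assms], of x] that by simp
  have ae: "AE x in unit_interval. \<phi> x = \<psi> x"
    using AE_completion[OF h(2)] unfolding unit_interval_eq[symmetric]
    by (rule AE_mp) (rule AE_I2, use sp in \<open>force simp: \<psi>_def\<close>)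
  have "distr borel_interval borel_interval \<psi> = distr unit_interval borel_interval \<psi>"
    unfolding unit_interval_eq using m by (rule distr_completion[symmetric])
  also have "\<dots> = borel_interval"
  proof (rule measure_eqI)
    fix A assume "A \<in> sets (distr unit_interval borel_interval \<psi>)"
    then have A: "A \<in> sets borel_interval" by simp
    then have A': "A \<in> sets unit_interval" unfolding unit_interval_eq by auto
    have "emeasure (distr unit_interval borel_interval \<psi>) A =
        emeasure unit_interval (\<psi> -` A \<inter> space unit_interval)"
      using m' A by (subst emeasure_distr) auto
    also have "\<dots> = emeasure unit_interval (\<phi> -` A \<inter> space unit_interval)"
      using ae measurable_sets[OF m' A] measurable_sets[OF mpD(1)[OF assms] A']
      by (intro emeasure_eq_AE) (auto elim!: AE_mp)
    also have "\<dots> = emeasure unit_interval A" by (rule mp_emeasure[OF assms A'])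
    also have "\<dots> = emeasure borel_interval A" unfolding unit_interval_eq using A by simp
    finally show "emeasure (distr unit_interval borel_interval \<psi>) A = emeasure borel_interval A" .
  qed simp
  finally have "measure_preserving borel_interval borel_interval \<psi>" using m by (simp add: measure_preserving_def)
  then show thesis using ae by (rule that)
qed

text \<open>The product of the Borel version with itself preserves the product measure, hence its
  completion. The points where a coordinate of it differs from \<open>\<phi>\<close> form a null set
  because \<open>fst\<close> and \<open>snd\<close> pull null sets back to null sets.\<close>

lemma mp_square:
  assumes "measure_preserving unit_interval unit_interval \<phi>"
  shows "measure_preserving unit_square unit_square (\<lambda>(x, y). (\<phi> x, \<phi> y))"
proof -
  obtain \<psi> where \<psi>: "measure_preserving borel_interval borel_interval \<psi>" "AE x in unit_interval. \<phi> x = \<psi> x"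
    using mp_borel_version[OF assms] .
  have "measure_preserving (borel_interval \<Otimes>\<^sub>M borel_interval) (borel_interval \<Otimes>\<^sub>M borel_interval)
      (\<lambda>(x, y). (\<psi> x, \<psi> y))"
    unfolding measure_preserving_def
  proof
    show "(\<lambda>(x, y). (\<psi> x, \<psi> y)) \<in> borel_interval \<Otimes>\<^sub>M borel_interval \<rightarrow>\<^sub>M borel_interval \<Otimes>\<^sub>M borel_interval"
      unfolding case_prod_beta
      by (intro measurable_Pair measurable_compose[OF measurable_fst mpD(1)[OF \<psi>(1)]]
          measurable_compose[OF measurable_snd mpD(1)[OF \<psi>(1)]])
    show "distr (borel_interval \<Otimes>\<^sub>M borel_interval) (borel_interval \<Otimes>\<^sub>M borel_interval)
        (\<lambda>(x, y). (\<psi> x, \<psi> y)) = borel_interval \<Otimes>\<^sub>M borel_interval"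
      by (rule pair_measure_distr[OF mpD(1)[OF \<psi>(1)] mpD(1)[OF \<psi>(1)], unfolded mpD(2)[OF \<psi>(1)],
            OF BI.sigma_finite_measure_axioms, symmetric])
  qed
  from mp_completion[OF this] have "measure_preserving unit_square unit_square (\<lambda>(x, y). (\<psi> x, \<psi> y))"
    by (simp add: unit_square_eq)
  then show ?thesis
    unfolding unit_square_eq
  proof (rule mp_cong_AE, fold unit_square_eq)
    show "AE x in unit_square. (case x of (x, y) \<Rightarrow> (\<psi> x, \<psi> y)) = (case x of (x, y) \<Rightarrow> (\<phi> x, \<phi> y))"
      using mp_AE[OF mp_fst \<psi>(2)] mp_AE[OF mp_snd \<psi>(2)] by eventually_elim auto
    show "(case x of (x, y) \<Rightarrow> (\<phi> x, \<phi> y)) \<in> space unit_square"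
      if "x \<in> space (borel_interval \<Otimes>\<^sub>M borel_interval)" for x
      using that measurable_space[OF mpD(1)[OF assms], of "fst x"]
        measurable_space[OF mpD(1)[OF assms], of "snd x"]
      by (cases x) (simp add: space_pair_measure)
  qed
qed

text \<open>The same passage through a Borel version in \<open>k\<close> coordinates, with boxes in
  place of rectangles.\<close>

lemma mp_cube:
  assumes "measure_preserving unit_interval unit_interval \<phi>"
  shows "measure_preserving (unit_cube k) (unit_cube k) (\<lambda>x. \<lambda>i\<in>{1..k}. \<phi> (x i))"
proof -
  obtain \<psi> where \<psi>: "measure_preserving borel_interval borel_interval \<psi>" "AE x in unit_interval. \<phi> x = \<psi> x"
    using mp_borel_version[OF assms] .
  have m: "(\<lambda>x. \<lambda>i\<in>{1..k}. \<psi> (x i)) \<in> borel_cube k \<rightarrow>\<^sub>M borel_cube k"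
    using mpD(1)[OF \<psi>(1)] by (auto intro!: measurable_restrict)
  have "distr (borel_cube k) (borel_cube k) (\<lambda>x. \<lambda>i\<in>{1..k}. \<psi> (x i)) = borel_cube k"
  proof (rule BC.PiM_eqI)
    fix A assume A: "\<And>i. i \<in> {1..k} \<Longrightarrow> A i \<in> sets borel_interval"
    have "(\<lambda>x. \<lambda>i\<in>{1..k}. \<psi> (x i)) -` Pi\<^sub>E {1..k} A \<inter> space (borel_cube k) =
        (\<Pi>\<^sub>E i\<in>{1..k}. \<psi> -` A i \<inter> space borel_interval)"
      by (auto simp: space_PiM PiE_iff restrict_PiE_iff extensional_def)
    then have "emeasure (distr (borel_cube k) (borel_cube k) (\<lambda>x. \<lambda>i\<in>{1..k}. \<psi> (x i))) (Pi\<^sub>E {1..k} A)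
       = emeasure (borel_cube k) (\<Pi>\<^sub>E i\<in>{1..k}. \<psi> -` A i \<inter> space borel_interval)"
      using m A by (subst emeasure_distr) (auto intro!: sets_PiM_I_finite)
    also have "\<dots> = (\<Prod>i\<in>{1..k}. emeasure borel_interval (\<psi> -` A i \<inter> space borel_interval))"
      by (intro BC.emeasure_PiM measurable_sets[OF mpD(1)[OF \<psi>(1)]] A) auto
    also have "\<dots> = (\<Prod>i\<in>{1..k}. emeasure borel_interval (A i))"
      by (intro prod.cong refl mp_emeasure[OF \<psi>(1)] A)
    finally show "emeasure (distr (borel_cube k) (borel_cube k) (\<lambda>x. \<lambda>i\<in>{1..k}. \<psi> (x i))) (Pi\<^sub>E {1..k} A)
       = (\<Prod>i\<in>{1..k}. emeasure borel_interval (A i))" .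
  qed auto
  then have "measure_preserving (borel_cube k) (borel_cube k) (\<lambda>x. \<lambda>i\<in>{1..k}. \<psi> (x i))"
    using m by (simp add: measure_preserving_def)
  from mp_completion[OF this] have "measure_preserving (unit_cube k) (unit_cube k) (\<lambda>x. \<lambda>i\<in>{1..k}. \<psi> (x i))"
    by (simp add: unit_cube_def)
  then show ?thesis
    unfolding unit_cube_def
  proof (rule mp_cong_AE, fold unit_cube_def)
    have "AE x in unit_cube k. \<forall>i\<in>{1..k}. \<phi> (x i) = \<psi> (x i)"
      by (intro AE_finite_allI mp_AE[OF mp_coord \<psi>(2)]) auto
    then show "AE x in unit_cube k. (\<lambda>i\<in>{1..k}. \<psi> (x i)) = (\<lambda>i\<in>{1..k}. \<phi> (x i))"
      by eventually_elim (auto intro!: restrict_ext)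
    show "(\<lambda>i\<in>{1..k}. \<phi> (x i)) \<in> space (unit_cube k)" if "x \<in> space (borel_cube k)" for x
      using that measurable_space[OF mpD(1)[OF assms]]
      by (fastforce simp: space_PiM space_unit_cube PiE_iff)
  qed
qed

subsection \<open>Step functions on regular partitions\<close>

text \<open>A Lebesgue measurable function is an almost everywhere limit of continuous ones.
  Truncating these at \<open>c\<close> makes the convergence dominated, and the bound is inherited
  by every step function built from \<open>g\<close>.\<close>

lemma L1_approx_continuous:
  fixes h :: "'a::euclidean_space \<Rightarrow> real"
  assumes S: "S \<in> lmeasurable" and h: "h \<in> borel_measurable (lebesgue_on S)"
    and bound: "AE x in lebesgue_on S. \<bar>h x\<bar> \<le> c" and c: "c \<ge> 0" and e: "e > 0"
  obtains g where "continuous_on UNIV g" "\<And>x. \<bar>g x\<bar> \<le> c"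
    "(\<integral>x. \<bar>h x - g x\<bar> \<partial>lebesgue_on S) < e"
proof -
  have Sl: "S \<in> sets lebesgue" using S by (auto simp: fmeasurable_def)
  have "h measurable_on S"
    using h Sl by (simp add: measurable_on_iff_borel_measurable)
  then obtain N G where N: "negligible N" and G: "\<And>n::nat. continuous_on UNIV (G n)"
    and lim: "\<And>x. x \<notin> N \<Longrightarrow> (\<lambda>n. G n x) \<longlonglongrightarrow> (if x \<in> S then h x else 0)"
    unfolding measurable_on_def by metis
  define G' where "G' n x = max (- c) (min c (G n x))" for n x
  have cont: "continuous_on UNIV (G' n)" for n
    unfolding G'_def by (intro continuous_intros G)
  have G'b: "\<bar>G' n x\<bar> \<le> c" for n x
    using c by (auto simp: G'_def)
  have fin: "finite_measure (lebesgue_on S)"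
    using S by (rule finite_measure_lebesgue_on)
  have meas: "G' n \<in> borel_measurable (lebesgue_on S)" for n
    using cont[of n] by (intro measurable_restrict_space1 measurable_completion)
      (auto intro: borel_measurable_continuous_onI)
  have N': "AE x in lebesgue_on S. x \<notin> N"
    using N Sl by (subst AE_restrict_space_iff)
      (auto simp: negligible_iff_null_sets intro: AE_mp[OF AE_not_in])
  have "(\<lambda>n. \<integral>x. \<bar>h x - G' n x\<bar> \<partial>lebesgue_on S) \<longlonglongrightarrow> (\<integral>x. 0 \<partial>lebesgue_on S)"
  proof (rule integral_dominated_convergence)
    show "integrable (lebesgue_on S) (\<lambda>x. 2 * c)"
      using fin by (rule finite_measure.integrable_const)
    show "AE x in lebesgue_on S. (\<lambda>n. \<bar>h x - G' n x\<bar>) \<longlonglongrightarrow> 0"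
      using bound N' AE_space
    proof eventually_elim
      case (elim x)
      then have "(\<lambda>n. G n x) \<longlonglongrightarrow> h x" using lim[of x] by simp
      then have "(\<lambda>n. \<bar>h x - G' n x\<bar>) \<longlonglongrightarrow> \<bar>h x - max (- c) (min c (h x))\<bar>"
        unfolding G'_def by (intro tendsto_intros)
      then show ?case using elim by (simp add: abs_le_iff)
    qed
    show "AE x in lebesgue_on S. norm \<bar>h x - G' n x\<bar> \<le> 2 * c" for n
      using bound
    proof eventually_elim
      case (elim x)
      then show ?case using G'b[of n x] by simp
    qed
  qed (use h meas in auto)
  then have "eventually (\<lambda>n. (\<integral>x. \<bar>h x - G' n x\<bar> \<partial>lebesgue_on S) < e) sequentially"
    using e by (intro order_tendstoD) auto
  then obtain n where "(\<integral>x. \<bar>h x - G' n x\<bar> \<partial>lebesgue_on S) < e"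
    by (auto simp: eventually_sequentially)
  with cont G'b show thesis by (blast intro: that)
qed

text \<open>The cells with index below \<open>m\<close> are half-open intervals of length
  \<open>1 / m\<close>. The point 1 gets the extra index \<open>m\<close>, which is discarded as a
  null set.\<close>

definition cell :: "nat \<Rightarrow> real \<Rightarrow> nat" where
  "cell m x = nat \<lfloor>real m * x\<rfloor>"

lemma measurable_cell_borel [measurable]: "cell m \<in> borel \<rightarrow>\<^sub>M count_space UNIV"
  unfolding cell_def by measurable

lemma measurable_cell [measurable]: "cell m \<in> unit_interval \<rightarrow>\<^sub>M count_space UNIV"
  by (intro measurable_restrict_space1 measurable_completion) simp

lemma cell_bounds:
  assumes "x \<in> {0..1}" "m > 0"
  shows "real (cell m x) / m \<le> x" "x < (real (cell m x) + 1) / m" "cell m x \<le> m"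
proof -
  have "real (cell m x) = of_int \<lfloor>real m * x\<rfloor>"
    using assms by (simp add: cell_def)
  moreover have "of_int \<lfloor>real m * x\<rfloor> \<le> real m * x" "real m * x < of_int \<lfloor>real m * x\<rfloor> + 1"
    by linarith+
  ultimately show 1: "real (cell m x) / m \<le> x" "x < (real (cell m x) + 1) / m"
    using assms by (auto simp: field_simps)
  have "real (cell m x) \<le> m * x" using 1 assms by (simp add: field_simps)
  also have "\<dots> \<le> m" using assms by (simp add: mult_left_le)
  finally show "cell m x \<le> m" by simp
qed

lemma cell_less: "x \<in> {0..<1} \<Longrightarrow> m > 0 \<Longrightarrow> cell m x < m"
  using cell_bounds(1)[of x m] by (auto simp: field_simps)
    (metis (no_types, lifting) less_le_trans mult.commute mult_less_cancel_left2 not_le of_nat_0_less_iff of_nat_less_iff)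

lemma AE_less_1: "AE x in unit_interval. x < 1"
proof -
  have "{1::real} \<in> null_sets lebesgue" by (simp add: null_sets_def)
  from AE_not_in[OF this] show ?thesis
    by (subst AE_restrict_space_iff) (auto elim!: eventually_mono)
qed

lemma AE_cell_less: "m > 0 \<Longrightarrow> AE x in unit_interval. cell m x < m"
  using AE_less_1 AE_space by eventually_elim (auto intro: cell_less)

lemma cell_eq_iff:
  assumes "m > 0" "x \<ge> 0"
  shows "cell m x = a \<longleftrightarrow> real a / m \<le> x \<and> x < (real a + 1) / m"
  using assms unfolding cell_def
  by (auto simp: field_simps nat_eq_iff floor_eq_iff)

lemma emeasure_cell:
  assumes "m > 0" "a < m"
  shows "emeasure borel_interval {x \<in> {0..1}. cell m x = a} = ennreal (1 / m)"
proof -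
  have "(real a + 1) / m \<le> 1" using assms by (simp add: field_simps)
  have "x \<in> {0..1} \<and> cell m x = a \<longleftrightarrow> x \<in> {real a / m ..< (real a + 1) / m}" for x
  proof (cases "x \<ge> 0")
    case True
    then show ?thesis
      using cell_eq_iff[OF assms(1) True, of a] \<open>(real a + 1) / m \<le> 1\<close> by auto
  next
    case False
    then have "\<not> real a / m \<le> x" using divide_nonneg_nonneg[of "real a" "real m"] by linarith
    then show ?thesis using False by auto
  qed
  then have "{x \<in> {0..1}. cell m x = a} = {real a / m ..< (real a + 1) / m}" by blast
  moreover have "x \<in> {0..1}" if "x \<in> {real a / m ..< (real a + 1) / m}" for x
    using that \<open>(real a + 1) / m \<le> 1\<close> divide_nonneg_nonneg[of "real a" "real m"]
    unfolding atLeastLessThan_iff atLeastAtMost_iff by linarith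
  then have "{real a / m ..< (real a + 1) / m} \<subseteq> {0..1}" by blast
  then have "emeasure borel_interval {real a / m ..< (real a + 1) / m} = emeasure lborel {real a / m ..< (real a + 1) / m}"
    by (subst emeasure_restrict_space) auto
  ultimately show ?thesis
    using assms by (simp add: field_simps)
qed

lemma sets_cell: "{x \<in> {0..1}. cell m x = a} \<in> sets borel_interval"
proof -
  have "cell m \<in> borel_interval \<rightarrow>\<^sub>M count_space UNIV"
    by (intro measurable_restrict_space1) simp
  from measurable_sets[OF this, of "{a}"] show ?thesis
    by (simp add: vimage_def Int_def conj_commute)
qed

lemma borel_measurable_step1 [measurable]:
  fixes h :: "nat \<Rightarrow> real"
  assumes "c \<in> unit_interval \<rightarrow>\<^sub>M count_space UNIV"
  shows "(\<lambda>x. h (c x)) \<in> borel_measurable unit_interval"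
  using assms by (rule measurable_compose) simp

lemma borel_measurable_step2:
  fixes h :: "nat \<Rightarrow> nat \<Rightarrow> real"
  assumes c: "c \<in> unit_interval \<rightarrow>\<^sub>M count_space UNIV"
  shows "(\<lambda>z. h (c (fst z)) (c (snd z))) \<in> borel_measurable unit_square"
proof -
  have "(\<lambda>z. (c (fst z), c (snd z))) \<in> unit_square \<rightarrow>\<^sub>M count_space UNIV \<Otimes>\<^sub>M count_space UNIV"
    using measurable_compose[OF mpD(1)[OF mp_fst] c] measurable_compose[OF mpD(1)[OF mp_snd] c]
    by (rule measurable_Pair)
  then have 1: "(\<lambda>z. (c (fst z), c (snd z))) \<in> unit_square \<rightarrow>\<^sub>M count_space (UNIV \<times> UNIV)"
    by (subst (asm) pair_measure_countable) auto
  have "(\<lambda>z. (\<lambda>(a, b). h a b) (c (fst z), c (snd z))) \<in> borel_measurable unit_square"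
    by (rule measurable_compose[OF 1]) simp
  then show ?thesis by (simp add: case_prod_beta)
qed

lemma integral_step1:
  assumes k: "k > 0"
  shows "(\<integral>x. h (cell k x) \<partial>unit_interval) = (\<Sum>a<k. h a) / real k"
proof -
  define C where "C a = {x \<in> {0..1}. cell k x = a}" for a
  have C: "C a \<in> sets unit_interval" for a
    unfolding unit_interval_eq C_def using sets_cell by (rule sets_completionI_sets)
  have CI: "C a \<inter> {0..1} = C a" for a
    by (auto simp: C_def)
  have m: "measure unit_interval (C a) = 1 / k" if "a < k" for a
    unfolding unit_interval_eq C_def using emeasure_cell[OF k that] sets_cell
    by (simp add: measure_def)
  have "(\<integral>x. h (cell k x) \<partial>unit_interval) = (\<integral>x. (\<Sum>a<k. h a * indicator (C a) x) \<partial>unit_interval)"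
  proof (rule integral_cong_AE)
    show "AE x in unit_interval. h (cell k x) = (\<Sum>a<k. h a * indicator (C a) x)"
      using AE_cell_less[OF k] AE_space
      by eventually_elim (auto simp: C_def indicator_def if_distrib[of "(*) _"] sum.delta cong: if_cong)
    show "(\<lambda>x. \<Sum>a<k. h a * indicator (C a) x) \<in> borel_measurable unit_interval"
      using C by (intro borel_measurable_sum borel_measurable_times borel_measurable_indicator) auto
  qed simp
  also have "\<dots> = (\<Sum>a<k. h a * (1 / k))"
    using C by (subst Bochner_Integration.integral_sum) (auto simp: CI m I.emeasure_eq_measure)
  finally show ?thesis by (simp add: sum_divide_distrib)
qed

lemma integral_step2:
  assumes k: "k > 0"
  shows "(\<integral>z. h (cell k (fst z)) (cell k (snd z)) \<partial>unit_square) = (\<Sum>a<k. \<Sum>b<k. h a b) / (real k)\<^sup>2"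
proof -
  define D where "D a = {x \<in> {0..1}. cell k x = a}" for a
  define C where "C a b = D a \<times> D b" for a b
  have D: "D a \<in> sets borel_interval" for a
    unfolding D_def by (rule sets_cell)
  have CI: "C a b \<inter> {0..1} \<times> {0..1} = C a b" for a b
    by (auto simp: C_def D_def)
  have C': "C a b \<in> sets (borel_interval \<Otimes>\<^sub>M borel_interval)" for a b
    unfolding C_def by (intro pair_measureI D)
  have C: "C a b \<in> sets unit_square" for a b
    unfolding unit_square_eq using C' by (rule sets_completionI_sets)
  have m: "measure unit_square (C a b) = 1 / (real k)\<^sup>2" if "a < k" "b < k" for a b
  proof -
    have "emeasure unit_square (C a b) = ennreal (1 / k) * ennreal (1 / k)"
      unfolding unit_square_eq
      using C' emeasure_cell[OF k that(1)] emeasure_cell[OF k that(2)]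
      by (simp add: C_def BI.emeasure_pair_measure_Times[OF D D] flip: D_def del: atLeastAtMost_iff)
    then show ?thesis
      by (simp add: measure_def power2_eq_square flip: ennreal_mult)
  qed
  have "(\<integral>z. h (cell k (fst z)) (cell k (snd z)) \<partial>unit_square) =
      (\<integral>z. (\<Sum>a<k. \<Sum>b<k. h a b * indicator (C a b) z) \<partial>unit_square)"
  proof (rule integral_cong_AE)
    show "AE z in unit_square. h (cell k (fst z)) (cell k (snd z)) =
        (\<Sum>a<k. \<Sum>b<k. h a b * indicator (C a b) z)"
      using mp_AE[OF mp_fst AE_cell_less[OF k]] mp_AE[OF mp_snd AE_cell_less[OF k]] AE_space
    proof eventually_elim
      case (elim z)
      \<comment> \<open>Exactly one pair of indices contributes; nested conditionals let the double
        sum collapse one index at a time.\<close>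
      have "(\<Sum>a<k. \<Sum>b<k. h a b * indicator (C a b) z) =
         (\<Sum>a<k. \<Sum>b<k. if b = cell k (snd z) then if a = cell k (fst z) then h a b else 0 else 0)"
      proof (intro sum.cong refl)
        fix a b
        have "z \<in> C a b \<longleftrightarrow> a = cell k (fst z) \<and> b = cell k (snd z)"
          using elim(3) unfolding C_def D_def mem_Times_iff by auto
        then show "h a b * indicator (C a b) z =
            (if b = cell k (snd z) then if a = cell k (fst z) then h a b else 0 else 0)"
          by (simp add: indicator_def)
      qed
      also have "\<dots> = h (cell k (fst z)) (cell k (snd z))"
        using elim by (simp add: sum.delta)
      finally show ?case by simp
    qed
    show "(\<lambda>z. \<Sum>a<k. \<Sum>b<k. h a b * indicator (C a b) z) \<in> borel_measurable unit_square"
      using C by (intro borel_measurable_sum borel_measurable_times borel_measurable_indicator) auto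
  qed (rule borel_measurable_step2[OF measurable_cell])
  also have "\<dots> = (\<Sum>a<k. \<Sum>b<k. \<integral>z. h a b * indicator (C a b) z \<partial>unit_square)"
  proof -
    have "integrable unit_square (\<lambda>z. h a b * indicator (C a b) z)" for a b
      using C[of a b]
      by (intro integrable_mult_right Q.integrable_const_bound[of _ 1]) (auto simp: indicator_def)
    then show ?thesis
      by (simp only: Bochner_Integration.integral_sum Bochner_Integration.integrable_sum)
  qed
  also have "\<dots> = (\<Sum>a<k. \<Sum>b<k. h a b * (1 / (real k)\<^sup>2))"
  proof (intro sum.cong refl)
    fix a b assume "a \<in> {..<k}" "b \<in> {..<k}"
    then have "measure unit_square (C a b \<inter> space unit_square) = 1 / (real k)\<^sup>2"
      using m[of a b] CI[of a b] by (simp del: Times_Int_Times)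
    then show "(\<integral>z. h a b * indicator (C a b) z \<partial>unit_square) = h a b * (1 / (real k)\<^sup>2)"
      by (simp only: integral_mult_right_zero Bochner_Integration.integral_indicator)
  qed
  finally show ?thesis by (simp add: sum_divide_distrib)
qed

text \<open>A continuous approximation is sampled at the left end points of the cells. The claim
  covers all large \<open>m\<close>, since one partition will have to serve two kernels and two
  signals.\<close>

lemma L1_approx_step1:
  fixes f :: "real \<Rightarrow> real"
  assumes f: "f \<in> borel_measurable unit_interval" "AE x in unit_interval. \<bar>f x\<bar> \<le> c"
    and c: "c \<ge> 0" and e: "e > 0"
  obtains N where "\<And>m. m \<ge> N \<Longrightarrow> \<exists>a. (\<forall>i. \<bar>a i\<bar> \<le> c) \<and> (\<integral>x. \<bar>f x - a (cell m x)\<bar> \<partial>unit_interval) < e"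
proof -
  obtain g where g: "continuous_on UNIV g" "\<And>x. \<bar>g x\<bar> \<le> c"
      "(\<integral>x. \<bar>f x - g x\<bar> \<partial>unit_interval) < e / 2"
    using L1_approx_continuous[OF _ f c, of "e / 2"] e by (auto simp: lmeasurable_cbox)
  have "uniformly_continuous_on {0..1} g"
    using g(1) by (intro compact_uniformly_continuous) (auto intro: continuous_on_subset)
  then obtain d where d: "d > 0" "\<And>x y. x \<in> {0..1} \<Longrightarrow> y \<in> {0..1} \<Longrightarrow> dist y x < d \<Longrightarrow> dist (g y) (g x) < e / 2"
    unfolding uniformly_continuous_on_def using e by (metis half_gt_zero)
  obtain N where N: "N > 0" "1 / real N < d"
    using d(1) by (metis nat_approx_posE of_nat_Suc zero_less_Suc)
  have gm: "g \<in> borel_measurable unit_interval"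
    using g(1) by (intro measurable_restrict_space1 measurable_completion)
      (auto intro: borel_measurable_continuous_onI)
  show thesis
  proof (rule that[of N])
    fix m assume m: "m \<ge> N"
    then have m0: "m > 0" using N(1) by simp
    have "1 / real m \<le> 1 / real N" using m N(1) by (intro frac_le) auto
    with N(2) have md: "1 / real m < d" by linarith
    let ?a = "\<lambda>i. g (real i / real m)"
    have am: "(\<lambda>x. ?a (cell m x)) \<in> borel_measurable unit_interval"
      by (rule borel_measurable_step1) simp
    have close: "\<bar>g x - ?a (cell m x)\<bar> \<le> e / 2" if "x \<in> {0..1}" for x
    proof -
      note b = cell_bounds[OF that m0]
      have "dist x (cell m x / m) < d"
        using b md by (simp add: dist_real_def add_divide_distrib)
      moreover have "real (cell m x) / real m \<in> {0..1}" using b m0 by simp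
      ultimately show ?thesis using d(2)[of "cell m x / m" x] that by (simp add: dist_real_def)
    qed
    have i1: "integrable unit_interval (\<lambda>x. \<bar>f x - g x\<bar>)"
    proof (rule I.integrable_const_bound)
      show "AE x in unit_interval. norm \<bar>f x - g x\<bar> \<le> 2 * c"
        using f(2)
      proof eventually_elim
        case (elim x)
        then show ?case using g(2)[of x] by simp
      qed
    qed (use f gm in simp)
    have "(\<integral>x. \<bar>f x - ?a (cell m x)\<bar> \<partial>unit_interval) \<le> (\<integral>x. \<bar>f x - g x\<bar> + e / 2 \<partial>unit_interval)"
    proof (rule integral_mono')
      show "integrable unit_interval (\<lambda>x. \<bar>f x - g x\<bar> + e / 2)"
        using i1 by (intro Bochner_Integration.integrable_add I.integrable_const)
      show "\<bar>f x - ?a (cell m x)\<bar> \<le> \<bar>f x - g x\<bar> + e / 2" if "x \<in> space unit_interval" for x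
        using close[of x] that abs_triangle_ineq[of "f x - g x" "g x - ?a (cell m x)"] by simp
    qed (use e in simp)
    also have "\<dots> = (\<integral>x. \<bar>f x - g x\<bar> \<partial>unit_interval) + e / 2"
      using i1 I.prob_space by (subst Bochner_Integration.integral_add) (auto simp: I.integrable_const)
    also have "\<dots> < e" using g(3) by simp
    finally show "\<exists>a. (\<forall>i. \<bar>a i\<bar> \<le> c) \<and> (\<integral>x. \<bar>f x - a (cell m x)\<bar> \<partial>unit_interval) < e"
      using g(2) by (intro exI[of _ ?a]) auto
  qed
qed

lemma L1_approx_step2:
  fixes W :: "real \<times> real \<Rightarrow> real"
  assumes W: "W \<in> borel_measurable unit_square" "AE z in unit_square. \<bar>W z\<bar> \<le> c"
    and c: "c \<ge> 0" and e: "e > 0"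
  obtains N where "\<And>m. m \<ge> N \<Longrightarrow>
    \<exists>u. (\<forall>i j. \<bar>u i j\<bar> \<le> c) \<and> (\<integral>z. \<bar>W z - u (cell m (fst z)) (cell m (snd z))\<bar> \<partial>unit_square) < e"
proof -
  have "{0..1::real} \<times> {0..1::real} = cbox (0, 0) (1, 1)" by (subst cbox_Pair_eq) simp
  then have "{0..1::real} \<times> {0..1::real} \<in> lmeasurable" by (metis lmeasurable_cbox)
  then obtain g where g: "continuous_on UNIV g" "\<And>x. \<bar>g x\<bar> \<le> c"
      "(\<integral>x. \<bar>W x - g x\<bar> \<partial>unit_square) < e / 2"
    using L1_approx_continuous[OF _ W c, of "e / 2"] e by auto
  have "uniformly_continuous_on ({0..1} \<times> {0..1}) g"
    using g(1) by (intro compact_uniformly_continuous)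
      (auto intro: continuous_on_subset compact_Times)
  then obtain d where d: "d > 0" "\<And>x y. x \<in> {0..1} \<times> {0..1} \<Longrightarrow> y \<in> {0..1} \<times> {0..1} \<Longrightarrow>
      dist y x < d \<Longrightarrow> dist (g y) (g x) < e / 2"
    unfolding uniformly_continuous_on_def using e by (metis half_gt_zero)
  \<comment> \<open>Each coordinate moves by less than \<open>1 / m\<close>, and the Euclidean
    distance is at most the sum of both moves; hence half of \<open>d\<close> per
    coordinate.\<close>
  obtain N where N: "N > 0" "1 / real N < d / 2"
    using d(1) by (metis half_gt_zero nat_approx_posE of_nat_Suc zero_less_Suc)
  have gm: "g \<in> borel_measurable unit_square"
    using g(1) by (intro measurable_restrict_space1 measurable_completion)
      (auto intro: borel_measurable_continuous_onI)
  show thesis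
  proof (rule that[of N])
    fix m assume m: "m \<ge> N"
    then have m0: "m > 0" using N(1) by simp
    have "1 / real m \<le> 1 / real N" using m N(1) by (intro frac_le) auto
    with N(2) have md: "1 / real m < d / 2" by linarith
    let ?u = "\<lambda>i j. g (real i / real m, real j / real m)"
    have um: "(\<lambda>z. ?u (cell m (fst z)) (cell m (snd z))) \<in> borel_measurable unit_square"
      by (rule borel_measurable_step2[OF measurable_cell])
    have close: "\<bar>g z - ?u (cell m (fst z)) (cell m (snd z))\<bar> \<le> e / 2" if z01: "z \<in> {0..1} \<times> {0..1}" for z
    proof -
      obtain x y where z: "z = (x, y)" "x \<in> {0..1}" "y \<in> {0..1}" using z01 by auto
      note b = cell_bounds[OF z(2) m0] cell_bounds[OF z(3) m0]
      have "dist x (cell m x / m) < d / 2" "dist y (cell m y / m) < d / 2"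
        using b md by (simp_all add: dist_real_def add_divide_distrib)
      then have "dist z (cell m x / m, cell m y / m) < d"
        unfolding z dist_Pair_Pair by (intro le_less_trans[OF sqrt_sum_squares_le_sum]) auto
      moreover have "(real (cell m x) / real m, real (cell m y) / real m) \<in> {0..1} \<times> {0..1}"
        using b m0 by simp
      ultimately show ?thesis using d(2)[of "(cell m x / m, cell m y / m)" z] z01
        by (simp add: dist_real_def z)
    qed
    have i1: "integrable unit_square (\<lambda>x. \<bar>W x - g x\<bar>)"
    proof (rule Q.integrable_const_bound)
      show "AE x in unit_square. norm \<bar>W x - g x\<bar> \<le> 2 * c"
        using W(2)
      proof eventually_elim
        case (elim x)
        then show ?case using g(2)[of x] by simp
      qed
    qed (use W gm in simp)
    have "(\<integral>z. \<bar>W z - ?u (cell m (fst z)) (cell m (snd z))\<bar> \<partial>unit_square) \<le> (\<integral>x. \<bar>W x - g x\<bar> + e / 2 \<partial>unit_square)"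
    proof (rule integral_mono')
      show "integrable unit_square (\<lambda>x. \<bar>W x - g x\<bar> + e / 2)"
        using i1 by (intro Bochner_Integration.integrable_add Q.integrable_const)
      show "\<bar>W x - ?u (cell m (fst x)) (cell m (snd x))\<bar> \<le> \<bar>W x - g x\<bar> + e / 2"
        if "x \<in> space unit_square" for x
        using close[of x] that
          abs_triangle_ineq[of "W x - g x" "g x - ?u (cell m (fst x)) (cell m (snd x))"] by simp
    qed (use e in simp)
    also have "\<dots> = (\<integral>x. \<bar>W x - g x\<bar> \<partial>unit_square) + e / 2"
      using i1 Q.prob_space by (subst Bochner_Integration.integral_add) (auto simp: Q.integrable_const)
    also have "\<dots> < e" using g(3) by simp
    finally show "\<exists>u. (\<forall>i j. \<bar>u i j\<bar> \<le> c) \<and>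
        (\<integral>z. \<bar>W z - u (cell m (fst z)) (cell m (snd z))\<bar> \<partial>unit_square) < e"
      using g(2) by (intro exI[of _ ?u]) auto
  qed
qed

subsection \<open>Cut norm and \<open>L\<^sup>p\<close> distances\<close>

lemma INF_eq_0_iff:
  fixes F :: "'a \<Rightarrow> real"
  assumes "A \<noteq> {}" "\<And>x. x \<in> A \<Longrightarrow> F x \<ge> 0"
  shows "(INF x\<in>A. F x) = 0 \<longleftrightarrow> (\<forall>e>0. \<exists>x\<in>A. F x < e)"
proof -
  have bdd: "bdd_below (F ` A)" using assms(2) by (auto intro!: bdd_belowI[of _ 0])
  have ge: "(INF x\<in>A. F x) \<ge> 0" using assms by (intro cINF_greatest) auto
  show ?thesis
  proof
    assume "(INF x\<in>A. F x) = 0"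
    then show "\<forall>e>0. \<exists>x\<in>A. F x < e"
      using cINF_less_iff[OF assms(1) bdd] by auto
  next
    assume *: "\<forall>e>0. \<exists>x\<in>A. F x < e"
    show "(INF x\<in>A. F x) = 0"
    proof (rule antisym[OF field_le_epsilon ge])
      fix e :: real assume "e > 0"
      with * have "(INF x\<in>A. F x) < e" using cINF_less_iff[OF assms(1) bdd] by auto
      then show "(INF x\<in>A. F x) \<le> 0 + e" by simp
    qed
  qed
qed

lemma ae_bijections_mp: "\<phi> \<in> ae_bijections \<Longrightarrow> measure_preserving unit_interval unit_interval \<phi>"
  by (simp add: ae_bijections_def measure_preserving_def)

lemma id_in_ae_bijections: "(\<lambda>x. x) \<in> ae_bijections"
proof -
  have "bij_betw (\<lambda>x::real. x) {0..1} {0..1}" by (simp add: bij_betw_def)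
  then show ?thesis
    unfolding ae_bijections_def by (auto simp: distr_id intro!: exI[of _ "{0..1}"])
qed

lemma ae_bijections_nonempty: "ae_bijections \<noteq> {}"
  using id_in_ae_bijections by auto

lemma borel_measurable_rect:
  assumes "S \<in> sets unit_interval" "T \<in> sets unit_interval"
  shows "(\<lambda>z. indicator S (fst z) * indicator T (snd z) :: real) \<in> borel_measurable unit_square"
  by (intro borel_measurable_times mp_measurable[OF mp_fst] mp_measurable[OF mp_snd]
      borel_measurable_indicator assms)

lemma integral_rect:
  fixes D :: kernel
  assumes "S \<in> sets unit_interval" "T \<in> sets unit_interval"
  shows "(LINT z:S \<times> T|lebesgue. D z) =
    (\<integral>z. indicator S (fst z) * indicator T (snd z) * D z \<partial>unit_square)"
proof -
  have ST: "S \<subseteq> {0..1}" "T \<subseteq> {0..1}"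
    using assms[THEN sets.sets_into_space] by auto
  have "{0..1::real} \<times> {0..1::real} = cbox (0, 0) (1, 1)" by (subst cbox_Pair_eq) simp
  then have "{0..1::real} \<times> {0..1::real} \<in> sets lebesgue" by (metis fmeasurableD lmeasurable_cbox)
  then have m: "{0..1::real} \<times> {0..1::real} \<inter> space lebesgue \<in> sets lebesgue" by simp
  have eq: "(\<lambda>z. indicator (S \<times> T) z *\<^sub>R D z) =
      (\<lambda>z. indicator ({0..1} \<times> {0..1}) z *\<^sub>R (indicator S (fst z) * indicator T (snd z) * D z))"
  proof
    fix z
    show "indicator (S \<times> T) z *\<^sub>R D z =
      indicator ({0..1} \<times> {0..1}) z *\<^sub>R (indicator S (fst z) * indicator T (snd z) * D z)"
      using subsetD[OF ST(1), of "fst z"] subsetD[OF ST(2), of "snd z"]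
      by (cases z) (auto simp: indicator_def)
  qed
  show ?thesis
    unfolding set_lebesgue_integral_def eq by (rule integral_restrict_space[OF m, symmetric])
qed

lemma integral_interval:
  fixes h :: signal
  assumes "S \<in> sets unit_interval"
  shows "(LINT x:S|lebesgue. h x) = (\<integral>x. indicator S x * h x \<partial>unit_interval)"
proof -
  have ST: "S \<subseteq> {0..1}"
    using assms[THEN sets.sets_into_space] by auto
  then show ?thesis
    unfolding set_lebesgue_integral_def
    by (subst integral_restrict_space)
       (auto intro!: Bochner_Integration.integral_cong simp: indicator_def)
qed

section \<open>Cut norms and L1 norms\<close>

lemma rect_integral_le_L1:
  fixes D :: kernel
  assumes D: "integrable unit_square D"
    and ST: "S \<in> sets unit_interval" "T \<in> sets unit_interval"
  shows "\<bar>LINT z:S \<times> T|lebesgue. D z\<bar> \<le> (\<integral>z. \<bar>D z\<bar> \<partial>unit_square)"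
proof -
  have "\<bar>LINT z:S \<times> T|lebesgue. D z\<bar> \<le> (\<integral>z. \<bar>indicator S (fst z) * indicator T (snd z) * D z\<bar> \<partial>unit_square)"
    unfolding integral_rect[OF ST] by (rule integral_abs_bound)
  also have "\<dots> \<le> (\<integral>z. \<bar>D z\<bar> \<partial>unit_square)"
    using D by (intro integral_mono') (auto simp: indicator_def)
  finally show ?thesis .
qed

lemma interval_integral_le_L1:
  fixes h :: signal
  assumes h: "integrable unit_interval h" and S: "S \<in> sets unit_interval"
  shows "\<bar>LINT x:S|lebesgue. h x\<bar> \<le> (\<integral>x. \<bar>h x\<bar> \<partial>unit_interval)"
proof -
  have "\<bar>LINT x:S|lebesgue. h x\<bar> \<le> (\<integral>x. \<bar>indicator S x * h x\<bar> \<partial>unit_interval)"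
    unfolding integral_interval[OF S] by (rule integral_abs_bound)
  also have "\<dots> \<le> (\<integral>x. \<bar>h x\<bar> \<partial>unit_interval)"
    using h by (intro integral_mono') (auto simp: indicator_def)
  finally show ?thesis .
qed

lemma cut_norm_kernel_le_L1:
  fixes D :: kernel
  assumes D: "integrable unit_square D"
  shows "cut_norm_kernel D \<le> (\<integral>z. \<bar>D z\<bar> \<partial>unit_square)"
  unfolding cut_norm_kernel_def
  by (rule cSUP_least) (auto intro!: rect_integral_le_L1[OF D])

text \<open>Integrability of \<open>D\<close> bounds the set of test values; a real supremum over an
  unbounded set would carry no information.\<close>

lemma cut_norm_kernel_ge:
  fixes D :: kernel
  assumes D: "integrable unit_square D"
    and ST: "S \<in> sets unit_interval" "T \<in> sets unit_interval"
  shows "\<bar>\<integral>z. indicator S (fst z) * indicator T (snd z) * D z \<partial>unit_square\<bar> \<le> cut_norm_kernel D"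
proof -
  have "bdd_above ((\<lambda>(S, T). \<bar>LINT z:S \<times> T|lebesgue. D z\<bar>) ` (sets unit_interval \<times> sets unit_interval))"
    by (rule bdd_aboveI[of _ "\<integral>z. \<bar>D z\<bar> \<partial>unit_square"]) (auto intro!: rect_integral_le_L1[OF D])
  from cSUP_upper[OF _ this, of "(S, T)"] show ?thesis
    unfolding cut_norm_kernel_def integral_rect[OF ST, symmetric] using ST by simp
qed

lemma cut_norm_signal_le_L1:
  fixes h :: signal
  assumes h: "integrable unit_interval h"
  shows "cut_norm_signal h \<le> (\<integral>x. \<bar>h x\<bar> \<partial>unit_interval)"
  unfolding cut_norm_signal_def
  by (rule cSUP_least) (auto intro!: interval_integral_le_L1[OF h])

lemma cut_norm_signal_ge:
  fixes h :: signal
  assumes h: "integrable unit_interval h" and S: "S \<in> sets unit_interval"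
  shows "\<bar>\<integral>x. indicator S x * h x \<partial>unit_interval\<bar> \<le> cut_norm_signal h"
proof -
  have "bdd_above ((\<lambda>S. \<bar>LINT x:S|lebesgue. h x\<bar>) ` (sets unit_interval))"
    by (rule bdd_aboveI[of _ "\<integral>x. \<bar>h x\<bar> \<partial>unit_interval"]) (auto intro!: interval_integral_le_L1[OF h])
  from cSUP_upper[OF S this] show ?thesis
    unfolding cut_norm_signal_def integral_interval[OF S, symmetric] .
qed

text \<open>In one variable the sets where \<open>h\<close> is nonnegative and where it is negative
  are themselves test sets, and each costs one cut norm. For kernels the argument breaks down, as
  the sign sets need not be rectangles.\<close>

lemma L1_le_cut_norm_signal:
  fixes h :: signal
  assumes h: "integrable unit_interval h"
  shows "(\<integral>x. \<bar>h x\<bar> \<partial>unit_interval) \<le> 2 * cut_norm_signal h"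
proof -
  define P where "P = {x \<in> space unit_interval. h x \<ge> 0}"
  define N where "N = {x \<in> space unit_interval. h x < 0}"
  have hm: "h \<in> borel_measurable unit_interval" using h by auto
  have P: "P \<in> sets unit_interval" "N \<in> sets unit_interval"
    unfolding P_def N_def using hm by (measurable, measurable)
  have i: "integrable unit_interval (\<lambda>x. indicator P x * h x)" "integrable unit_interval (\<lambda>x. indicator N x * h x)"
    using integrable_real_mult_indicator[OF P(1) h] integrable_real_mult_indicator[OF P(2) h]
    by (simp_all add: mult.commute)
  have "(\<integral>x. \<bar>h x\<bar> \<partial>unit_interval) = (\<integral>x. indicator P x * h x - indicator N x * h x \<partial>unit_interval)"
    by (intro Bochner_Integration.integral_cong refl) (auto simp: P_def N_def indicator_def)
  also have "\<dots> = (\<integral>x. indicator P x * h x \<partial>unit_interval) - (\<integral>x. indicator N x * h x \<partial>unit_interval)"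
    using i by (rule Bochner_Integration.integral_diff)
  also have "\<dots> \<le> 2 * cut_norm_signal h"
    using cut_norm_signal_ge[OF h P(1)] cut_norm_signal_ge[OF h P(2)] by linarith
  finally show ?thesis .
qed

lemma cut_norm_kernel_nonneg: "integrable unit_square D \<Longrightarrow> cut_norm_kernel D \<ge> 0"
  using cut_norm_kernel_ge[of D "{}" "{}"] by simp

lemma cut_norm_signal_nonneg: "integrable unit_interval h \<Longrightarrow> cut_norm_signal h \<ge> 0"
  using cut_norm_signal_ge[of h "{}"] by simp

text \<open>A step function is a combination of \<open>m * m\<close> indicators of rectangles, each
  of which costs one cut norm. The classifying map \<open>c\<close> is arbitrary, so that the pulled
  back partition \<open>cell m (\<phi> x)\<close>, whose parts need not be intervals, is covered as
  well.\<close>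

lemma step_inner_bound:
  fixes c :: "real \<Rightarrow> nat"
  assumes D: "integrable unit_square D" and c: "c \<in> unit_interval \<rightarrow>\<^sub>M count_space UNIV"
    and m: "AE x in unit_interval. c x < m" and u: "\<And>i j. \<bar>u i j\<bar> \<le> 1"
  shows "\<bar>\<integral>z. D z * u (c (fst z)) (c (snd z)) \<partial>unit_square\<bar> \<le> (real m)\<^sup>2 * cut_norm_kernel D"
proof -
  define S where "S a = {x \<in> space unit_interval. c x = a}" for a
  have S: "S a \<in> sets unit_interval" for a
    using measurable_sets[OF c, of "{a}"] by (simp add: S_def vimage_def Int_def conj_commute)
  let ?t = "\<lambda>a b z. u a b * (indicator (S a) (fst z) * indicator (S b) (snd z) * D z)"
  have i: "integrable unit_square (\<lambda>z. indicator (S a) (fst z) * indicator (S b) (snd z) * D z)" for a b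
    by (rule Bochner_Integration.integrable_bound[OF D])
       (use borel_measurable_rect[OF S S] D in \<open>auto simp: indicator_def\<close>)
  have "(\<integral>z. D z * u (c (fst z)) (c (snd z)) \<partial>unit_square) = (\<integral>z. (\<Sum>a<m. \<Sum>b<m. ?t a b z) \<partial>unit_square)"
  proof (rule integral_cong_AE)
    show "AE z in unit_square. D z * u (c (fst z)) (c (snd z)) = (\<Sum>a<m. \<Sum>b<m. ?t a b z)"
      using mp_AE[OF mp_fst m] mp_AE[OF mp_snd m] AE_space
    proof eventually_elim
      case (elim z)
      have "(\<Sum>a<m. \<Sum>b<m. ?t a b z) =
          (\<Sum>a<m. \<Sum>b<m. if b = c (snd z) then if a = c (fst z) then u a b * D z else 0 else 0)"
      proof (intro sum.cong refl)
        fix a b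
        have "fst z \<in> S a \<longleftrightarrow> a = c (fst z)" "snd z \<in> S b \<longleftrightarrow> b = c (snd z)"
          using elim(3) unfolding S_def by auto
        then show "?t a b z = (if b = c (snd z) then if a = c (fst z) then u a b * D z else 0 else 0)"
          by (simp add: indicator_def)
      qed
      also have "\<dots> = u (c (fst z)) (c (snd z)) * D z"
        using elim by (simp add: sum.delta)
      finally show ?case by simp
    qed
    show "(\<lambda>z. D z * u (c (fst z)) (c (snd z))) \<in> borel_measurable unit_square"
      using borel_measurable_step2[OF c, of u] D by auto
    show "(\<lambda>z. \<Sum>a<m. \<Sum>b<m. ?t a b z) \<in> borel_measurable unit_square"
      by (intro borel_measurable_sum borel_measurable_times[OF borel_measurable_const
          borel_measurable_integrable[OF i]])
  qed
  also have "\<dots> = (\<Sum>a<m. \<Sum>b<m. u a b * (\<integral>z. indicator (S a) (fst z) * indicator (S b) (snd z) * D z \<partial>unit_square))"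
    using i by (simp only: Bochner_Integration.integral_sum Bochner_Integration.integrable_sum
        integrable_mult_right integral_mult_right_zero)
  also have "\<bar>\<dots>\<bar> \<le> (\<Sum>a<m. \<Sum>b<m. 1 * cut_norm_kernel D)"
    by (intro order_trans[OF sum_abs] sum_mono) (simp only: abs_mult, intro mult_mono u cut_norm_kernel_ge D S, auto)
  finally show ?thesis by (simp add: power2_eq_square mult.assoc)
qed

lemma integrable_bounded_square:
  "D \<in> borel_measurable unit_square \<Longrightarrow> AE z in unit_square. \<bar>D z\<bar> \<le> c \<Longrightarrow> integrable unit_square (D :: _ \<Rightarrow> real)"
  by (rule Q.integrable_const_bound[of _ c]) auto

lemma integrable_bounded_interval:
  "D \<in> borel_measurable unit_interval \<Longrightarrow> AE z in unit_interval. \<bar>D z\<bar> \<le> c \<Longrightarrow> integrable unit_interval (D :: _ \<Rightarrow> real)"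
  by (rule I.integrable_const_bound[of _ c]) auto

lemma graphon_signalsD:
  assumes "(W, f) \<in> graphon_signals r"
  shows "is_graphon W" "W \<in> borel_measurable unit_square" "\<And>z. z \<in> {0..1} \<times> {0..1} \<Longrightarrow> 0 \<le> W z \<and> W z \<le> 1"
    "AE z in unit_square. \<bar>W z\<bar> \<le> 1"
    "f \<in> borel_measurable unit_interval" "AE x in unit_interval. \<bar>f x\<bar> \<le> r" "integrable unit_square W"
    "integrable unit_interval f" "0 \<le> r"
proof -
  show G: "is_graphon W" and F: "f \<in> borel_measurable unit_interval"
    using assms by (simp_all add: graphon_signals_def)
  show W: "W \<in> borel_measurable unit_square"
    using G by (simp add: is_graphon_def is_kernel_def)
  show W1: "0 \<le> W z \<and> W z \<le> 1" if "z \<in> {0..1} \<times> {0..1}" for z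
    using assms that by (cases z) (auto simp: graphon_signals_def is_graphon_def)
  show ae: "AE z in unit_square. \<bar>W z\<bar> \<le> 1"
    by (rule AE_I2) (use W1 in auto)
  have "esssup unit_interval (\<lambda>x. ereal \<bar>f x\<bar>) \<le> ereal r"
    using assms by (auto simp: graphon_signals_def)
  then show fr: "AE x in unit_interval. \<bar>f x\<bar> \<le> r"
    using esssup_AE[of "\<lambda>x. ereal \<bar>f x\<bar>" unit_interval]
    by (auto elim!: eventually_mono dest: order_trans)
  show "integrable unit_square W" by (rule integrable_bounded_square[OF W ae])
  show "integrable unit_interval f" by (rule integrable_bounded_interval[OF F fr])
  have "AE x in unit_interval. 0 \<le> r" using fr by eventually_elim linarith
  then show "0 \<le> r" using I.AE_const by simp
qed

lemma kernel_pullback_eq: "kernel_pullback V \<phi> z = V (case z of (x, y) \<Rightarrow> (\<phi> x, \<phi> y))"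
  by (simp add: kernel_pullback_def case_prod_beta)

text \<open>One \<open>\<phi>\<close> has to serve kernel and signal. The form with \<open>e\<close>
  is essential: the infimum over almost everywhere bijective maps need not be attained.\<close>

definition L1_close :: "kernel \<Rightarrow> signal \<Rightarrow> kernel \<Rightarrow> signal \<Rightarrow> bool" where
  "L1_close W f V g \<longleftrightarrow> (\<forall>e>0. \<exists>\<phi>\<in>ae_bijections.
     (\<integral>z. \<bar>W z - kernel_pullback V \<phi> z\<bar> \<partial>unit_square) < e \<and>
     (\<integral>x. \<bar>f x - signal_pullback g \<phi> x\<bar> \<partial>unit_interval) < e)"

lemma Lp_norm_nonneg: "Lp_norm M p h \<ge> 0"
  by (simp add: Lp_norm_def)

lemma Lp_norm_1: "Lp_norm M 1 h = (\<integral>z. \<bar>h z\<bar> \<partial>M)"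
  by (simp add: Lp_norm_def)

text \<open>Interpolation with the essential bound: \<open>\<bar>h x\<bar> powr p \<le> c powr (p -
  1) * \<bar>h x\<bar>\<close> almost everywhere.\<close>

lemma Lp_norm_le:
  assumes M: "finite_measure M" and h: "h \<in> borel_measurable M" "AE x in M. \<bar>h x\<bar> \<le> c"
    and c: "c > 0" and p: "p \<ge> 1"
  shows "Lp_norm M p h \<le> (c powr (p - 1) * (\<integral>x. \<bar>h x\<bar> \<partial>M)) powr (1 / p)"
proof -
  have i: "integrable M (\<lambda>x. \<bar>h x\<bar>)"
    using finite_measure.integrable_const_bound[OF M, of "\<lambda>x. \<bar>h x\<bar>" c] h by auto
  have "(\<integral>x. \<bar>h x\<bar> powr p \<partial>M) \<le> (\<integral>x. c powr (p - 1) * \<bar>h x\<bar> \<partial>M)"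
  proof (rule integral_mono_AE')
    show "integrable M (\<lambda>x. c powr (p - 1) * \<bar>h x\<bar>)" using i by simp
    show "AE x in M. \<bar>h x\<bar> powr p \<le> c powr (p - 1) * \<bar>h x\<bar>"
      using h(2)
    proof eventually_elim
      case (elim x)
      show ?case
      proof (cases "h x = 0")
        case False
        then have "\<bar>h x\<bar> powr p = \<bar>h x\<bar> powr (p - 1) * \<bar>h x\<bar>"
          using powr_add[of "\<bar>h x\<bar>" "p - 1" 1] by simp
        also have "\<dots> \<le> c powr (p - 1) * \<bar>h x\<bar>"
          using elim p by (intro mult_right_mono powr_mono2) auto
        finally show ?thesis .
      qed simp
    qed
  qed auto
  then show ?thesis
    unfolding Lp_norm_def using p by (intro powr_mono2) (auto intro: integral_nonneg_AE)
qed

lemma Lp_norm_small: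
  assumes c: "c > 0" and p: "p \<ge> 1" and e: "(e::real) > 0"
  obtains d where "d > 0" "\<And>M h. finite_measure M \<Longrightarrow> h \<in> borel_measurable M \<Longrightarrow> AE x in M. \<bar>h x\<bar> \<le> c \<Longrightarrow>
     (\<integral>x. \<bar>h x\<bar> \<partial>M) < d \<Longrightarrow> Lp_norm M p h < e"
proof (rule that)
  \<comment> \<open>The solution \<open>d\<close> of
    \<open>(c powr (p - 1) * d) powr (1 / p) = e\<close>, the bound of \<open>Lp_norm_le\<close>. It
    depends neither on the measure nor on the function.\<close>
  let ?d = "e powr p / c powr (p - 1)"
  show "?d > 0" using c e by simp
  fix M and h :: "'a \<Rightarrow> real"
  assume *: "finite_measure M" "h \<in> borel_measurable M" "AE x in M. \<bar>h x\<bar> \<le> c" "(\<integral>x. \<bar>h x\<bar> \<partial>M) < ?d"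
  have "Lp_norm M p h \<le> (c powr (p - 1) * (\<integral>x. \<bar>h x\<bar> \<partial>M)) powr (1 / p)"
    by (rule Lp_norm_le[OF *(1-3) c p])
  also have "\<dots> < (e powr p) powr (1 / p)"
    using *(4) c p by (intro powr_less_mono2) (auto simp: field_simps integral_nonneg_AE)
  also have "\<dots> = e" using e p by (simp add: powr_powr)
  finally show "Lp_norm M p h < e" .
qed

text \<open>The pointwise inequality \<open>\<bar>D z\<bar> \<le> e / 2 + (D z)^2 / (2 * e)\<close>
  is integrated over a space of measure one and takes the place of the Cauchy-Schwarz
  inequality.\<close>

lemma L1_less_of_L2:
  fixes D :: kernel
  assumes D: "D \<in> borel_measurable unit_square" "AE z in unit_square. \<bar>D z\<bar> \<le> c"
    and e: "e > 0" "(\<integral>z. (D z)\<^sup>2 \<partial>unit_square) < e\<^sup>2"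
  shows "(\<integral>z. \<bar>D z\<bar> \<partial>unit_square) < e"
proof -
  have D2: "integrable unit_square (\<lambda>z. (D z)\<^sup>2)"
  proof (rule integrable_bounded_square)
    show "AE z in unit_square. \<bar>(D z)\<^sup>2\<bar> \<le> c\<^sup>2"
      using D(2)
    proof eventually_elim
      case (elim z)
      then show ?case using power_mono[OF elim abs_ge_zero, of 2] by simp
    qed
  qed (use D(1) in simp)
  have "(\<integral>z. \<bar>D z\<bar> \<partial>unit_square) \<le> (\<integral>z. e / 2 + (D z)\<^sup>2 / (2 * e) \<partial>unit_square)"
  proof (rule integral_mono')
    fix z
    have "0 \<le> (\<bar>D z\<bar> - e)\<^sup>2" by simp
    then show "\<bar>D z\<bar> \<le> e / 2 + (D z)\<^sup>2 / (2 * e)"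
      using e(1) by (simp add: power2_diff field_simps power2_eq_square)
  qed (use D2 e in \<open>auto intro!: Bochner_Integration.integrable_add Q.integrable_const\<close>)
  also have "\<dots> = e / 2 + (\<integral>z. (D z)\<^sup>2 \<partial>unit_square) / (2 * e)"
    using D2 Q.prob_space by (subst Bochner_Integration.integral_add) (auto simp: Q.integrable_const)
  also have "\<dots> < e / 2 + e\<^sup>2 / (2 * e)"
    using e by (intro add_strict_left_mono divide_strict_right_mono) auto
  also have "\<dots> = e" using e by (simp add: power2_eq_square)
  finally show ?thesis .
qed

section \<open>Distances between two fixed graphon-signals\<close>

context
  fixes W V :: kernel and f g :: signal and r :: real
  assumes Wf: "(W, f) \<in> graphon_signals r" and Vg: "(V, g) \<in> graphon_signals r"
begin

private lemmas W = graphon_signalsD[OF Wf]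
private lemmas V = graphon_signalsD[OF Vg]

lemma diff_kernel:
  assumes "\<phi> \<in> ae_bijections"
  shows "(\<lambda>z. W z - kernel_pullback V \<phi> z) \<in> borel_measurable unit_square"
    "AE z in unit_square. \<bar>W z - kernel_pullback V \<phi> z\<bar> \<le> 1"
    "integrable unit_square (\<lambda>z. W z - kernel_pullback V \<phi> z)"
    "kernel_pullback V \<phi> \<in> borel_measurable unit_square"
    "\<And>z. z \<in> {0..1} \<times> {0..1} \<Longrightarrow> 0 \<le> kernel_pullback V \<phi> z \<and> kernel_pullback V \<phi> z \<le> 1"
proof -
  note m = mp_square[OF ae_bijections_mp[OF assms]]
  have *: "kernel_pullback V \<phi> \<in> borel_measurable unit_square"
    using mp_measurable[OF m V(2)] by (simp add: kernel_pullback_eq[abs_def])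
  show **: "0 \<le> kernel_pullback V \<phi> z \<and> kernel_pullback V \<phi> z \<le> 1" if "z \<in> {0..1} \<times> {0..1}" for z
    unfolding kernel_pullback_eq
    by (rule V(3)) (use measurable_space[OF mpD(1)[OF m], of z] that in simp)
  show "kernel_pullback V \<phi> \<in> borel_measurable unit_square" by (rule *)
  show d: "(\<lambda>z. W z - kernel_pullback V \<phi> z) \<in> borel_measurable unit_square"
    using W(2) * by simp
  show b: "AE z in unit_square. \<bar>W z - kernel_pullback V \<phi> z\<bar> \<le> 1"
    by (rule AE_I2) (use W(3) ** in \<open>fastforce simp: abs_le_iff\<close>)
  show "integrable unit_square (\<lambda>z. W z - kernel_pullback V \<phi> z)"
    by (rule integrable_bounded_square[OF d b])
qed

lemma diff_signal:
  assumes "\<phi> \<in> ae_bijections"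
  shows "(\<lambda>x. f x - signal_pullback g \<phi> x) \<in> borel_measurable unit_interval"
    "AE x in unit_interval. \<bar>f x - signal_pullback g \<phi> x\<bar> \<le> 2 * r"
    "integrable unit_interval (\<lambda>x. f x - signal_pullback g \<phi> x)"
proof -
  note m = ae_bijections_mp[OF assms]
  show d: "(\<lambda>x. f x - signal_pullback g \<phi> x) \<in> borel_measurable unit_interval"
    using mp_measurable[OF m V(5)] W(5) by (simp add: signal_pullback_def)
  show b: "AE x in unit_interval. \<bar>f x - signal_pullback g \<phi> x\<bar> \<le> 2 * r"
    using mp_AE[OF m V(6)] W(6) by eventually_elim (simp add: signal_pullback_def)
  show "integrable unit_interval (\<lambda>x. f x - signal_pullback g \<phi> x)"
    by (rule integrable_bounded_interval[OF d b])
qed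

lemma Lp_distance_eq_0_iff:
  "Lp_distance p (W, f) (V, g) = 0 \<longleftrightarrow> (\<forall>e>0. \<exists>\<phi>\<in>ae_bijections.
      Lp_norm unit_square p (\<lambda>z. W z - kernel_pullback V \<phi> z) +
      Lp_norm unit_interval p (\<lambda>x. f x - signal_pullback g \<phi> x) < e)"
  unfolding Lp_distance.simps
  by (rule INF_eq_0_iff[OF ae_bijections_nonempty]) (auto intro: add_nonneg_nonneg Lp_norm_nonneg)

lemma Lp_iff_L1_close: "(\<forall>p\<ge>1. Lp_distance p (W, f) (V, g) = 0) \<longleftrightarrow> L1_close W f V g"
proof
  assume *: "\<forall>p\<ge>1. Lp_distance p (W, f) (V, g) = 0"
  then have 1: "Lp_distance 1 (W, f) (V, g) = 0" by simp
  show "L1_close W f V g"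
    unfolding L1_close_def
  proof (intro allI impI)
    fix e :: real assume "e > 0"
    then obtain \<phi> where \<phi>: "\<phi> \<in> ae_bijections"
      "Lp_norm unit_square 1 (\<lambda>z. W z - kernel_pullback V \<phi> z) +
      Lp_norm unit_interval 1 (\<lambda>x. f x - signal_pullback g \<phi> x) < e"
      using 1 unfolding Lp_distance_eq_0_iff by blast
    moreover note Lp_norm_nonneg[of unit_square 1 "\<lambda>z. W z - kernel_pullback V \<phi> z"]
      Lp_norm_nonneg[of unit_interval 1 "\<lambda>x. f x - signal_pullback g \<phi> x"]
    ultimately show "\<exists>\<phi>\<in>ae_bijections.
     (\<integral>z. \<bar>W z - kernel_pullback V \<phi> z\<bar> \<partial>unit_square) < e \<and>
     (\<integral>x. \<bar>f x - signal_pullback g \<phi> x\<bar> \<partial>unit_interval) < e"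
      unfolding Lp_norm_1 by (intro bexI[of _ \<phi>] conjI; linarith)
  qed
next
  assume *: "L1_close W f V g"
  show "\<forall>p\<ge>1. Lp_distance p (W, f) (V, g) = 0"
    unfolding Lp_distance_eq_0_iff
  proof (intro allI impI)
    fix p e :: real assume p: "p \<ge> 1" and e: "e > 0"
    \<comment> \<open>One bound for both differences: the kernels differ by at most 1 and the
      signals by at most \<open>2 * r\<close>. The sum is positive even for
      \<open>r = 0\<close>.\<close>
    have c: "2 * r + 1 > 0" using W(9) by simp
    obtain d where d: "d > 0" "\<And>M h. finite_measure M \<Longrightarrow> h \<in> borel_measurable M \<Longrightarrow>
        AE x in M. \<bar>h x\<bar> \<le> 2 * r + 1 \<Longrightarrow> (\<integral>x. \<bar>h x\<bar> \<partial>M) < d \<Longrightarrow> Lp_norm (M :: (real \<times> real) measure) p h < e / 2"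
      using Lp_norm_small[OF c p, of "e / 2"] e by auto
    obtain d' where d': "d' > 0" "\<And>M h. finite_measure M \<Longrightarrow> h \<in> borel_measurable M \<Longrightarrow>
        AE x in M. \<bar>h x\<bar> \<le> 2 * r + 1 \<Longrightarrow> (\<integral>x. \<bar>h x\<bar> \<partial>M) < d' \<Longrightarrow> Lp_norm (M :: real measure) p h < e / 2"
      using Lp_norm_small[OF c p, of "e / 2"] e by auto
    obtain \<phi> where \<phi>: "\<phi> \<in> ae_bijections"
       "(\<integral>z. \<bar>W z - kernel_pullback V \<phi> z\<bar> \<partial>unit_square) < min d d'"
       "(\<integral>x. \<bar>f x - signal_pullback g \<phi> x\<bar> \<partial>unit_interval) < min d d'"
      using *[unfolded L1_close_def, rule_format, of "min d d'"] d(1) d'(1) by auto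
    note k = diff_kernel[OF \<phi>(1)] and s = diff_signal[OF \<phi>(1)]
    have "Lp_norm unit_square p (\<lambda>z. W z - kernel_pullback V \<phi> z) < e / 2"
    proof (rule d(2))
      show "AE z in unit_square. \<bar>W z - kernel_pullback V \<phi> z\<bar> \<le> 2 * r + 1"
        using k(2) by eventually_elim (use W(9) in simp)
    qed (use k \<phi> Q.finite_measure_axioms in auto)
    moreover have "Lp_norm unit_interval p (\<lambda>x. f x - signal_pullback g \<phi> x) < e / 2"
    proof (rule d'(2))
      show "AE x in unit_interval. \<bar>f x - signal_pullback g \<phi> x\<bar> \<le> 2 * r + 1"
        using s(2) by eventually_elim simp
    qed (use s \<phi> I.finite_measure_axioms in auto)
    ultimately show "\<exists>\<phi>\<in>ae_bijections.
      Lp_norm unit_square p (\<lambda>z. W z - kernel_pullback V \<phi> z) +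
      Lp_norm unit_interval p (\<lambda>x. f x - signal_pullback g \<phi> x) < e"
      using \<phi>(1) by (intro bexI[of _ \<phi>]) auto
  qed
qed

lemma cut_distance_eq_0_iff:
  "cut_distance (W, f) (V, g) = 0 \<longleftrightarrow> (\<forall>e>0. \<exists>\<phi>\<in>ae_bijections.
      cut_norm_kernel (\<lambda>z. W z - kernel_pullback V \<phi> z) +
      cut_norm_signal (\<lambda>x. f x - signal_pullback g \<phi> x) < e)"
  unfolding cut_distance.simps
  by (rule INF_eq_0_iff[OF ae_bijections_nonempty])
     (auto intro: add_nonneg_nonneg cut_norm_kernel_nonneg cut_norm_signal_nonneg
        diff_kernel diff_signal)

text \<open>The constant \<open>C\<close> comes from the number of steps approximating
  \<open>W\<close> and \<open>V\<close> and does not depend on \<open>\<phi>\<close>. This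
  uniformity matters: \<open>C\<close> must be known before \<open>\<phi>\<close> is chosen with
  small cut norm.\<close>

lemma kernel_L2_le_cut_norm:
  assumes "e > 0"
  obtains C where "C \<ge> 0" "\<And>\<phi>. \<phi> \<in> ae_bijections \<Longrightarrow>
    (\<integral>z. (W z - kernel_pullback V \<phi> z)\<^sup>2 \<partial>unit_square) \<le>
      C * cut_norm_kernel (\<lambda>z. W z - kernel_pullback V \<phi> z) + e"
proof -
  have e2: "e / 2 > 0" using assms by simp
  obtain N1 where N1: "\<And>m. m \<ge> N1 \<Longrightarrow>
    \<exists>u. (\<forall>i j. \<bar>u i j\<bar> \<le> 1) \<and> (\<integral>z. \<bar>W z - u (cell m (fst z)) (cell m (snd z))\<bar> \<partial>unit_square) < e / 2"
    using L1_approx_step2[OF W(2) W(4) _ e2] by auto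
  obtain N2 where N2: "\<And>m. m \<ge> N2 \<Longrightarrow>
    \<exists>u. (\<forall>i j. \<bar>u i j\<bar> \<le> 1) \<and> (\<integral>z. \<bar>V z - u (cell m (fst z)) (cell m (snd z))\<bar> \<partial>unit_square) < e / 2"
    using L1_approx_step2[OF V(2) V(4) _ e2] by auto
  define m where "m = max 1 (max N1 N2)"
  have m: "m > 0" "m \<ge> N1" "m \<ge> N2" by (auto simp: m_def)
  obtain u where u: "\<And>i j. \<bar>u i j\<bar> \<le> 1"
    "(\<integral>z. \<bar>W z - u (cell m (fst z)) (cell m (snd z))\<bar> \<partial>unit_square) < e / 2"
    using N1[OF m(2)] by auto
  obtain v where v: "\<And>i j. \<bar>v i j\<bar> \<le> 1"
    "(\<integral>z. \<bar>V z - v (cell m (fst z)) (cell m (snd z))\<bar> \<partial>unit_square) < e / 2"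
    using N2[OF m(3)] by auto
  show thesis
  proof (rule that[of "2 * (real m)\<^sup>2"])
    fix \<phi> assume \<phi>: "\<phi> \<in> ae_bijections"
    note mp = mp_square[OF ae_bijections_mp[OF \<phi>]]
    define D where "D z = W z - kernel_pullback V \<phi> z" for z
    have D: "D \<in> borel_measurable unit_square" "AE z in unit_square. \<bar>D z\<bar> \<le> 1" "integrable unit_square D"
      using diff_kernel[OF \<phi>] unfolding D_def[abs_def] by auto
    \<comment> \<open>Stated for a general partition map \<open>c\<close>, because it is applied to
      \<open>W\<close> with the cells themselves and to the pullback of \<open>V\<close> with the
      cells pulled back by \<open>\<phi>\<close>.\<close>
    have approx: "\<bar>\<integral>z. D z * w z \<partial>unit_square\<bar> \<le> (real m)\<^sup>2 * cut_norm_kernel D + e / 2"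
      if w: "w \<in> borel_measurable unit_square" "AE z in unit_square. \<bar>w z\<bar> \<le> 1"
        and c: "c \<in> unit_interval \<rightarrow>\<^sub>M count_space UNIV" "AE x in unit_interval. c x < m"
        and t: "\<And>i j. \<bar>t i j\<bar> \<le> 1" "(\<integral>z. \<bar>w z - t (c (fst z)) (c (snd z))\<bar> \<partial>unit_square) < e / 2"
      for w :: kernel and c and t :: "nat \<Rightarrow> nat \<Rightarrow> real"
    proof -
      let ?t = "\<lambda>z. t (c (fst z)) (c (snd z))"
      have tm: "?t \<in> borel_measurable unit_square"
        by (rule borel_measurable_step2[OF c(1)])
      have i1: "integrable unit_square (\<lambda>z. D z * ?t z)"
        by (rule integrable_bounded_square[of _ 1])
           (use D tm t(1) in \<open>auto elim!: eventually_mono simp: abs_mult intro!: mult_le_one\<close>)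
      have i2: "integrable unit_square (\<lambda>z. \<bar>w z - ?t z\<bar>)"
      proof (rule integrable_bounded_square[of _ 2])
        show "AE z in unit_square. \<bar>\<bar>w z - ?t z\<bar>\<bar> \<le> 2"
          using w(2)
        proof eventually_elim
          case (elim z)
          then show ?case using t(1)[of "c (fst z)" "c (snd z)"] by linarith
        qed
      qed (use w tm in simp)
      have i3: "integrable unit_square (\<lambda>z. D z * (w z - ?t z))"
        by (rule Bochner_Integration.integrable_bound[OF i2])
           (use D w tm in \<open>auto elim!: eventually_mono simp: abs_mult intro!: mult_left_le_one_le\<close>)
      have "(\<integral>z. D z * w z \<partial>unit_square) = (\<integral>z. D z * ?t z + D z * (w z - ?t z) \<partial>unit_square)"
        by (simp add: algebra_simps)
      then have 1: "(\<integral>z. D z * w z \<partial>unit_square) =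
          (\<integral>z. D z * ?t z \<partial>unit_square) + (\<integral>z. D z * (w z - ?t z) \<partial>unit_square)"
        using Bochner_Integration.integral_add[OF i1 i3] by simp
      have 2: "\<bar>\<integral>z. D z * (w z - ?t z) \<partial>unit_square\<bar> \<le> (\<integral>z. \<bar>D z * (w z - ?t z)\<bar> \<partial>unit_square)"
        by (rule integral_abs_bound)
      have 3: "(\<integral>z. \<bar>D z * (w z - ?t z)\<bar> \<partial>unit_square) \<le> (\<integral>z. \<bar>w z - ?t z\<bar> \<partial>unit_square)"
      proof (rule integral_mono_AE'[OF i2])
        show "AE z in unit_square. \<bar>D z * (w z - ?t z)\<bar> \<le> \<bar>w z - ?t z\<bar>"
          using D(2) by eventually_elim (simp add: abs_mult mult_left_le_one_le)
      qed simp
      have 4: "\<bar>\<integral>z. D z * ?t z \<partial>unit_square\<bar> \<le> (real m)\<^sup>2 * cut_norm_kernel D"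
        by (rule step_inner_bound[OF D(3) c t(1)])
      show ?thesis using 1 2 3 4 t(2) by linarith
    qed
    have A: "\<bar>\<integral>z. D z * W z \<partial>unit_square\<bar> \<le> (real m)\<^sup>2 * cut_norm_kernel D + e / 2"
      by (rule approx[OF W(2) W(4) measurable_cell AE_cell_less[OF m(1)] u])
    have V': "kernel_pullback V \<phi> \<in> borel_measurable unit_square"
      "AE z in unit_square. \<bar>kernel_pullback V \<phi> z\<bar> \<le> 1"
      using diff_kernel(4,5)[OF \<phi>] by (auto intro!: AE_I2)
    have B: "\<bar>\<integral>z. D z * kernel_pullback V \<phi> z \<partial>unit_square\<bar> \<le> (real m)\<^sup>2 * cut_norm_kernel D + e / 2"
    proof (rule approx[OF V', where c = "\<lambda>x. cell m (\<phi> x)" and t = v])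
      show "(\<lambda>x. cell m (\<phi> x)) \<in> unit_interval \<rightarrow>\<^sub>M count_space UNIV"
        by (rule mp_measurable[OF ae_bijections_mp[OF \<phi>] measurable_cell])
      show "AE x in unit_interval. cell m (\<phi> x) < m"
        by (rule mp_AE[OF ae_bijections_mp[OF \<phi>] AE_cell_less[OF m(1)]])
      have vm: "(\<lambda>z. \<bar>V z - v (cell m (fst z)) (cell m (snd z))\<bar>) \<in> borel_measurable unit_square"
        using borel_measurable_step2[OF measurable_cell[of m], of v] V(2) by simp
      \<comment> \<open>The pullback of \<open>V\<close> is as close to the pulled back step
        function as \<open>V\<close> is to the original one, since \<open>\<phi>\<close> acting on
        both coordinates preserves the measure.\<close>
      have "(\<integral>z. \<bar>kernel_pullback V \<phi> z - v (cell m (\<phi> (fst z))) (cell m (\<phi> (snd z)))\<bar> \<partial>unit_square) =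
         (\<integral>z. \<bar>V z - v (cell m (fst z)) (cell m (snd z))\<bar> \<partial>unit_square)"
        using mp_integral[OF mp vm] by (simp add: kernel_pullback_def case_prod_beta)
      then show "(\<integral>z. \<bar>kernel_pullback V \<phi> z - v (cell m (\<phi> (fst z))) (cell m (\<phi> (snd z)))\<bar> \<partial>unit_square) < e / 2"
        using v(2) by simp
    qed (rule v(1))
    have "(\<integral>z. (D z)\<^sup>2 \<partial>unit_square) = (\<integral>z. D z * W z - D z * kernel_pullback V \<phi> z \<partial>unit_square)"
      by (simp add: D_def power2_eq_square algebra_simps)
    also have "\<dots> = (\<integral>z. D z * W z \<partial>unit_square) - (\<integral>z. D z * kernel_pullback V \<phi> z \<partial>unit_square)"
    proof (rule Bochner_Integration.integral_diff; rule integrable_bounded_square[of _ 1])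
      show "AE z in unit_square. \<bar>D z * W z\<bar> \<le> 1"
        using D(2) W(4) by eventually_elim (simp add: abs_mult mult_le_one)
      show "AE z in unit_square. \<bar>D z * kernel_pullback V \<phi> z\<bar> \<le> 1"
        using D(2) V'(2) by eventually_elim (simp add: abs_mult mult_le_one)
    qed (use D(1) W(2) V'(1) in auto)
    also have "\<dots> \<le> 2 * (real m)\<^sup>2 * cut_norm_kernel D + e"
      using A B by linarith
    finally show "(\<integral>z. (W z - kernel_pullback V \<phi> z)\<^sup>2 \<partial>unit_square) \<le>
      2 * (real m)\<^sup>2 * cut_norm_kernel (\<lambda>z. W z - kernel_pullback V \<phi> z) + e"
      by (simp add: D_def[abs_def])
  qed simp
qed

lemma cut_distance_iff_L1_close: "cut_distance (W, f) (V, g) = 0 \<longleftrightarrow> L1_close W f V g"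
proof
  assume *: "L1_close W f V g"
  show "cut_distance (W, f) (V, g) = 0"
    unfolding cut_distance_eq_0_iff
  proof (intro allI impI)
    fix e :: real assume "e > 0"
    then obtain \<phi> where \<phi>: "\<phi> \<in> ae_bijections"
       "(\<integral>z. \<bar>W z - kernel_pullback V \<phi> z\<bar> \<partial>unit_square) < e / 2"
       "(\<integral>x. \<bar>f x - signal_pullback g \<phi> x\<bar> \<partial>unit_interval) < e / 2"
      using *[unfolded L1_close_def, rule_format, of "e / 2"] by auto
    then show "\<exists>\<phi>\<in>ae_bijections. cut_norm_kernel (\<lambda>z. W z - kernel_pullback V \<phi> z) +
      cut_norm_signal (\<lambda>x. f x - signal_pullback g \<phi> x) < e"
      using cut_norm_kernel_le_L1[OF diff_kernel(3)[OF \<phi>(1)]] cut_norm_signal_le_L1[OF diff_signal(3)[OF \<phi>(1)]]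
      by (intro bexI[of _ \<phi>]) auto
  qed
next
  assume *: "cut_distance (W, f) (V, g) = 0"
  show "L1_close W f V g"
    unfolding L1_close_def
  proof (intro allI impI)
    fix e :: real assume e: "e > 0"
    then have e2: "e\<^sup>2 / 2 > 0" by simp
    obtain C where C: "C \<ge> 0" "\<And>\<phi>. \<phi> \<in> ae_bijections \<Longrightarrow>
      (\<integral>z. (W z - kernel_pullback V \<phi> z)\<^sup>2 \<partial>unit_square) \<le>
        C * cut_norm_kernel (\<lambda>z. W z - kernel_pullback V \<phi> z) + e\<^sup>2 / 2"
      using kernel_L2_le_cut_norm[OF e2] by blast
    \<comment> \<open>The first entry absorbs the factor 2 of \<open>L1_le_cut_norm_signal\<close>;
      the second yields \<open>C * d < e^2 / 2\<close>, the share of the squared kernel distance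
      left over by the approximation error. Using \<open>C + 1\<close> avoids a division by
      zero.\<close>
    define d where "d = min (e / 2) (e\<^sup>2 / (2 * (C + 1)))"
    have d: "d > 0" using e C(1) by (simp add: d_def)
    have Cd: "C * d < e\<^sup>2 / 2"
    proof -
      have "C * d < (C + 1) * d" using d by simp
      also have "\<dots> \<le> (C + 1) * (e\<^sup>2 / (2 * (C + 1)))"
        using C(1) by (intro mult_left_mono) (auto simp: d_def)
      also have "\<dots> = e\<^sup>2 / 2" using C(1) by (simp add: field_simps)
      finally show ?thesis .
    qed
    obtain \<phi> where \<phi>: "\<phi> \<in> ae_bijections"
      "cut_norm_kernel (\<lambda>z. W z - kernel_pullback V \<phi> z) +
       cut_norm_signal (\<lambda>x. f x - signal_pullback g \<phi> x) < d"
      using * d unfolding cut_distance_eq_0_iff by blast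
    note k = diff_kernel[OF \<phi>(1)] and s = diff_signal[OF \<phi>(1)]
    have n: "cut_norm_kernel (\<lambda>z. W z - kernel_pullback V \<phi> z) < d"
      "cut_norm_signal (\<lambda>x. f x - signal_pullback g \<phi> x) < d"
      using \<phi>(2) cut_norm_kernel_nonneg[OF k(3)] cut_norm_signal_nonneg[OF s(3)] by linarith+
    have "(\<integral>z. (W z - kernel_pullback V \<phi> z)\<^sup>2 \<partial>unit_square) < e\<^sup>2"
      using C(2)[OF \<phi>(1)] mult_left_mono[OF less_imp_le[OF n(1)] C(1)] Cd by linarith
    then have "(\<integral>z. \<bar>W z - kernel_pullback V \<phi> z\<bar> \<partial>unit_square) < e"
      by (rule L1_less_of_L2[OF k(1,2) e])
    moreover have "(\<integral>x. \<bar>f x - signal_pullback g \<phi> x\<bar> \<partial>unit_interval) < e"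
      using L1_le_cut_norm_signal[OF s(3)] n(2) by (simp add: d_def)
    ultimately show "\<exists>\<phi>\<in>ae_bijections.
     (\<integral>z. \<bar>W z - kernel_pullback V \<phi> z\<bar> \<partial>unit_square) < e \<and>
     (\<integral>x. \<bar>f x - signal_pullback g \<phi> x\<bar> \<partial>unit_interval) < e"
      using \<phi>(1) by blast
  qed
qed

end

subsection \<open>Moments determine bounded random variables\<close>

text \<open>The bound is only required almost everywhere, as the values of a signal are controlled
  by an essential supremum. Measurability is included so that the property is closed under products
  and powers and gives integrability.\<close>

definition ess_bounded :: "'a measure \<Rightarrow> ('a \<Rightarrow> real) \<Rightarrow> bool" where
  "ess_bounded M h \<longleftrightarrow> h \<in> borel_measurable M \<and> (\<exists>c. AE x in M. \<bar>h x\<bar> \<le> c)"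

lemma ess_boundedI: "h \<in> borel_measurable M \<Longrightarrow> AE x in M. \<bar>h x\<bar> \<le> c \<Longrightarrow> ess_bounded M h"
  by (auto simp: ess_bounded_def)

lemma ess_bounded_measurable: "ess_bounded M h \<Longrightarrow> h \<in> borel_measurable M"
  by (simp add: ess_bounded_def)

lemma ess_boundedE:
  assumes "ess_bounded M h"
  obtains c where "c \<ge> 0" "AE x in M. \<bar>h x\<bar> \<le> c"
proof -
  from assms obtain c where "AE x in M. \<bar>h x\<bar> \<le> c" by (auto simp: ess_bounded_def)
  then have "AE x in M. \<bar>h x\<bar> \<le> max 0 c" by eventually_elim simp
  then show thesis by (intro that[of "max 0 c"]) auto
qed

lemma (in prob_space) ess_bounded_integrable:
  assumes "ess_bounded M h"
  shows "integrable M h"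
proof -
  obtain c where "AE x in M. \<bar>h x\<bar> \<le> c" using assms by (rule ess_boundedE)
  then show ?thesis
    using ess_bounded_measurable[OF assms] by (intro integrable_const_bound[of _ c]) auto
qed

lemma ess_bounded_const: "ess_bounded M (\<lambda>x. c)"
  by (rule ess_boundedI[of _ _ "\<bar>c\<bar>"]) auto

lemma ess_bounded_mult:
  assumes "ess_bounded M g" "ess_bounded M h"
  shows "ess_bounded M (\<lambda>x. g x * h x)"
proof -
  obtain c d where c: "c \<ge> 0" "AE x in M. \<bar>g x\<bar> \<le> c" "AE x in M. \<bar>h x\<bar> \<le> d" "d \<ge> 0"
    using assms by (metis ess_boundedE)
  have "AE x in M. \<bar>g x * h x\<bar> \<le> c * d"
    using c(2,3) by eventually_elim (auto simp: abs_mult intro!: mult_mono c)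
  then show ?thesis
    using assms by (auto simp: ess_bounded_def)
qed

lemma ess_bounded_add:
  assumes "ess_bounded M g" "ess_bounded M h"
  shows "ess_bounded M (\<lambda>x. g x + h x)"
proof -
  obtain c d where c: "AE x in M. \<bar>g x\<bar> \<le> c" "AE x in M. \<bar>h x\<bar> \<le> d"
    using assms by (metis ess_boundedE)
  have "AE x in M. \<bar>g x + h x\<bar> \<le> c + d"
    using c by eventually_elim linarith
  then show ?thesis
    using assms by (auto simp: ess_bounded_def)
qed

lemma ess_bounded_minus: "ess_bounded M h \<Longrightarrow> ess_bounded M (\<lambda>x. - h x)"
  by (auto simp: ess_bounded_def)

lemma ess_bounded_diff:
  "ess_bounded M g \<Longrightarrow> ess_bounded M h \<Longrightarrow> ess_bounded M (\<lambda>x. g x - h x)"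
  using ess_bounded_add[of M g "\<lambda>x. - h x"] ess_bounded_minus by auto

lemma ess_bounded_power: "ess_bounded M h \<Longrightarrow> ess_bounded M (\<lambda>x. h x ^ n)"
  by (induction n) (auto intro: ess_bounded_const ess_bounded_mult)

lemma ess_bounded_prod:
  "(\<And>i. i \<in> I \<Longrightarrow> ess_bounded M (h i)) \<Longrightarrow> ess_bounded M (\<lambda>x. \<Prod>i\<in>I. h i x)"
  by (induction I rule: infinite_finite_induct) (auto intro: ess_bounded_const ess_bounded_mult)

lemma ess_bounded_compose:
  assumes "h \<in> borel_measurable borel" "\<And>y. \<bar>h y\<bar> \<le> c" "Y \<in> borel_measurable M"
  shows "ess_bounded M (\<lambda>x. h (Y x))"
  by (rule ess_boundedI[of _ _ c]) (use assms in \<open>auto intro: measurable_compose\<close>)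

lemma ess_bounded_indicator:
  "B \<in> sets borel \<Longrightarrow> Y \<in> borel_measurable M \<Longrightarrow> ess_bounded M (\<lambda>x. indicator B (Y x))"
  by (rule ess_bounded_compose[of _ 1]) (auto simp: indicator_def)

lemma ess_bounded_mp: "measure_preserving M N T \<Longrightarrow> ess_bounded N h \<Longrightarrow> ess_bounded M (\<lambda>x. h (T x))"
  unfolding ess_bounded_def using mp_measurable mp_AE by blast

context prob_space
begin

section \<open>Weighted moments of a single variable\<close>

context
  fixes Y Z R R' :: "'a \<Rightarrow> real"
  assumes Y: "ess_bounded M Y" and Z: "ess_bounded M Z"
    and R: "ess_bounded M R" and R': "ess_bounded M R'"
    and moments: "\<And>d. expectation (\<lambda>x. R x * Y x ^ d) = expectation (\<lambda>x. R' x * Z x ^ d)"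
begin

text \<open>The weights \<open>R\<close> and \<open>R'\<close> are there for the later induction
  over coordinates: while one variable is treated, the factors coming from all other variables are
  hidden in them.\<close>

lemma moments_polynomial:
  assumes "real_polynomial_function p"
  shows "expectation (\<lambda>x. R x * p (Y x)) = expectation (\<lambda>x. R' x * p (Z x))"
proof -
  obtain a n where p: "p = (\<lambda>x. \<Sum>i\<le>n. a i * x ^ i)"
    using assms real_polynomial_function_iff_sum by metis
  have *: "expectation (\<lambda>x. S x * p (X x)) = (\<Sum>i\<le>n. a i * expectation (\<lambda>x. S x * X x ^ i))"
    if "ess_bounded M S" "ess_bounded M X" for S X
  proof -
    have i: "integrable M (\<lambda>x. S x * X x ^ i)" for i
      by (intro ess_bounded_integrable ess_bounded_mult ess_bounded_power that)
    have "expectation (\<lambda>x. S x * p (X x)) = expectation (\<lambda>x. \<Sum>i\<le>n. a i * (S x * X x ^ i))"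
      by (simp add: p sum_distrib_left mult_ac)
    also have "\<dots> = (\<Sum>i\<le>n. a i * expectation (\<lambda>x. S x * X x ^ i))"
      using i by (subst Bochner_Integration.integral_sum) auto
    finally show ?thesis .
  qed
  show ?thesis
    unfolding *[OF R Y] *[OF R' Z] moments ..
qed

text \<open>Almost all values of \<open>Y\<close> and \<open>Z\<close> lie in one compact interval,
  so \<open>h\<close> may be replaced there by a polynomial. A uniform error \<open>e'\<close> costs
  at most \<open>cR * e'\<close> and \<open>cR' * e'\<close>.\<close>

lemma moments_continuous:
  assumes h: "continuous_on UNIV h" "\<And>y. \<bar>h y\<bar> \<le> b"
  shows "expectation (\<lambda>x. R x * h (Y x)) = expectation (\<lambda>x. R' x * h (Z x))"
proof -
  obtain cY where cY: "AE x in M. \<bar>Y x\<bar> \<le> cY" using Y by (rule ess_boundedE)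
  obtain cZ where cZ: "AE x in M. \<bar>Z x\<bar> \<le> cZ" using Z by (rule ess_boundedE)
  obtain cR where cR: "cR \<ge> 0" "AE x in M. \<bar>R x\<bar> \<le> cR" using R by (rule ess_boundedE)
  obtain cR' where cR': "cR' \<ge> 0" "AE x in M. \<bar>R' x\<bar> \<le> cR'" using R' by (rule ess_boundedE)
  define c where "c = max cY cZ"
  have hb: "h \<in> borel_measurable borel" using h(1) by (rule borel_measurable_continuous_onI)
  have bound: "\<bar>expectation (\<lambda>x. S x * h (X x)) - expectation (\<lambda>x. S x * p (X x))\<bar> \<le> cS * e"
    if S: "ess_bounded M S" "AE x in M. \<bar>S x\<bar> \<le> cS" and X: "ess_bounded M X" "AE x in M. \<bar>X x\<bar> \<le> c"
      and p: "real_polynomial_function p" "\<And>y. y \<in> {- c..c} \<Longrightarrow> \<bar>h y - p y\<bar> < e" for S X p cS e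
  proof -
    have pc: "p \<in> borel_measurable borel"
      using p(1) by (intro borel_measurable_continuous_onI continuous_on_polymonial_function)
        (simp add: real_polynomial_function_eq)
    have d: "AE x in M. \<bar>h (X x) - p (X x)\<bar> \<le> e"
      using X(2)
    proof eventually_elim
      case (elim x)
      then have "X x \<in> {- c..c}" by (simp add: abs_le_iff)
      from p(2)[OF this] show ?case by simp
    qed
    have Xm: "X \<in> borel_measurable M" using X(1) by (rule ess_bounded_measurable)
    have 1: "ess_bounded M (\<lambda>x. h (X x))" by (rule ess_bounded_compose[OF hb h(2) Xm])
    have 2: "ess_bounded M (\<lambda>x. h (X x) - p (X x))"
      by (rule ess_boundedI[OF _ d])
         (intro borel_measurable_diff measurable_compose[OF Xm hb] measurable_compose[OF Xm pc])
    have 3: "ess_bounded M (\<lambda>x. p (X x))"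
      using ess_bounded_diff[OF 1 2] by simp
    have i: "integrable M (\<lambda>x. S x * h (X x))" "integrable M (\<lambda>x. S x * p (X x))"
      "integrable M (\<lambda>x. S x * (h (X x) - p (X x)))"
      using S(1) 1 2 3 by (auto intro!: ess_bounded_integrable ess_bounded_mult)
    have "expectation (\<lambda>x. S x * h (X x)) - expectation (\<lambda>x. S x * p (X x)) =
        expectation (\<lambda>x. S x * (h (X x) - p (X x)))"
      using Bochner_Integration.integral_diff[OF i(1,2)] by (simp add: right_diff_distrib)
    also have "\<bar>\<dots>\<bar> \<le> expectation (\<lambda>x. \<bar>S x * (h (X x) - p (X x))\<bar>)"
      by (rule integral_abs_bound)
    also have "\<dots> \<le> expectation (\<lambda>x. cS * e)"
    proof (rule integral_mono_AE)
      show "AE x in M. \<bar>S x * (h (X x) - p (X x))\<bar> \<le> cS * e"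
        using S(2) d by eventually_elim (auto simp: abs_mult intro!: mult_mono)
    qed (use i in auto)
    finally show ?thesis using prob_space by simp
  qed
  have Yc: "AE x in M. \<bar>Y x\<bar> \<le> c" using cY by eventually_elim (simp add: c_def)
  have Zc: "AE x in M. \<bar>Z x\<bar> \<le> c" using cZ by eventually_elim (simp add: c_def)
  have "\<bar>expectation (\<lambda>x. R x * h (Y x)) - expectation (\<lambda>x. R' x * h (Z x))\<bar> \<le> 0 + e" if e: "e > 0" for e
  proof -
    define e' where "e' = e / (cR + cR' + 1)"
    have e': "e' > 0" using e cR cR' by (simp add: e'_def)
    obtain p where p: "real_polynomial_function p" "\<And>y. y \<in> {- c..c} \<Longrightarrow> \<bar>h y - p y\<bar> < e'"
      using Stone_Weierstrass_real_polynomial_function[OF compact_Icc continuous_on_subset[OF h(1)] e', of "- c" c]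
      by auto
    have "cR * e' + cR' * e' \<le> (cR + cR' + 1) * e'" using e' by (simp add: algebra_simps)
    also have "\<dots> = e" using cR(1) cR'(1) by (simp add: e'_def)
    finally show ?thesis
      using bound[OF R cR(2) Y Yc p] bound[OF R' cR'(2) Z Zc p] moments_polynomial[OF p(1)] by linarith
  qed
  then have "\<bar>expectation (\<lambda>x. R x * h (Y x)) - expectation (\<lambda>x. R' x * h (Z x))\<bar> \<le> 0"
    by (rule field_le_epsilon)
  then show ?thesis by simp
qed

lemma moments_atMost:
  "expectation (\<lambda>x. R x * indicator {..a} (Y x)) = expectation (\<lambda>x. R' x * indicator {..a} (Z x))"
proof -
  \<comment> \<open>Continuous and piecewise linear: equal to 1 up to \<open>a\<close>, then falling
    with slope \<open>- n\<close>, so the functions converge pointwise to the indicator of the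
    half-line.\<close>
  define h where "h n y = max 0 (min 1 (1 - real n * (y - a)))" for n y
  have hc: "continuous_on UNIV (h n)" for n unfolding h_def by (intro continuous_intros)
  have hb: "\<bar>h n y\<bar> \<le> 1" for n y by (simp add: h_def)
  have hl: "(\<lambda>n. h n y) \<longlonglongrightarrow> indicator {..a} y" for y
  proof (cases "y \<le> a")
    case True
    then have "h n y = 1" for n
      using mult_nonneg_nonneg[of "real n" "a - y"] by (simp add: h_def algebra_simps)
    then show ?thesis using True by simp
  next
    case False
    obtain N where N: "1 / (y - a) < real N" using reals_Archimedean2 by blast
    have "h n y = 0" if "n \<ge> N" for n
    proof -
      have "1 < real N * (y - a)" using N False by (simp add: field_simps)
      also have "\<dots> \<le> real n * (y - a)" using that False by (intro mult_right_mono) auto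
      finally show ?thesis by (simp add: h_def)
    qed
    then have "eventually (\<lambda>n. h n y = indicator {..a} y) sequentially"
      using False by (auto simp: eventually_sequentially)
    then show ?thesis by (rule tendsto_eventually)
  qed
  have lim: "(\<lambda>n. expectation (\<lambda>x. S x * h n (X x))) \<longlonglongrightarrow> expectation (\<lambda>x. S x * indicator {..a} (X x))"
    if S: "ess_bounded M S" and X: "ess_bounded M X" for S X
  proof (rule integral_dominated_convergence)
    note Xm = ess_bounded_measurable[OF X] and Sm = ess_bounded_measurable[OF S]
    show "integrable M (\<lambda>x. \<bar>S x\<bar>)" using ess_bounded_integrable[OF S] by simp
    show "AE x in M. (\<lambda>n. S x * h n (X x)) \<longlonglongrightarrow> S x * indicator {..a} (X x)"
      by (intro AE_I2 tendsto_intros hl)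
    show "AE x in M. norm (S x * h n (X x)) \<le> \<bar>S x\<bar>" for n
      using hb by (intro AE_I2) (simp add: abs_mult mult_left_le)
    show "(\<lambda>x. S x * h n (X x)) \<in> borel_measurable M" for n
      by (intro borel_measurable_times Sm measurable_compose[OF Xm] borel_measurable_continuous_onI hc)
    show "(\<lambda>x. S x * indicator {..a} (X x)) \<in> borel_measurable M"
      using Sm Xm by simp
  qed
  have eq: "(\<lambda>n. expectation (\<lambda>x. R x * h n (Y x))) = (\<lambda>n. expectation (\<lambda>x. R' x * h n (Z x)))"
    by (intro ext moments_continuous[OF hc hb])
  show ?thesis by (rule LIMSEQ_unique[OF lim[OF R Y, unfolded eq] lim[OF R' Z]])
qed

text \<open>The half-lines form an intersection-stable generator of the Borel sets, and the sets
  with the asserted property are closed under complements and countable disjoint unions.\<close>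

lemma moments_indicator:
  assumes "B \<in> sets borel"
  shows "expectation (\<lambda>x. R x * indicator B (Y x)) = expectation (\<lambda>x. R' x * indicator B (Z x))"
proof -
  note Ym = ess_bounded_measurable[OF Y] and Zm = ess_bounded_measurable[OF Z]
  have gen: "sets borel = sigma_sets UNIV (range (\<lambda>a::real. {..a}))"
    by (subst borel_eq_atMost) (rule sets_measure_of, simp)
  have int: "integrable M (\<lambda>x. S x * indicator A (X x))"
    if "ess_bounded M S" "X \<in> borel_measurable M" "A \<in> sets borel" for S X and A :: "real set"
    using that by (intro ess_bounded_integrable ess_bounded_mult ess_bounded_indicator)
  have "Int_stable (range (\<lambda>a::real. {..a}))"
    by (auto simp: Int_stable_def)
  moreover have "range (\<lambda>a::real. {..a}) \<subseteq> Pow UNIV" by simp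
  moreover have "B \<in> sigma_sets UNIV (range (\<lambda>a::real. {..a}))" using assms gen by simp
  ultimately show ?thesis
  proof (induction rule: sigma_sets_induct_disjoint)
    case (basic A)
    then show ?case using moments_atMost by auto
  next
    case empty
    show ?case by simp
  next
    case (compl A)
    then have A: "A \<in> sets borel" using gen by simp
    have *: "expectation (\<lambda>x. S x * indicator (UNIV - A) (X x)) =
       expectation S - expectation (\<lambda>x. S x * indicator A (X x))"
      if S: "ess_bounded M S" and X: "X \<in> borel_measurable M" for S X
    proof -
      have "expectation (\<lambda>x. S x * indicator (UNIV - A) (X x)) =
          expectation (\<lambda>x. S x - S x * indicator A (X x))"
        by (intro Bochner_Integration.integral_cong refl) (simp add: indicator_def)
      also have "\<dots> = expectation S - expectation (\<lambda>x. S x * indicator A (X x))"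
        using ess_bounded_integrable[OF S] int[OF S X A] by (rule Bochner_Integration.integral_diff)
      finally show ?thesis .
    qed
    \<comment> \<open>The moment of order 0 says that \<open>R\<close> and \<open>R'\<close> have
      equal integrals, which is what passing to complements requires.\<close>
    show ?case
      using *[OF R Ym] *[OF R' Zm] compl moments[of 0] by simp
  next
    case (union A)
    then have A: "A i \<in> sets borel" for i using gen by auto
    have *: "(\<lambda>n. expectation (\<lambda>x. S x * indicator (\<Union>i<n. A i) (X x))) \<longlonglongrightarrow>
         expectation (\<lambda>x. S x * indicator (\<Union>i. A i) (X x))"
      if S: "ess_bounded M S" and X: "X \<in> borel_measurable M" for S X
    proof (rule integral_dominated_convergence)
      have "(\<lambda>n. indicator (\<Union>i<n. A i) y :: real) \<longlonglongrightarrow> indicator (\<Union>i. A i) y" for y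
      proof (cases "y \<in> (\<Union>i. A i)")
        case True
        then obtain i where "y \<in> A i" by auto
        then have "eventually (\<lambda>n. indicator (\<Union>i<n. A i) y = (indicator (\<Union>i. A i) y :: real)) sequentially"
          using True by (auto simp: eventually_sequentially indicator_def intro!: exI[of _ "Suc i"])
        then show ?thesis by (rule tendsto_eventually)
      next
        case False
        then show ?thesis by (simp add: indicator_def)
      qed
      then show "AE x in M. (\<lambda>n. S x * indicator (\<Union>i<n. A i) (X x)) \<longlonglongrightarrow> S x * indicator (\<Union>i. A i) (X x)"
        by (intro AE_I2 tendsto_mult tendsto_const) auto
      show "integrable M (\<lambda>x. \<bar>S x\<bar>)" using ess_bounded_integrable[OF S] by simp
      show "AE x in M. norm (S x * indicator (\<Union>i<n. A i) (X x)) \<le> \<bar>S x\<bar>" for n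
        by (intro AE_I2) (simp add: indicator_def)
      show "(\<lambda>x. S x * indicator (\<Union>i<n. A i) (X x)) \<in> borel_measurable M" for n
        using A by (intro borel_measurable_integrable int S X) auto
      show "(\<lambda>x. S x * indicator (\<Union>i. A i) (X x)) \<in> borel_measurable M"
        using A by (intro borel_measurable_integrable int S X) auto
    qed
    have **: "expectation (\<lambda>x. S x * indicator (\<Union>i<n. A i) (X x)) =
       (\<Sum>i<n. expectation (\<lambda>x. S x * indicator (A i) (X x)))"
      if S: "ess_bounded M S" and X: "X \<in> borel_measurable M" for S X n
    proof -
      have "disjoint_family_on A {..<n}" using union(1) by (auto simp: disjoint_family_on_def)
      then have "indicator (\<Union>i<n. A i) y = (\<Sum>i<n. indicator (A i) y :: real)" for y
        by (intro indicator_UN_disjoint) auto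
      then show ?thesis
        using int[OF S X A]
        by (simp only: sum_distrib_left Bochner_Integration.integral_sum)
    qed
    show ?case
      using *[OF R Ym] *[OF R' Zm] union(3) unfolding **[OF R Ym] **[OF R' Zm]
      by (simp add: LIMSEQ_unique)
  qed
qed

end

text \<open>Powers are exchanged for indicators one coordinate at a time. \<open>J\<close> is the
  set of coordinates already exchanged; the others keep arbitrary exponents, and everything except
  the current coordinate serves as the weight of the one-variable statement.\<close>

lemma moments_determine:
  fixes Y Z :: "'i \<Rightarrow> 'a \<Rightarrow> real"
  assumes I: "finite I"
    and Y: "\<And>i. i \<in> I \<Longrightarrow> ess_bounded M (Y i)" and Z: "\<And>i. i \<in> I \<Longrightarrow> ess_bounded M (Z i)"
    and R: "ess_bounded M R" and R': "ess_bounded M R'"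
    and moments: "\<And>D. expectation (\<lambda>x. R x * (\<Prod>i\<in>I. Y i x ^ D i)) =
                       expectation (\<lambda>x. R' x * (\<Prod>i\<in>I. Z i x ^ D i))"
    and B: "\<And>i. i \<in> I \<Longrightarrow> B i \<in> sets borel"
  shows "expectation (\<lambda>x. R x * (\<Prod>i\<in>I. indicator (B i) (Y i x))) =
         expectation (\<lambda>x. R' x * (\<Prod>i\<in>I. indicator (B i) (Z i x)))"
proof -
  have "\<forall>D. expectation (\<lambda>x. R x * (\<Prod>i\<in>J. indicator (B i) (Y i x)) * (\<Prod>i\<in>I - J. Y i x ^ D i)) =
         expectation (\<lambda>x. R' x * (\<Prod>i\<in>J. indicator (B i) (Z i x)) * (\<Prod>i\<in>I - J. Z i x ^ D i))"
    if "finite J" "J \<subseteq> I" for J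
    using that
  proof (induction J rule: finite_induct)
    case empty
    then show ?case using moments by simp
  next
    case (insert j J)
    then have j: "j \<in> I" "J \<subseteq> I" "j \<notin> J" and fJ: "finite J" by auto
    have eq: "I - J = insert j (I - insert j J)" using j by auto
    show ?case
    proof
      fix D :: "'i \<Rightarrow> nat"
      let ?S = "\<lambda>R Y x. R x * (\<Prod>i\<in>J. indicator (B i) (Y i x)) * (\<Prod>i\<in>I - insert j J. Y i x ^ D i) :: real"
      have b: "ess_bounded M (?S R X)"
        if "ess_bounded M R" "\<And>i. i \<in> I \<Longrightarrow> ess_bounded M (X i)" for R X
        using that j B
        by (intro ess_bounded_mult ess_bounded_prod ess_bounded_power ess_bounded_indicator
            ess_bounded_measurable) auto
      have "expectation (\<lambda>x. ?S R Y x * indicator (B j) (Y j x)) =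
            expectation (\<lambda>x. ?S R' Z x * indicator (B j) (Z j x))"
      proof (rule moments_indicator[OF Y[OF j(1)] Z[OF j(1)] b[OF R Y] b[OF R' Z] _ B[OF j(1)]])
        fix d
        \<comment> \<open>The induction hypothesis holds for all exponents; changing the one at
          \<open>j\<close> to \<open>d\<close> produces every moment of the coordinate
          \<open>j\<close>.\<close>
        have "(\<Prod>i\<in>I - J. X i x ^ (D(j := d)) i) = X j x ^ d * (\<Prod>i\<in>I - insert j J. X i x ^ D i)"
          for X :: "'i \<Rightarrow> 'a \<Rightarrow> real" and x
          unfolding eq using I by (subst prod.insert) (auto intro!: prod.cong)
        then show "expectation (\<lambda>x. ?S R Y x * Y j x ^ d) = expectation (\<lambda>x. ?S R' Z x * Z j x ^ d)"
          using insert.IH[OF j(2), rule_format, of "D(j := d)"] by (simp add: mult_ac)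
      qed
      then show "expectation (\<lambda>x. R x * (\<Prod>i\<in>insert j J. indicator (B i) (Y i x)) * (\<Prod>i\<in>I - insert j J. Y i x ^ D i)) =
         expectation (\<lambda>x. R' x * (\<Prod>i\<in>insert j J. indicator (B i) (Z i x)) * (\<Prod>i\<in>I - insert j J. Z i x ^ D i))"
        using fJ j by (simp add: mult_ac)
    qed
  qed
  from this[OF I subset_refl] show ?thesis by simp
qed

end

subsection \<open>Homomorphism densities and sampled weighted graphs\<close>

lemma finite_vertex_pairs: "finite (vertex_pairs k)"
  by (rule finite_subset[of _ "Pow {1..k}"]) (auto simp: vertex_pairs_def)

lemma vertex_pairsD:
  assumes "e \<in> vertex_pairs k"
  shows "Min e \<in> {1..k}" "Max e \<in> {1..k}" "Min e < Max e" "e = {Min e, Max e}"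
proof -
  obtain i j where ij: "e = {i, j}" "i \<noteq> j" "e \<subseteq> {1..k}"
    using assms by (auto simp: vertex_pairs_def card_2_iff)
  then show "Min e \<in> {1..k}" "Max e \<in> {1..k}" "Min e < Max e" "e = {Min e, Max e}"
    by (auto simp: min_def max_def)
qed

lemma mp_edge:
  assumes "e \<in> vertex_pairs k"
  shows "measure_preserving (unit_cube k) unit_square (\<lambda>x. (x (Min e), x (Max e)))"
  using vertex_pairsD[OF assms] by (intro mp_coord_pair) auto

text \<open>Edges and nodes share one index set, so that edge multiplicities and node exponents
  become one exponent vector and the sample becomes one random vector.\<close>

definition sample_index :: "nat \<Rightarrow> (nat set + nat) set" where
  "sample_index k = vertex_pairs k <+> {1..k}"

lemma sample_index_iff [simp]:
  "Inl e \<in> sample_index k \<longleftrightarrow> e \<in> vertex_pairs k"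
  "Inr i \<in> sample_index k \<longleftrightarrow> i \<in> {1..k}"
  by (auto simp: sample_index_def)

definition sample_value :: "kernel \<Rightarrow> signal \<Rightarrow> nat set + nat \<Rightarrow> (nat \<Rightarrow> real) \<Rightarrow> real" where
  "sample_value W f \<iota> x = (case \<iota> of Inl e \<Rightarrow> edge_value W x e | Inr i \<Rightarrow> f (x i))"

lemma finite_sample_index: "finite (sample_index k)"
  unfolding sample_index_def by (intro finite_Plus finite_vertex_pairs) auto

lemma prod_sample_index:
  fixes h :: "nat set + nat \<Rightarrow> real"
  shows "(\<Prod>\<iota>\<in>sample_index k. h \<iota>) = (\<Prod>e\<in>vertex_pairs k. h (Inl e)) * (\<Prod>i\<in>{1..k}. h (Inr i))"
  by (simp add: sample_index_def prod.Plus finite_vertex_pairs comp_def)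


text \<open>Multiplicities turn into exponents; pairs that are not edges get exponent 0.\<close>

lemma hom_density_eq:
  assumes "is_multigraph k E"
  shows "hom_density k E d (W, f) =
    (\<integral>x. (\<Prod>\<iota>\<in>sample_index k. sample_value W f \<iota> x ^ case_sum (count E) d \<iota>) \<partial>unit_cube k)"
proof -
  have "(\<Prod>e\<in>#E. edge_value W x e) = (\<Prod>e\<in>vertex_pairs k. edge_value W x e ^ count E e)" for x
    unfolding image_prod_mset_multiplicity
    using assms finite_vertex_pairs
    by (intro prod.mono_neutral_left) (auto simp: is_multigraph_def not_in_iff)
  then show ?thesis
    by (simp add: prod_sample_index sample_value_def mult.commute)
qed

lemma ex_multigraph:
  fixes D :: "nat set + nat \<Rightarrow> nat"
  obtains E where "is_multigraph k E"
    "\<And>\<iota>. \<iota> \<in> sample_index k \<Longrightarrow> case_sum (count E) (\<lambda>i. D (Inr i)) \<iota> = D \<iota>"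
proof (rule that)
  let ?E = "\<Sum>e\<in>vertex_pairs k. replicate_mset (D (Inl e)) e"
  have c: "count ?E e = (if e \<in> vertex_pairs k then D (Inl e) else 0)" for e
    by (simp add: count_sum finite_vertex_pairs)
  show "is_multigraph k ?E"
    unfolding is_multigraph_def by (auto simp flip: count_greater_zero_iff simp: c split: if_splits)
  show "case_sum (count ?E) (\<lambda>i. D (Inr i)) \<iota> = D \<iota>" if "\<iota> \<in> sample_index k" for \<iota>
    using that by (cases \<iota>) (auto simp: c)
qed

text \<open>The densities on \<open>k\<close> vertices are precisely the mixed moments of the sample
  entries: repeated edges realise arbitrary exponents on the kernel values.\<close>

lemma multigraph_densities_eq_iff:
  "(\<forall>E d. is_multigraph k E \<longrightarrow> hom_density k E d (W, f) = hom_density k E d (V, g)) \<longleftrightarrow>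
   (\<forall>D. (\<integral>x. (\<Prod>\<iota>\<in>sample_index k. sample_value W f \<iota> x ^ D \<iota>) \<partial>unit_cube k) =
        (\<integral>x. (\<Prod>\<iota>\<in>sample_index k. sample_value V g \<iota> x ^ D \<iota>) \<partial>unit_cube k))"
  (is "?L \<longleftrightarrow> ?R")
proof
  assume L: ?L
  show ?R
  proof
    fix D
    obtain E where E: "is_multigraph k E"
      "\<And>\<iota>. \<iota> \<in> sample_index k \<Longrightarrow> case_sum (count E) (\<lambda>i. D (Inr i)) \<iota> = D \<iota>"
      using ex_multigraph by metis
    have "(\<Prod>\<iota>\<in>sample_index k. sample_value W f \<iota> x ^ case_sum (count E) (\<lambda>i. D (Inr i)) \<iota>) =
        (\<Prod>\<iota>\<in>sample_index k. sample_value W f \<iota> x ^ D \<iota>)" for W f x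
      by (intro prod.cong refl) (simp only: E(2))
    with L[rule_format, OF E(1), of "\<lambda>i. D (Inr i)"]
    show "(\<integral>x. (\<Prod>\<iota>\<in>sample_index k. sample_value W f \<iota> x ^ D \<iota>) \<partial>unit_cube k) =
        (\<integral>x. (\<Prod>\<iota>\<in>sample_index k. sample_value V g \<iota> x ^ D \<iota>) \<partial>unit_cube k)"
      unfolding hom_density_eq[OF E(1)] by simp
  qed
qed (simp add: hom_density_eq del: hom_density.simps)

lemma ess_bounded_edge_value:
  assumes "(W, f) \<in> graphon_signals r" "e \<in> vertex_pairs k"
  shows "ess_bounded (unit_cube k) (\<lambda>x. edge_value W x e)"
    "AE x in unit_cube k. \<bar>edge_value W x e\<bar> \<le> 1"
proof -
  note W = graphon_signalsD[OF assms(1)]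
  show "ess_bounded (unit_cube k) (\<lambda>x. edge_value W x e)"
    unfolding edge_value_def using ess_bounded_mp[OF mp_edge[OF assms(2)] ess_boundedI[OF W(2,4)]] .
  show "AE x in unit_cube k. \<bar>edge_value W x e\<bar> \<le> 1"
    unfolding edge_value_def using mp_AE[OF mp_edge[OF assms(2)] W(4)] .
qed

lemma ess_bounded_node_value:
  assumes "(W, f) \<in> graphon_signals r" "i \<in> {1..k}"
  shows "ess_bounded (unit_cube k) (\<lambda>x. f (x i))" "AE x in unit_cube k. \<bar>f (x i)\<bar> \<le> r"
  using graphon_signalsD[OF assms(1)] mp_coord[OF assms(2)] ess_bounded_mp mp_AE ess_boundedI
  by blast+

lemma ess_bounded_sample_value:
  assumes "(W, f) \<in> graphon_signals r" "\<iota> \<in> sample_index k"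
  shows "ess_bounded (unit_cube k) (sample_value W f \<iota>)"
  using assms(2) ess_bounded_edge_value(1)[OF assms(1)] ess_bounded_node_value(1)[OF assms(1)]
  by (cases \<iota>) (auto simp: sample_value_def[abs_def])

lemma AE_sample_value_le:
  assumes "(W, f) \<in> graphon_signals r" "\<iota> \<in> sample_index k" "r \<ge> 1"
  shows "AE x in unit_cube k. \<bar>sample_value W f \<iota> x\<bar> \<le> r"
  using assms(2)
proof (cases \<iota>)
  case (Inl e)
  with assms have "AE x in unit_cube k. \<bar>edge_value W x e\<bar> \<le> 1"
    by (intro ess_bounded_edge_value(2)) auto
  then show ?thesis using Inl assms(3) by (auto elim!: eventually_mono simp: sample_value_def)
next
  case (Inr i)
  with assms have "AE x in unit_cube k. \<bar>f (x i)\<bar> \<le> r"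
    by (intro ess_bounded_node_value(2)) auto
  then show ?thesis using Inr by (auto elim!: eventually_mono simp: sample_value_def)
qed

text \<open>After division by \<open>r\<close> all factors lie in \<open>[- 1, 1]\<close>, where a
  product changes by at most the sum of the changes of its factors and an \<open>n\<close>-th power
  by at most \<open>n\<close> times the change of its base. The remaining divisions by
  \<open>r\<close> only help because \<open>r \<ge> 1\<close>.\<close>

lemma prod_power_diff_le:
  fixes a b :: "'i \<Rightarrow> real"
  assumes I: "finite I" and r: "r \<ge> 1" and ab: "\<And>i. i \<in> I \<Longrightarrow> \<bar>a i\<bar> \<le> r" "\<And>i. i \<in> I \<Longrightarrow> \<bar>b i\<bar> \<le> r"
  shows "\<bar>(\<Prod>i\<in>I. a i ^ D i) - (\<Prod>i\<in>I. b i ^ D i)\<bar> \<le> r ^ (\<Sum>i\<in>I. D i) * (\<Sum>i\<in>I. D i * \<bar>a i - b i\<bar>)"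
proof -
  have sc: "(\<Prod>i\<in>I. c i ^ D i) = r ^ (\<Sum>i\<in>I. D i) * (\<Prod>i\<in>I. (c i / r) ^ D i)" for c
    using r I by (simp add: power_divide prod_dividef power_sum)
  have le: "\<bar>c / r\<bar> \<le> 1" if "\<bar>c\<bar> \<le> r" for c using that r by simp
  have "\<bar>(\<Prod>i\<in>I. (a i / r) ^ D i) - (\<Prod>i\<in>I. (b i / r) ^ D i)\<bar> \<le> (\<Sum>i\<in>I. \<bar>(a i / r) ^ D i - (b i / r) ^ D i\<bar>)"
  proof -
    have "norm ((c / r) ^ n) \<le> 1" if "\<bar>c\<bar> \<le> r" for c n
      using power_le_one[OF abs_ge_zero le[OF that], of n] by (simp only: real_norm_def power_abs)
    from norm_prod_diff[of I "\<lambda>i. (a i / r) ^ D i" "\<lambda>i. (b i / r) ^ D i", OF this this]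
    show ?thesis using ab by simp
  qed
  also have "\<dots> \<le> (\<Sum>i\<in>I. D i * \<bar>a i - b i\<bar>)"
  proof (rule sum_mono)
    fix i assume i: "i \<in> I"
    have "\<bar>(a i / r) ^ D i - (b i / r) ^ D i\<bar> \<le> D i * \<bar>a i / r - b i / r\<bar>"
      using norm_power_diff[of "a i / r" "b i / r" "D i", unfolded real_norm_def,
          OF le[OF ab(1)[OF i]] le[OF ab(2)[OF i]]] .
    also have "\<dots> \<le> D i * \<bar>a i - b i\<bar>"
      using r divide_left_mono[of 1 r "\<bar>a i - b i\<bar>"]
      by (intro mult_left_mono) (auto simp flip: diff_divide_distrib)
    finally show "\<bar>(a i / r) ^ D i - (b i / r) ^ D i\<bar> \<le> D i * \<bar>a i - b i\<bar>" .
  qed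
  finally have *: "\<bar>(\<Prod>i\<in>I. (a i / r) ^ D i) - (\<Prod>i\<in>I. (b i / r) ^ D i)\<bar> \<le> (\<Sum>i\<in>I. D i * \<bar>a i - b i\<bar>)" .
  have "\<bar>(\<Prod>i\<in>I. a i ^ D i) - (\<Prod>i\<in>I. b i ^ D i)\<bar> =
      r ^ (\<Sum>i\<in>I. D i) * \<bar>(\<Prod>i\<in>I. (a i / r) ^ D i) - (\<Prod>i\<in>I. (b i / r) ^ D i)\<bar>"
    unfolding sc[of a] sc[of b] right_diff_distrib[symmetric] abs_mult using r by simp
  also have "\<dots> \<le> r ^ (\<Sum>i\<in>I. D i) * (\<Sum>i\<in>I. D i * \<bar>a i - b i\<bar>)"
    using * r by (intro mult_left_mono) auto
  finally show ?thesis .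
qed

context
  fixes W V :: kernel and f g :: signal and r :: real
  assumes Wf: "(W, f) \<in> graphon_signals r" and Vg: "(V, g) \<in> graphon_signals r" and r: "r \<ge> 1"
begin

text \<open>Applying \<open>\<phi>\<close> to every coordinate preserves the measure of the cube, so
  the density of \<open>(V, g)\<close> may be computed along it. Then each factor is close to the
  corresponding factor of \<open>(W, f)\<close> in L1, and \<open>K\<close> bounds the effect of
  these errors on the product.\<close>

lemma L1_close_imp_densities:
  assumes close: "L1_close W f V g"
  shows "(\<integral>x. (\<Prod>\<iota>\<in>sample_index k. sample_value W f \<iota> x ^ D \<iota>) \<partial>unit_cube k) =
         (\<integral>x. (\<Prod>\<iota>\<in>sample_index k. sample_value V g \<iota> x ^ D \<iota>) \<partial>unit_cube k)"
    (is "?I W f = ?I V g")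
proof -
  define C where "C = r ^ (\<Sum>\<iota>\<in>sample_index k. D \<iota>)"
  define K where "K = C * (\<Sum>\<iota>\<in>sample_index k. real (D \<iota>))"
  have C: "C \<ge> 0" using r by (simp add: C_def)
  have K: "K \<ge> 0" unfolding K_def by (intro mult_nonneg_nonneg C sum_nonneg) auto
  have "\<bar>?I W f - ?I V g\<bar> \<le> 0 + e" if e: "e > 0" for e
  proof -
    define d where "d = e / (K + 1)"
    have d: "d > 0" using e K by (simp add: d_def)
    obtain \<phi> where \<phi>: "\<phi> \<in> ae_bijections"
      "(\<integral>z. \<bar>W z - kernel_pullback V \<phi> z\<bar> \<partial>unit_square) < d"
      "(\<integral>x. \<bar>f x - signal_pullback g \<phi> x\<bar> \<partial>unit_interval) < d"
      using close[unfolded L1_close_def, rule_format, OF d] by auto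
    note dk = diff_kernel[OF Wf Vg \<phi>(1)] and ds = diff_signal[OF Wf Vg \<phi>(1)]
    note mp = mp_cube[OF ae_bijections_mp[OF \<phi>(1)], of k]
    define T where "T x = (\<lambda>i\<in>{1..k}. \<phi> (x i))" for x :: "nat \<Rightarrow> real"
    have mpT: "measure_preserving (unit_cube k) (unit_cube k) T" using mp by (simp add: T_def[abs_def])
    let ?v = "\<lambda>\<iota> x. sample_value V g \<iota> (T x)"
    have bW: "ess_bounded (unit_cube k) (\<lambda>x. sample_value W f \<iota> x)" if "\<iota> \<in> sample_index k" for \<iota>
      using ess_bounded_sample_value[OF Wf that] .
    have bV: "ess_bounded (unit_cube k) (\<lambda>x. sample_value V g \<iota> x)" if "\<iota> \<in> sample_index k" for \<iota>
      using ess_bounded_sample_value[OF Vg that] .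
    have bVT: "ess_bounded (unit_cube k) (?v \<iota>)" if "\<iota> \<in> sample_index k" for \<iota>
      by (rule ess_bounded_mp[OF mpT bV[OF that]])
    have aW: "AE x in unit_cube k. \<forall>\<iota>\<in>sample_index k. \<bar>sample_value W f \<iota> x\<bar> \<le> r"
      by (intro AE_finite_allI finite_sample_index AE_sample_value_le[OF Wf _ r])
    have aV: "AE x in unit_cube k. \<forall>\<iota>\<in>sample_index k. \<bar>?v \<iota> x\<bar> \<le> r"
      by (intro AE_finite_allI finite_sample_index mp_AE[OF mpT] AE_sample_value_le[OF Vg _ r])
    have diffs: "(\<integral>x. \<bar>sample_value W f \<iota> x - ?v \<iota> x\<bar> \<partial>unit_cube k) \<le> d"
      if "\<iota> \<in> sample_index k" for \<iota>
    proof (cases \<iota>)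
      case \<iota>: (Inl e)
      with that have e: "e \<in> vertex_pairs k" by simp
      have "(\<integral>x. \<bar>sample_value W f \<iota> x - ?v \<iota> x\<bar> \<partial>unit_cube k) =
         (\<integral>x. \<bar>W (x (Min e), x (Max e)) - kernel_pullback V \<phi> (x (Min e), x (Max e))\<bar> \<partial>unit_cube k)"
        using vertex_pairsD(1,2)[OF e]
        by (simp add: \<iota> sample_value_def edge_value_def T_def kernel_pullback_def)
      also have "\<dots> = (\<integral>z. \<bar>W z - kernel_pullback V \<phi> z\<bar> \<partial>unit_square)"
        by (rule mp_integral[OF mp_edge[OF e]]) (use dk(1) in simp)
      finally show ?thesis using \<phi>(2) by simp
    next
      case \<iota>: (Inr i)
      with that have i: "i \<in> {1..k}" by simp
      have "(\<integral>x. \<bar>sample_value W f \<iota> x - ?v \<iota> x\<bar> \<partial>unit_cube k) =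
         (\<integral>x. \<bar>f (x i) - signal_pullback g \<phi> (x i)\<bar> \<partial>unit_cube k)"
        using i by (simp add: \<iota> sample_value_def T_def signal_pullback_def)
      also have "\<dots> = (\<integral>z. \<bar>f z - signal_pullback g \<phi> z\<bar> \<partial>unit_interval)"
        by (rule mp_integral[OF mp_coord[OF i]]) (use ds(1) in simp)
      finally show ?thesis using \<phi>(3) by simp
    qed
    let ?PW = "\<lambda>x. \<Prod>\<iota>\<in>sample_index k. sample_value W f \<iota> x ^ D \<iota>"
    let ?PV = "\<lambda>x. \<Prod>\<iota>\<in>sample_index k. sample_value V g \<iota> x ^ D \<iota>"
    let ?PVT = "\<lambda>x. \<Prod>\<iota>\<in>sample_index k. ?v \<iota> x ^ D \<iota>"
    have PV: "ess_bounded (unit_cube k) ?PV" by (intro ess_bounded_prod ess_bounded_power bV)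
    have iPW: "integrable (unit_cube k) ?PW"
      by (intro C.ess_bounded_integrable ess_bounded_prod ess_bounded_power bW)
    have iPVT: "integrable (unit_cube k) ?PVT"
      by (intro C.ess_bounded_integrable ess_bounded_prod ess_bounded_power bVT)
    have ii: "integrable (unit_cube k) (\<lambda>x. \<bar>sample_value W f \<iota> x - ?v \<iota> x\<bar>)"
      if "\<iota> \<in> sample_index k" for \<iota>
      using C.ess_bounded_integrable[OF ess_bounded_diff[OF bW[OF that] bVT[OF that]]] by simp
    have "?I V g = (\<integral>x. ?PVT x \<partial>unit_cube k)"
      by (rule mp_integral[OF mpT ess_bounded_measurable[OF PV], symmetric])
    then have "?I W f - ?I V g = (\<integral>x. ?PW x - ?PVT x \<partial>unit_cube k)"
      using Bochner_Integration.integral_diff[OF iPW iPVT] by simp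
    then have "\<bar>?I W f - ?I V g\<bar> \<le> (\<integral>x. \<bar>?PW x - ?PVT x\<bar> \<partial>unit_cube k)"
      using integral_abs_bound by simp
    also have "\<dots> \<le> (\<integral>x. C * (\<Sum>\<iota>\<in>sample_index k. D \<iota> * \<bar>sample_value W f \<iota> x - ?v \<iota> x\<bar>) \<partial>unit_cube k)"
    proof (rule integral_mono_AE)
      show "AE x in unit_cube k. \<bar>?PW x - ?PVT x\<bar> \<le>
          C * (\<Sum>\<iota>\<in>sample_index k. D \<iota> * \<bar>sample_value W f \<iota> x - ?v \<iota> x\<bar>)"
        using aW aV
      proof eventually_elim
        case (elim x)
        then show ?case unfolding C_def
          by (intro prod_power_diff_le finite_sample_index r) auto
      qed
    qed (use iPW iPVT ii in auto)
    also have "\<dots> = C * (\<Sum>\<iota>\<in>sample_index k. D \<iota> * (\<integral>x. \<bar>sample_value W f \<iota> x - ?v \<iota> x\<bar> \<partial>unit_cube k))"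
      using ii by simp
    also have "\<dots> \<le> C * (\<Sum>\<iota>\<in>sample_index k. D \<iota> * d)"
      by (intro mult_left_mono sum_mono diffs C) auto
    also have "\<dots> = K * d" by (simp add: K_def sum_distrib_right mult.assoc)
    also have "\<dots> \<le> (K + 1) * d" using d by (simp add: algebra_simps)
    also have "\<dots> = e" using K by (simp add: d_def)
    finally show ?thesis by simp
  qed
  then have "\<bar>?I W f - ?I V g\<bar> \<le> 0" by (rule field_le_epsilon)
  then show ?thesis by simp
qed

end

section \<open>The sampled weighted graph as a random vector\<close>

definition sample_vector :: "nat \<Rightarrow> kernel \<Rightarrow> signal \<Rightarrow> (nat \<Rightarrow> real) \<Rightarrow> nat set + nat \<Rightarrow> real" where
  "sample_vector k W f x = (\<lambda>\<iota>\<in>sample_index k. sample_value W f \<iota> x)"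

lemma measurable_sample_vector:
  assumes "(W, f) \<in> graphon_signals r"
  shows "sample_vector k W f \<in> unit_cube k \<rightarrow>\<^sub>M Pi\<^sub>M (sample_index k) (\<lambda>_. borel)"
  unfolding sample_vector_def
  by (intro measurable_restrict ess_bounded_measurable ess_bounded_sample_value[OF assms])

abbreviation (input) weighted_graph_space :: "nat \<Rightarrow> ((nat set \<Rightarrow> real) \<times> (nat \<Rightarrow> real)) measure" where
  "weighted_graph_space k \<equiv> Pi\<^sub>M (vertex_pairs k) (\<lambda>_. borel) \<Otimes>\<^sub>M Pi\<^sub>M {1..k} (\<lambda>_. borel)"

definition split_sample :: "nat \<Rightarrow> (nat set + nat \<Rightarrow> real) \<Rightarrow> (nat set \<Rightarrow> real) \<times> (nat \<Rightarrow> real)" where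
  "split_sample k s = (\<lambda>e\<in>vertex_pairs k. s (Inl e), \<lambda>i\<in>{1..k}. s (Inr i))"

lemma measurable_split_sample:
  "split_sample k \<in> Pi\<^sub>M (sample_index k) (\<lambda>_. borel) \<rightarrow>\<^sub>M weighted_graph_space k"
  unfolding split_sample_def
  by (intro measurable_Pair measurable_restrict measurable_component_singleton) auto

lemma split_sample_vector:
  "split_sample k (sample_vector k W f x) =
     (\<lambda>e\<in>vertex_pairs k. edge_value W x e, node_signal k f x)"
  by (auto simp: split_sample_def sample_vector_def sample_value_def node_signal_def restrict_def)

text \<open>The law of the graph is the image of the law of one random vector under a fixed map, so
  equality of the vector laws is enough.\<close>

lemma sampled_weighted_graph_eq:
  assumes "(W, f) \<in> graphon_signals r"
  shows "sampled_weighted_graph k (W, f) =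
    distr (distr (unit_cube k) (Pi\<^sub>M (sample_index k) (\<lambda>_. borel)) (sample_vector k W f))
      (weighted_graph_space k) (split_sample k)"
  using distr_distr[OF measurable_split_sample measurable_sample_vector[OF assms]]
  by (simp add: comp_def split_sample_vector)

lemma distr_eq_PiM_finite:
  fixes X X' :: "'a \<Rightarrow> 'i \<Rightarrow> real"
  assumes M: "prob_space M" "prob_space N" and I: "finite I"
    and X: "X \<in> M \<rightarrow>\<^sub>M Pi\<^sub>M I (\<lambda>_. borel)" "X' \<in> N \<rightarrow>\<^sub>M Pi\<^sub>M I (\<lambda>_. borel)"
    and eq: "\<And>B. (\<And>i. i \<in> I \<Longrightarrow> B i \<in> sets borel) \<Longrightarrow>
       emeasure M (X -` Pi\<^sub>E I B \<inter> space M) = emeasure N (X' -` Pi\<^sub>E I B \<inter> space N)"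
  shows "distr M (Pi\<^sub>M I (\<lambda>_. borel)) X = distr N (Pi\<^sub>M I (\<lambda>_. borel)) X'"
proof (rule measure_eqI_PiM_finite[OF I])
  show "distr M (Pi\<^sub>M I (\<lambda>_. borel)) X (Pi\<^sub>E I B) = distr N (Pi\<^sub>M I (\<lambda>_. borel)) X' (Pi\<^sub>E I B)"
    if "\<And>i. i \<in> I \<Longrightarrow> B i \<in> sets borel" for B
  proof -
    have "Pi\<^sub>E I B \<in> sets (Pi\<^sub>M I (\<lambda>_. borel))" by (intro sets_PiM_I_finite I that)
    then show ?thesis using eq[OF that] X by (simp add: emeasure_distr)
  qed
  let ?A = "\<lambda>_::nat. space (Pi\<^sub>M I (\<lambda>_. borel :: real measure))"
  show "range ?A \<subseteq> prod_algebra I (\<lambda>_. borel)"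
    using I by (auto simp: space_PiM intro!: prod_algebraI_finite)
  show "emeasure (distr M (Pi\<^sub>M I (\<lambda>_. borel)) X) (?A i) \<noteq> \<infinity>" for i
    using prob_space.emeasure_space_1[OF prob_space.prob_space_distr[OF M(1) X(1)]] by simp
qed auto

lemma emeasure_vimage_box:
  assumes "prob_space M" and I: "finite I"
    and X: "X \<in> M \<rightarrow>\<^sub>M Pi\<^sub>M I (\<lambda>_. borel :: real measure)"
    and B: "\<And>i. i \<in> I \<Longrightarrow> B i \<in> sets borel"
  shows "emeasure M (X -` Pi\<^sub>E I B \<inter> space M) = ennreal (\<integral>x. (\<Prod>i\<in>I. indicator (B i) (X x i)) \<partial>M)"
proof -
  interpret prob_space M by fact
  let ?A = "X -` Pi\<^sub>E I B \<inter> space M"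
  have A: "?A \<in> sets M"
    using X sets_PiM_I_finite[OF I B] by (auto intro: measurable_sets)
  have "X x \<in> Pi\<^sub>E I B \<longleftrightarrow> (\<forall>i\<in>I. X x i \<in> B i)" if "x \<in> space M" for x
    using measurable_space[OF X that] by (auto simp: space_PiM PiE_iff)
  then have "(\<integral>x. (\<Prod>i\<in>I. indicator (B i) (X x i)) \<partial>M) = (\<integral>x. indicator ?A x \<partial>M :: real)"
    using I by (intro Bochner_Integration.integral_cong refl)
      (auto simp: indicator_def prod_eq_1_iff intro!: prod_zero)
  then show ?thesis using A by (simp add: emeasure_eq_measure)
qed

text \<open>With constant weight 1, equal moments give equal probabilities of all boxes, and these
  determine a probability law on a finite product of lines.\<close>

lemma densities_imp_weighted:
  assumes Wf: "(W, f) \<in> graphon_signals r" and Vg: "(V, g) \<in> graphon_signals r"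
    and dens: "\<And>D. (\<integral>x. (\<Prod>\<iota>\<in>sample_index k. sample_value W f \<iota> x ^ D \<iota>) \<partial>unit_cube k) =
         (\<integral>x. (\<Prod>\<iota>\<in>sample_index k. sample_value V g \<iota> x ^ D \<iota>) \<partial>unit_cube k)"
  shows "sampled_weighted_graph k (W, f) = sampled_weighted_graph k (V, g)"
proof -
  have "distr (unit_cube k) (Pi\<^sub>M (sample_index k) (\<lambda>_. borel)) (sample_vector k W f) =
    distr (unit_cube k) (Pi\<^sub>M (sample_index k) (\<lambda>_. borel)) (sample_vector k V g)"
  proof (rule distr_eq_PiM_finite[OF prob_space_unit_cube prob_space_unit_cube finite_sample_index
        measurable_sample_vector[OF Wf] measurable_sample_vector[OF Vg]])
    fix B :: "nat set + nat \<Rightarrow> real set" assume B: "\<And>\<iota>. \<iota> \<in> sample_index k \<Longrightarrow> B \<iota> \<in> sets borel"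
    have "(\<integral>x. (1::real) * (\<Prod>\<iota>\<in>sample_index k. indicator (B \<iota>) (sample_value W f \<iota> x)) \<partial>unit_cube k) =
          (\<integral>x. (1::real) * (\<Prod>\<iota>\<in>sample_index k. indicator (B \<iota>) (sample_value V g \<iota> x)) \<partial>unit_cube k)"
      using dens B
      by (intro C.moments_determine finite_sample_index ess_bounded_sample_value[OF Wf]
          ess_bounded_sample_value[OF Vg] ess_bounded_const) simp_all
    then show "emeasure (unit_cube k) (sample_vector k W f -` Pi\<^sub>E (sample_index k) B \<inter> space (unit_cube k)) =
       emeasure (unit_cube k) (sample_vector k V g -` Pi\<^sub>E (sample_index k) B \<inter> space (unit_cube k))"
      using emeasure_vimage_box[OF prob_space_unit_cube finite_sample_index measurable_sample_vector[OF Wf] B]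
        emeasure_vimage_box[OF prob_space_unit_cube finite_sample_index measurable_sample_vector[OF Vg] B]
      by (simp add: sample_vector_def)
  qed
  then show ?thesis
    unfolding sampled_weighted_graph_eq[OF Wf] sampled_weighted_graph_eq[OF Vg] by simp
qed

text \<open>Each moment is the integral of a fixed measurable function against the law of the
  sample; hence equal laws have equal moments.\<close>

lemma density_weighted:
  assumes Wf: "(W, f) \<in> graphon_signals r"
  shows "(\<integral>x. (\<Prod>\<iota>\<in>sample_index k. sample_value W f \<iota> x ^ D \<iota>) \<partial>unit_cube k) =
    (\<integral>z. (\<Prod>e\<in>vertex_pairs k. fst z e ^ D (Inl e)) * (\<Prod>i\<in>{1..k}. snd z i ^ D (Inr i))
       \<partial>sampled_weighted_graph k (W, f))"
proof -
  let ?H = "\<lambda>z. (\<Prod>e\<in>vertex_pairs k. fst z e ^ D (Inl e)) * (\<Prod>i\<in>{1..k}. snd z i ^ D (Inr i)) :: real"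
  have m: "(\<lambda>x. split_sample k (sample_vector k W f x)) \<in> unit_cube k \<rightarrow>\<^sub>M weighted_graph_space k"
    using measurable_sample_vector[OF Wf] measurable_split_sample by (rule measurable_compose)
  have H: "?H \<in> borel_measurable (weighted_graph_space k)"
    by (intro borel_measurable_times borel_measurable_prod borel_measurable_power
        measurable_compose[OF measurable_fst] measurable_compose[OF measurable_snd]
        measurable_component_singleton)
  have "(\<integral>z. ?H z \<partial>sampled_weighted_graph k (W, f)) =
      (\<integral>x. ?H (split_sample k (sample_vector k W f x)) \<partial>unit_cube k)"
    using integral_distr[OF m H] by (simp add: split_sample_vector)
  also have "\<dots> = (\<integral>x. (\<Prod>\<iota>\<in>sample_index k. sample_value W f \<iota> x ^ D \<iota>) \<partial>unit_cube k)"
    by (simp add: prod_sample_index split_sample_def sample_vector_def)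
  finally show ?thesis ..
qed

lemma multigraph_iff_weighted:
  assumes Wf: "(W, f) \<in> graphon_signals r" and Vg: "(V, g) \<in> graphon_signals r"
  shows "(\<forall>k E d. is_multigraph k E \<longrightarrow> hom_density k E d (W, f) = hom_density k E d (V, g)) \<longleftrightarrow>
    (\<forall>k\<ge>1. sampled_weighted_graph k (W, f) = sampled_weighted_graph k (V, g))" (is "?L \<longleftrightarrow> ?R")
proof
  assume ?L
  then show ?R
    using densities_imp_weighted[OF Wf Vg] unfolding multigraph_densities_eq_iff by blast
next
  assume R: ?R
  show ?L
    unfolding multigraph_densities_eq_iff
  proof (intro allI)
    fix k D
    show "(\<integral>x. (\<Prod>\<iota>\<in>sample_index k. sample_value W f \<iota> x ^ D \<iota>) \<partial>unit_cube k) =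
         (\<integral>x. (\<Prod>\<iota>\<in>sample_index k. sample_value V g \<iota> x ^ D \<iota>) \<partial>unit_cube k)"
    proof (cases "k \<ge> 1")
      case True
      then show ?thesis using R by (simp only: density_weighted[OF Wf] density_weighted[OF Vg])
    next
      \<comment> \<open>The sampling condition starts at \<open>k = 1\<close>. For
        \<open>k = 0\<close> both integrands are the empty product.\<close>
      case False
      then have "vertex_pairs k = {}" by (auto simp: vertex_pairs_def)
      then show ?thesis using False by (simp add: prod_sample_index)
    qed
  qed
qed

subsection \<open>Sampled simple graphs\<close>

text \<open>The conditional probability, given the node positions \<open>x\<close>, that the sampled
  edge set is exactly \<open>F\<close>.\<close>

definition edge_prob :: "nat \<Rightarrow> kernel \<Rightarrow> nat set set \<Rightarrow> (nat \<Rightarrow> real) \<Rightarrow> real" where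
  "edge_prob k W F x = (\<Prod>e\<in>F. edge_value W x e) * (\<Prod>e\<in>vertex_pairs k - F. 1 - edge_value W x e)"

abbreviation (input) simple_graph_space :: "nat \<Rightarrow> (nat set set \<times> (nat \<Rightarrow> real)) measure" where
  "simple_graph_space k \<equiv> count_space (Pow (vertex_pairs k)) \<Otimes>\<^sub>M Pi\<^sub>M {1..k} (\<lambda>_. borel)"

lemma edge_value_01:
  assumes "(W, f) \<in> graphon_signals r" "x \<in> space (unit_cube k)" "e \<in> vertex_pairs k"
  shows "edge_value W x e \<in> {0..1}"
proof -
  have "x (Min e) \<in> {0..1}" "x (Max e) \<in> {0..1}"
    using vertex_pairsD(1,2)[OF assms(3)] assms(2) by (auto simp: space_unit_cube PiE_iff)
  then show ?thesis
    using graphon_signalsD(3)[OF assms(1)] by (simp add: edge_value_def)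
qed

lemma edge_prob_nonneg:
  assumes "(W, f) \<in> graphon_signals r" "x \<in> space (unit_cube k)" "F \<subseteq> vertex_pairs k"
  shows "edge_prob k W F x \<ge> 0"
proof -
  have "0 \<le> edge_value W x e \<and> edge_value W x e \<le> 1" if "e \<in> vertex_pairs k" for e
    using edge_value_01[OF assms(1,2) that] by simp
  then show ?thesis
    unfolding edge_prob_def using assms(3) by (intro mult_nonneg_nonneg prod_nonneg) auto
qed

lemma pmf_random_edges:
  assumes W: "(W, f) \<in> graphon_signals r" "x \<in> space (unit_cube k)" and F: "F \<subseteq> vertex_pairs k"
  shows "pmf (random_edges k W x) F = edge_prob k W F x"
proof -
  let ?P = "vertex_pairs k"
  let ?p = "\<lambda>e. bernoulli_pmf (edge_value W x e)"
  \<comment> \<open>Here \<open>{e \<in> F}\<close> is the singleton of a truth value: drawing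
    exactly \<open>F\<close> prescribes the outcome at every pair.\<close>
  have "(\<lambda>b. {e \<in> ?P. b e}) -` {F} = Pi ?P (\<lambda>e. {e \<in> F})"
    using F by (auto simp: Pi_iff)
  then have "pmf (random_edges k W x) F = measure_pmf.prob (Pi_pmf ?P False ?p) (Pi ?P (\<lambda>e. {e \<in> F}))"
    by (simp add: random_edges_def pmf_map)
  also have "\<dots> = (\<Prod>e\<in>?P. measure_pmf.prob (?p e) {e \<in> F})"
    by (rule measure_Pi_pmf_Pi[OF finite_vertex_pairs])
  also have "\<dots> = (\<Prod>e\<in>?P. if e \<in> F then edge_value W x e else 1 - edge_value W x e)"
  proof (rule prod.cong[OF refl])
    fix e assume "e \<in> ?P"
    from edge_value_01[OF W this]
    show "measure_pmf.prob (?p e) {e \<in> F} = (if e \<in> F then edge_value W x e else 1 - edge_value W x e)"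
      by (cases "e \<in> F") (simp_all add: measure_pmf_single)
  qed
  also have "\<dots> = edge_prob k W F x"
    unfolding edge_prob_def
    by (subst prod.If_cases[OF finite_vertex_pairs])
       (use F in \<open>simp add: Int_absorb1 Diff_eq\<close>)
  finally show ?thesis .
qed

lemma set_pmf_random_edges: "set_pmf (random_edges k W x) \<subseteq> Pow (vertex_pairs k)"
  by (auto simp: random_edges_def)

text \<open>A finite sum in which the positions enter through \<open>edge_prob\<close> alone;
  measurability in \<open>x\<close> can be read off even when \<open>S\<close> varies with
  \<open>x\<close>.\<close>

lemma emeasure_random_edges:
  assumes W: "(W, f) \<in> graphon_signals r" "x \<in> space (unit_cube k)"
  shows "emeasure (measure_pmf (random_edges k W x)) S =
    (\<Sum>F\<in>Pow (vertex_pairs k). ennreal (edge_prob k W F x) * indicator S F)"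
proof -
  have "emeasure (measure_pmf (random_edges k W x)) S = (\<integral>\<^sup>+F. indicator S F \<partial>measure_pmf (random_edges k W x))"
    by simp
  also have "\<dots> = (\<Sum>F\<in>Pow (vertex_pairs k). indicator S F * ennreal (pmf (random_edges k W x) F))"
    by (rule nn_integral_measure_pmf_support)
       (auto simp: finite_vertex_pairs dest: subsetD[OF set_pmf_random_edges])
  also have "\<dots> = (\<Sum>F\<in>Pow (vertex_pairs k). ennreal (edge_prob k W F x) * indicator S F)"
    by (intro sum.cong refl) (simp add: pmf_random_edges[OF W] mult.commute)
  finally show ?thesis .
qed

lemma measurable_node_signal:
  assumes "(W, f) \<in> graphon_signals r"
  shows "node_signal k f \<in> unit_cube k \<rightarrow>\<^sub>M Pi\<^sub>M {1..k} (\<lambda>_. borel)"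
  unfolding node_signal_def
  by (intro measurable_restrict ess_bounded_measurable ess_bounded_node_value[OF assms])

lemma ess_bounded_edge_prob:
  assumes "(W, f) \<in> graphon_signals r" "F \<subseteq> vertex_pairs k"
  shows "ess_bounded (unit_cube k) (edge_prob k W F)"
  unfolding edge_prob_def
  by (intro ess_bounded_mult ess_bounded_prod ess_bounded_diff ess_bounded_const
      ess_bounded_edge_value[OF assms(1)]) (use assms(2) in auto)

text \<open>The map \<open>E \<mapsto> (E, n)\<close> does not map into the space of the target measure outside the
  support of \<^const>\<open>random_edges\<close>, hence \<open>emeasure_distr\<close> is not applicable directly.\<close>

lemma distr_random_edges:
  assumes n: "n \<in> space (Pi\<^sub>M {1..k} (\<lambda>_. borel))"
  shows "distr (measure_pmf (random_edges k W x)) (simple_graph_space k) (\<lambda>E. (E, n)) =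
    distr (measure_pmf (random_edges k W x)) (simple_graph_space k) (\<lambda>E. (E \<inter> vertex_pairs k, n))"
proof -
  let ?p = "random_edges k W x"
  have "emeasure (measure_pmf ?p) ((\<lambda>E. (E, n)) -` A) =
      emeasure (measure_pmf ?p) ((\<lambda>E. (E \<inter> vertex_pairs k, n)) -` A)" for A
  proof -
    have "(\<lambda>E. (E, n)) -` A \<inter> set_pmf ?p = (\<lambda>E. (E \<inter> vertex_pairs k, n)) -` A \<inter> set_pmf ?p"
      using set_pmf_random_edges[of k W x] by (auto simp: Int_absorb2 subset_iff Pow_def)
    then show ?thesis by (metis emeasure_Int_set_pmf)
  qed
  then show ?thesis unfolding distr_def by simp
qed

lemma measurable_graph_with_signal:
  assumes n: "n \<in> space (Pi\<^sub>M {1..k} (\<lambda>_. borel))"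
  shows "(\<lambda>E. (E \<inter> vertex_pairs k, n)) \<in> measure_pmf p \<rightarrow>\<^sub>M simple_graph_space k"
  using n by (intro measurable_Pair) auto

lemma emeasure_distr_random_edges:
  assumes n: "n \<in> space (Pi\<^sub>M {1..k} (\<lambda>_. borel))" and A: "A \<in> sets (simple_graph_space k)"
  shows "emeasure (distr (measure_pmf (random_edges k W x)) (simple_graph_space k) (\<lambda>E. (E, n))) A =
    emeasure (measure_pmf (random_edges k W x)) {E. (E, n) \<in> A}"
proof -
  let ?p = "random_edges k W x"
  have "emeasure (distr (measure_pmf ?p) (simple_graph_space k) (\<lambda>E. (E, n))) A =
      emeasure (measure_pmf ?p) ((\<lambda>E. (E \<inter> vertex_pairs k, n)) -` A)"
    unfolding distr_random_edges[OF n]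
    using emeasure_distr[OF measurable_graph_with_signal[OF n, of "?p"] A] by simp
  also have "\<dots> = emeasure (measure_pmf ?p) {E. (E, n) \<in> A}"
  proof (rule emeasure_eq_AE)
    show "AE E in measure_pmf ?p. E \<in> (\<lambda>E. (E \<inter> vertex_pairs k, n)) -` A \<longleftrightarrow> E \<in> {E. (E, n) \<in> A}"
      using set_pmf_random_edges[of k W x]
      by (intro AE_pmfI) (auto simp: subset_iff Int_absorb2)
  qed auto
  finally show ?thesis .
qed

lemma node_signal_space: "node_signal k f x \<in> space (Pi\<^sub>M {1..k} (\<lambda>_. borel))"
  by (simp add: node_signal_def space_PiM)

text \<open>The monadic definition of \<open>sampled_simple_graph\<close> can be evaluated as a
  mixture of the conditional laws only once these depend measurably on \<open>x\<close>.\<close>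

lemma measurable_simple_graph_kernel:
  assumes W: "(W, f) \<in> graphon_signals r"
  shows "(\<lambda>x. distr (measure_pmf (random_edges k W x)) (simple_graph_space k)
      (\<lambda>E. (E, node_signal k f x))) \<in> unit_cube k \<rightarrow>\<^sub>M subprob_algebra (simple_graph_space k)"
proof (rule measurable_subprob_algebra)
  fix x assume x: "x \<in> space (unit_cube k)"
  show "subprob_space (distr (measure_pmf (random_edges k W x)) (simple_graph_space k) (\<lambda>E. (E, node_signal k f x)))"
    unfolding distr_random_edges[OF node_signal_space]
    by (intro prob_space_imp_subprob_space prob_space.prob_space_distr measure_pmf.prob_space_axioms
        measurable_graph_with_signal node_signal_space)
next
  fix A assume A: "A \<in> sets (simple_graph_space k)"
  have "(\<lambda>x. \<Sum>F\<in>Pow (vertex_pairs k). ennreal (edge_prob k W F x) *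
      indicator {s. (F, s) \<in> A} (node_signal k f x)) \<in> borel_measurable (unit_cube k)"
  proof (intro borel_measurable_sum borel_measurable_times_ennreal)
    fix F assume "F \<in> Pow (vertex_pairs k)"
    then have "edge_prob k W F \<in> borel_measurable (unit_cube k)"
      by (intro ess_bounded_measurable ess_bounded_edge_prob[OF W]) auto
    then show "(\<lambda>x. ennreal (edge_prob k W F x)) \<in> borel_measurable (unit_cube k)" by simp
    have "{s. (F, s) \<in> A} \<in> sets (Pi\<^sub>M {1..k} (\<lambda>_. borel))"
      using sets_Pair1[OF A, of F] by (simp add: vimage_def)
    then show "(\<lambda>x. indicator {s. (F, s) \<in> A} (node_signal k f x) :: ennreal) \<in> borel_measurable (unit_cube k)"
      by (intro measurable_compose[OF measurable_node_signal[OF W]] borel_measurable_indicator)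
  qed
  also have "?this \<longleftrightarrow> (\<lambda>x. emeasure (distr (measure_pmf (random_edges k W x)) (simple_graph_space k)
      (\<lambda>E. (E, node_signal k f x))) A) \<in> borel_measurable (unit_cube k)"
    by (intro measurable_cong, simp only: emeasure_distr_random_edges[OF node_signal_space A])
       (simp add: emeasure_random_edges[OF W] indicator_def)
  finally show "(\<lambda>x. emeasure (distr (measure_pmf (random_edges k W x)) (simple_graph_space k)
      (\<lambda>E. (E, node_signal k f x))) A) \<in> borel_measurable (unit_cube k)" .
qed (simp only: sets_distr)

lemma sets_sampled_simple_graph:
  "sets (sampled_simple_graph k (W, f)) = sets (simple_graph_space k)"
  using C.not_empty by (simp only: sampled_simple_graph.simps) (rule sets_bind, simp only: sets_distr)

lemma emeasure_sampled_simple_graph: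
  assumes W: "(W, f) \<in> graphon_signals r" and A: "A \<in> sets (simple_graph_space k)"
  shows "emeasure (sampled_simple_graph k (W, f)) A =
    (\<integral>\<^sup>+x. emeasure (measure_pmf (random_edges k W x)) {E. (E, node_signal k f x) \<in> A} \<partial>unit_cube k)"
  unfolding sampled_simple_graph.simps emeasure_bind[OF C.not_empty measurable_simple_graph_kernel[OF W] A]
  by (simp only: emeasure_distr_random_edges[OF node_signal_space A])

text \<open>Splits the law according to the finitely many edge sets. For a fixed \<open>F\<close>
  only the node signal is left, distributed under the cube measure weighted by
  \<open>edge_prob\<close>, so that real-valued moment arguments apply.\<close>

lemma emeasure_sampled_simple_graph':
  assumes W: "(W, f) \<in> graphon_signals r" and A: "A \<in> sets (simple_graph_space k)"
  shows "emeasure (sampled_simple_graph k (W, f)) A =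
    (\<Sum>F\<in>Pow (vertex_pairs k). emeasure (distr (density (unit_cube k) (edge_prob k W F))
        (Pi\<^sub>M {1..k} (\<lambda>_. borel)) (node_signal k f)) {s. (F, s) \<in> A})"
proof -
  note n = measurable_node_signal[OF W, of k]
  have e: "edge_prob k W F \<in> borel_measurable (unit_cube k)" if "F \<in> Pow (vertex_pairs k)" for F
    using that by (intro ess_bounded_measurable ess_bounded_edge_prob[OF W]) auto
  have S: "{s. (F, s) \<in> A} \<in> sets (Pi\<^sub>M {1..k} (\<lambda>_. borel))" for F
    using sets_Pair1[OF A, of F] by (simp add: vimage_def)
  have "emeasure (sampled_simple_graph k (W, f)) A =
     (\<integral>\<^sup>+x. (\<Sum>F\<in>Pow (vertex_pairs k). ennreal (edge_prob k W F x) *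
        indicator (node_signal k f -` {s. (F, s) \<in> A} \<inter> space (unit_cube k)) x) \<partial>unit_cube k)"
    unfolding emeasure_sampled_simple_graph[OF W A]
    by (intro nn_integral_cong) (simp add: emeasure_random_edges[OF W] indicator_def)
  also have "\<dots> = (\<Sum>F\<in>Pow (vertex_pairs k). \<integral>\<^sup>+x. ennreal (edge_prob k W F x) *
        indicator (node_signal k f -` {s. (F, s) \<in> A} \<inter> space (unit_cube k)) x \<partial>unit_cube k)"
    using e measurable_sets[OF n S] by (intro nn_integral_sum) auto
  also have "\<dots> = (\<Sum>F\<in>Pow (vertex_pairs k). emeasure (distr (density (unit_cube k) (edge_prob k W F))
        (Pi\<^sub>M {1..k} (\<lambda>_. borel)) (node_signal k f)) {s. (F, s) \<in> A})"
  proof (intro sum.cong refl)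
    fix F assume F: "F \<in> Pow (vertex_pairs k)"
    have "node_signal k f \<in> density (unit_cube k) (edge_prob k W F) \<rightarrow>\<^sub>M Pi\<^sub>M {1..k} (\<lambda>_. borel)"
      using n by simp
    from emeasure_distr[OF this S]
    show "(\<integral>\<^sup>+x. ennreal (edge_prob k W F x) *
        indicator (node_signal k f -` {s. (F, s) \<in> A} \<inter> space (unit_cube k)) x \<partial>unit_cube k) =
      emeasure (distr (density (unit_cube k) (edge_prob k W F))
        (Pi\<^sub>M {1..k} (\<lambda>_. borel)) (node_signal k f)) {s. (F, s) \<in> A}"
      using e[OF F] measurable_sets[OF n S] by (simp add: emeasure_density)
  qed
  finally show ?thesis .
qed

text \<open>The product over the absent edges is multiplied out. As \<open>F\<close> and
  \<open>X\<close> are disjoint, no edge is repeated, so every term belongs to a simple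
  graph.\<close>

lemma edge_prob_expand:
  assumes "F \<subseteq> vertex_pairs k"
  shows "edge_prob k W F x = (\<Sum>X\<in>Pow (vertex_pairs k - F). (-1) ^ card X * (\<Prod>e\<in>F \<union> X. edge_value W x e))"
proof -
  have fin: "finite (vertex_pairs k - F)" "finite F"
    using finite_vertex_pairs assms by (auto intro: finite_subset)
  have "(\<Prod>e\<in>vertex_pairs k - F. 1 - edge_value W x e) =
      (\<Prod>e\<in>vertex_pairs k - F. - edge_value W x e + 1)" by simp
  also have "\<dots> = (\<Sum>X\<in>Pow (vertex_pairs k - F). (-1) ^ card X * (\<Prod>e\<in>X. edge_value W x e))"
    by (subst prod_add[OF fin(1)]) (simp add: prod_uminus)
  finally have "edge_prob k W F x = (\<Sum>X\<in>Pow (vertex_pairs k - F).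
      (\<Prod>e\<in>F. edge_value W x e) * ((-1) ^ card X * (\<Prod>e\<in>X. edge_value W x e)))"
    by (simp add: edge_prob_def sum_distrib_left)
  also have "\<dots> = (\<Sum>X\<in>Pow (vertex_pairs k - F). (-1) ^ card X * (\<Prod>e\<in>F \<union> X. edge_value W x e))"
  proof (intro sum.cong refl)
    fix X assume "X \<in> Pow (vertex_pairs k - F)"
    then have "F \<inter> X = {}" "finite X" using fin by (auto intro: finite_subset)
    then show "(\<Prod>e\<in>F. edge_value W x e) * ((-1) ^ card X * (\<Prod>e\<in>X. edge_value W x e)) =
        (-1) ^ card X * (\<Prod>e\<in>F \<union> X. edge_value W x e)"
      using fin by (simp add: prod.union_disjoint)
  qed
  finally show ?thesis .
qed

lemma integral_edge_prob:
  assumes W: "(W, f) \<in> graphon_signals r" and F: "F \<subseteq> vertex_pairs k"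
  shows "(\<integral>x. edge_prob k W F x * (\<Prod>i\<in>{1..k}. f (x i) ^ d i) \<partial>unit_cube k) =
    (\<Sum>X\<in>Pow (vertex_pairs k - F). (-1) ^ card X * hom_density k (mset_set (F \<union> X)) d (W, f))"
proof -
  let ?t = "\<lambda>X x. (\<Prod>i\<in>{1..k}. f (x i) ^ d i) * (\<Prod>e\<in>F \<union> X. edge_value W x e)"
  have "(\<integral>x. edge_prob k W F x * (\<Prod>i\<in>{1..k}. f (x i) ^ d i) \<partial>unit_cube k) =
      (\<integral>x. (\<Sum>X\<in>Pow (vertex_pairs k - F). (-1) ^ card X * ?t X x) \<partial>unit_cube k)"
    by (simp add: edge_prob_expand[OF F] sum_distrib_right sum_distrib_left mult_ac)
  also have "\<dots> = (\<Sum>X\<in>Pow (vertex_pairs k - F). \<integral>x. (-1) ^ card X * ?t X x \<partial>unit_cube k)"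
  proof (rule Bochner_Integration.integral_sum)
    fix X assume "X \<in> Pow (vertex_pairs k - F)"
    then show "integrable (unit_cube k) (\<lambda>x. (-1) ^ card X * ?t X x)"
      using F by (intro integrable_mult_right C.ess_bounded_integrable ess_bounded_mult ess_bounded_prod
          ess_bounded_power ess_bounded_node_value[OF W] ess_bounded_edge_value[OF W]) auto
  qed
  also have "\<dots> = (\<Sum>X\<in>Pow (vertex_pairs k - F). (-1) ^ card X * hom_density k (mset_set (F \<union> X)) d (W, f))"
    by (simp add: prod_unfold_prod_mset[of _ "F \<union> _"])
  finally show ?thesis .
qed

lemma simple_graph_mset_set:
  assumes "F \<subseteq> vertex_pairs k"
  shows "is_simple_graph k (mset_set F)"
proof -
  have "finite F" using assms finite_vertex_pairs by (rule finite_subset)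
  then show ?thesis
    using assms by (simp add: is_simple_graph_def is_multigraph_def count_mset_set')
qed

text \<open>For fixed \<open>F\<close> the edge factor is taken as the weight in
  \<open>moments_determine\<close>, so that only the signal values are raised to powers. The
  weighted moments are then alternating sums of simple graph densities.\<close>

lemma simple_imp_sampled_simple:
  assumes W: "(W, f) \<in> graphon_signals r" and V: "(V, g) \<in> graphon_signals r"
    and dens: "\<And>E d. is_simple_graph k E \<Longrightarrow> hom_density k E d (W, f) = hom_density k E d (V, g)"
  shows "sampled_simple_graph k (W, f) = sampled_simple_graph k (V, g)"
proof (rule measure_eqI)
  show "sets (sampled_simple_graph k (W, f)) = sets (sampled_simple_graph k (V, g))"
    by (simp only: sets_sampled_simple_graph)
  let ?N = "Pi\<^sub>M {1..k} (\<lambda>_. borel :: real measure)"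
  fix A assume "A \<in> sets (sampled_simple_graph k (W, f))"
  then have A: "A \<in> sets (simple_graph_space k)" by (simp only: sets_sampled_simple_graph)
  have "distr (density (unit_cube k) (edge_prob k W F)) ?N (node_signal k f) =
        distr (density (unit_cube k) (edge_prob k V F)) ?N (node_signal k g)"
    if F: "F \<in> Pow (vertex_pairs k)" for F
  proof -
    have F': "F \<subseteq> vertex_pairs k" using F by simp
    have box: "emeasure (distr (density (unit_cube k) (edge_prob k W F)) ?N (node_signal k f)) (Pi\<^sub>E {1..k} B) =
        ennreal (\<integral>x. edge_prob k W F x * (\<Prod>i\<in>{1..k}. indicator (B i) (f (x i))) \<partial>unit_cube k)"
      if W: "(W, f) \<in> graphon_signals r" and B: "\<And>i. i \<in> {1..k} \<Longrightarrow> B i \<in> sets borel" for W f B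
    proof -
      note n = measurable_node_signal[OF W, of k]
      have S: "Pi\<^sub>E {1..k} B \<in> sets ?N" by (intro sets_PiM_I_finite B) auto
      have e: "edge_prob k W F \<in> borel_measurable (unit_cube k)"
        by (intro ess_bounded_measurable ess_bounded_edge_prob[OF W F'])
      have "emeasure (distr (density (unit_cube k) (edge_prob k W F)) ?N (node_signal k f)) (Pi\<^sub>E {1..k} B) =
        (\<integral>\<^sup>+x. ennreal (edge_prob k W F x) * indicator (node_signal k f -` Pi\<^sub>E {1..k} B \<inter> space (unit_cube k)) x \<partial>unit_cube k)"
        using n S e measurable_sets[OF n S] by (subst emeasure_distr) (simp_all add: emeasure_density)
      also have "\<dots> = (\<integral>\<^sup>+x. ennreal (edge_prob k W F x * (\<Prod>i\<in>{1..k}. indicator (B i) (f (x i)))) \<partial>unit_cube k)"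
      proof (rule nn_integral_cong)
        fix x assume x: "x \<in> space (unit_cube k)"
        have "(\<Prod>i\<in>{1..k}. indicator (B i) (f (x i))) =
            (indicator (node_signal k f -` Pi\<^sub>E {1..k} B \<inter> space (unit_cube k)) x :: real)"
        proof (cases "\<forall>i\<in>{1..k}. f (x i) \<in> B i")
          case True
          then show ?thesis using x by (simp add: node_signal_def)
        next
          case False
          then have "node_signal k f x \<notin> Pi\<^sub>E {1..k} B" by (auto simp: node_signal_def PiE_iff)
          moreover have "(\<Prod>i\<in>{1..k}. indicator (B i) (f (x i))) = (0::real)"
            using False by (intro prod_zero) (auto simp: indicator_def)
          ultimately show ?thesis by simp
        qed
        then show "ennreal (edge_prob k W F x) * indicator (node_signal k f -` Pi\<^sub>E {1..k} B \<inter> space (unit_cube k)) x =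
           ennreal (edge_prob k W F x * (\<Prod>i\<in>{1..k}. indicator (B i) (f (x i))))"
          by (simp add: indicator_def)
      qed
      also have "\<dots> = ennreal (\<integral>x. edge_prob k W F x * (\<Prod>i\<in>{1..k}. indicator (B i) (f (x i))) \<partial>unit_cube k)"
      proof (rule nn_integral_eq_integral)
        show "integrable (unit_cube k) (\<lambda>x. edge_prob k W F x * (\<Prod>i\<in>{1..k}. indicator (B i) (f (x i))))"
          by (intro C.ess_bounded_integrable ess_bounded_mult ess_bounded_edge_prob[OF W F'] ess_bounded_prod
              ess_bounded_indicator B ess_bounded_measurable ess_bounded_node_value[OF W])
        show "AE x in unit_cube k. 0 \<le> edge_prob k W F x * (\<Prod>i\<in>{1..k}. indicator (B i) (f (x i)))"
          by (intro AE_I2 mult_nonneg_nonneg prod_nonneg edge_prob_nonneg[OF W _ F']) auto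
      qed
      finally show ?thesis .
    qed
    show ?thesis
    proof (rule measure_eqI_PiM_finite)
      fix B :: "nat \<Rightarrow> real set" assume B: "\<And>i. i \<in> {1..k} \<Longrightarrow> B i \<in> sets borel"
      have "(\<integral>x. edge_prob k W F x * (\<Prod>i\<in>{1..k}. indicator (B i) (f (x i))) \<partial>unit_cube k) =
          (\<integral>x. edge_prob k V F x * (\<Prod>i\<in>{1..k}. indicator (B i) (g (x i))) \<partial>unit_cube k)"
      proof (rule C.moments_determine[where Y = "\<lambda>i x. f (x i)" and Z = "\<lambda>i x. g (x i)"])
        fix D :: "nat \<Rightarrow> nat"
        have "hom_density k (mset_set (F \<union> X)) D (W, f) = hom_density k (mset_set (F \<union> X)) D (V, g)"
          if "X \<in> Pow (vertex_pairs k - F)" for X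
          using that F by (intro dens simple_graph_mset_set) auto
        then show "(\<integral>x. edge_prob k W F x * (\<Prod>i\<in>{1..k}. f (x i) ^ D i) \<partial>unit_cube k) =
            (\<integral>x. edge_prob k V F x * (\<Prod>i\<in>{1..k}. g (x i) ^ D i) \<partial>unit_cube k)"
          unfolding integral_edge_prob[OF W F'] integral_edge_prob[OF V F'] by (intro sum.cong refl) simp
      qed (auto intro: ess_bounded_node_value[OF W] ess_bounded_node_value[OF V]
          ess_bounded_edge_prob[OF W F'] ess_bounded_edge_prob[OF V F'] B)
      then show "emeasure (distr (density (unit_cube k) (edge_prob k W F)) ?N (node_signal k f)) (Pi\<^sub>E {1..k} B) =
         emeasure (distr (density (unit_cube k) (edge_prob k V F)) ?N (node_signal k g)) (Pi\<^sub>E {1..k} B)"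
        using box[OF W B] box[OF V B] by simp
    next
      let ?A = "\<lambda>_::nat. \<Pi>\<^sub>E i\<in>{1..k}. (UNIV :: real set)"
      show "range ?A \<subseteq> prod_algebra {1..k} (\<lambda>_. borel)"
        by (auto intro!: prod_algebraI_finite)
      show "(\<Union>i. ?A i) = space ?N" by (simp add: space_PiM)
      show "emeasure (distr (density (unit_cube k) (edge_prob k W F)) ?N (node_signal k f)) (?A i) \<noteq> \<infinity>" for i
        using box[OF W, of "\<lambda>_. UNIV"] by simp
    qed auto
  qed
  then show "emeasure (sampled_simple_graph k (W, f)) A = emeasure (sampled_simple_graph k (V, g)) A"
    unfolding emeasure_sampled_simple_graph'[OF W A] emeasure_sampled_simple_graph'[OF V A] by simp
qed

subsection \<open>Samples and interval exchanges\<close>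

lemma inj_on_extend_bij_betw:
  assumes fin: "finite A" "finite B" and card: "card A = card B"
    and G: "G \<subseteq> A" "inj_on h G" "h ` G \<subseteq> B"
  obtains \<sigma> where "bij_betw \<sigma> A B" "\<And>i. i \<in> G \<Longrightarrow> \<sigma> i = h i"
proof -
  have "card (A - G) = card (B - h ` G)"
    using fin card G by (simp add: card_Diff_subset finite_subset card_image)
  then obtain h' where h': "bij_betw h' (A - G) (B - h ` G)"
    using fin finite_same_card_bij[of "A - G" "B - h ` G"] by auto
  define \<sigma> where "\<sigma> i = (if i \<in> G then h i else h' i)" for i
  have "bij_betw \<sigma> G (h ` G)"
    using inj_on_imp_bij_betw[OF G(2)] by (rule bij_betw_cong[THEN iffD1, rotated]) (simp add: \<sigma>_def)
  moreover have "bij_betw \<sigma> (A - G) (B - h ` G)"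
    using h' by (rule bij_betw_cong[THEN iffD1, rotated]) (simp add: \<sigma>_def)
  ultimately have "bij_betw \<sigma> (G \<union> (A - G)) (h ` G \<union> (B - h ` G))"
    by (rule bij_betw_combine) auto
  moreover have "G \<union> (A - G) = A" "h ` G \<union> (B - h ` G) = B" using G by auto
  ultimately show thesis by (intro that[of \<sigma>]) (auto simp: \<sigma>_def)
qed

text \<open>Each of the \<open>m\<close> blocks offers exactly \<open>q\<close> places. As many
  nodes of class \<open>a\<close> as fit are put into block \<open>a\<close>, and the rest are
  distributed arbitrarily. The misplaced nodes are bounded by the vacancies in the underfull blocks,
  which the truncated subtraction counts. Nodes of class \<open>m\<close> or higher are among those
  placed arbitrarily.\<close>

lemma ex_block_assignment:
  fixes c :: "nat \<Rightarrow> nat"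
  assumes q: "q > 0"
  obtains \<sigma> where "bij_betw \<sigma> {1..m * q} {..<m * q}"
    "card {i \<in> {1..m * q}. \<sigma> i div q \<noteq> c i} \<le> (\<Sum>a<m. q - card {i \<in> {1..m * q}. c i = a})"
proof -
  define A where "A = {1..m * q}"
  define C where "C a = {i \<in> A. c i = a}" for a
  have finA: "finite A" "card A = m * q" by (simp_all add: A_def)
  have finC: "finite (C a)" for a using finA by (simp add: C_def)
  \<comment> \<open>\<open>G\<close> consists of the nodes of class \<open>a\<close> that find room
    in their own block, and \<open>h\<close> gives their places.\<close>
  have "\<exists>G h. G \<subseteq> C a \<and> card G = min q (card (C a)) \<and> h ` G \<subseteq> {a * q..<a * q + q} \<and> inj_on h G" for a
  proof -
    obtain G where G: "G \<subseteq> C a" "card G = min q (card (C a))" "finite G"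
      using obtain_subset_with_card_n[of "min q (card (C a))" "C a"] finC by auto
    then obtain h where "h ` G \<subseteq> {a * q..<a * q + q}" "inj_on h G"
      using card_le_inj[of G "{a * q..<a * q + q}"] by auto
    with G show ?thesis by blast
  qed
  then obtain G h where Gh: "\<And>a. G a \<subseteq> C a" "\<And>a. card (G a) = min q (card (C a))"
      "\<And>a. h a ` G a \<subseteq> {a * q..<a * q + q}" "\<And>a. inj_on (h a) (G a)"
    by metis
  define U where "U = (\<Union>a<m. G a)"
  define H where "H i = h (c i) i" for i
  have div: "H i div q = a \<and> c i = a \<and> H i \<in> {a * q..<a * q + q}" if "i \<in> G a" for i a
  proof -
    have "c i = a" using that Gh(1)[of a] by (auto simp: C_def)
    moreover have "h a i \<in> {a * q..<a * q + q}" using that Gh(3)[of a] by blast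
    ultimately show ?thesis using q by (auto simp: H_def div_nat_eqI mult.commute)
  qed
  have 1: "inj_on H U"
  proof (rule inj_onI)
    fix i j assume ij: "i \<in> U" "j \<in> U" "H i = H j"
    then obtain a b where "i \<in> G a" "j \<in> G b" by (auto simp: U_def)
    with div[of i a] div[of j b] ij(3) have "a = b" "c i = a" "c j = a" by auto
    then show "i = j" using ij(3) \<open>i \<in> G a\<close> \<open>j \<in> G b\<close> Gh(4)[of a] by (auto simp: H_def inj_on_def)
  qed
  have 2: "U \<subseteq> A" using Gh(1) by (auto simp: U_def C_def)
  have 3: "H ` U \<subseteq> {..<m * q}"
  proof (rule image_subsetI)
    fix i assume "i \<in> U"
    then obtain a where "a < m" "i \<in> G a" by (auto simp: U_def)
    then have "H i < a * q + q" "Suc a \<le> m" using div[of i a] by auto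
    moreover from this have "Suc a * q \<le> m * q" by (intro mult_le_mono1)
    ultimately show "H i \<in> {..<m * q}" by simp
  qed
  have 4: "card A = card {..<m * q}" using finA(2) by simp
  obtain \<sigma> where \<sigma>: "bij_betw \<sigma> A {..<m * q}" "\<And>i. i \<in> U \<Longrightarrow> \<sigma> i = H i"
    using inj_on_extend_bij_betw[OF finA(1) finite_lessThan 4 2 1 3] by blast
  have "{i \<in> A. \<sigma> i div q \<noteq> c i} \<subseteq> A - U"
  proof
    fix i assume i: "i \<in> {i \<in> A. \<sigma> i div q \<noteq> c i}"
    have "i \<notin> U"
    proof
      assume "i \<in> U"
      moreover from this obtain a where "i \<in> G a" by (auto simp: U_def)
      ultimately show False using i \<sigma>(2)[of i] div[of i a] by simp
    qed
    then show "i \<in> A - U" using i by simp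
  qed
  then have "card {i \<in> A. \<sigma> i div q \<noteq> c i} \<le> card (A - U)"
    using finA by (intro card_mono) auto
  also have "card (A - U) = m * q - card U"
    using \<open>U \<subseteq> A\<close> finA by (simp add: card_Diff_subset finite_subset)
  also have "card U = (\<Sum>a<m. min q (card (C a)))"
    unfolding U_def Gh(2)[symmetric]
  proof (rule card_UN_disjoint)
    show "\<forall>a\<in>{..<m}. finite (G a)" using finite_subset[OF Gh(1) finC] by simp
    show "\<forall>a\<in>{..<m}. \<forall>b\<in>{..<m}. a \<noteq> b \<longrightarrow> G a \<inter> G b = {}"
      using div by (metis disjoint_iff)
  qed simp
  also have "m * q - (\<Sum>a<m. min q (card (C a))) = (\<Sum>a<m. q) - (\<Sum>a<m. min q (card (C a)))" by simp
  also have "\<dots> = (\<Sum>a<m. q - min q (card (C a)))"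
    by (rule sum_subtractf_nat[symmetric]) simp
  also have "\<dots> = (\<Sum>a<m. q - card (C a))" by (intro sum.cong refl) auto
  finally show thesis using \<sigma>(1) by (intro that) (auto simp: A_def C_def)
qed

section \<open>Interval exchanges\<close>

lemma cell_div:
  assumes "m > 0" "q > 0" "x \<ge> 0"
  shows "cell (m * q) x div q = cell m x"
proof -
  define p where "p = cell (m * q) x"
  define a where "a = p div q"
  have "real p / (m * q) \<le> x" "x < (real p + 1) / (m * q)"
    using cell_eq_iff[of "m * q" x p] assms by (auto simp: p_def)
  then have x: "real p \<le> x * (m * q)" "x * (m * q) < real p + 1"
    using assms by (auto simp: field_simps)
  have "a * q \<le> p" "p + 1 \<le> (a + 1) * q"
    using assms(2) dividend_less_div_times[of q p] by (auto simp: a_def)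
  then have "real (a * q) \<le> real p" "real (p + 1) \<le> real ((a + 1) * q)" by (simp_all only: of_nat_le_iff)
  then have "real a * q \<le> real p" "real p + 1 \<le> (real a + 1) * q"
    by (simp_all add: algebra_simps)
  then have "real a * q \<le> x * (m * q)" "x * (m * q) < (real a + 1) * q"
    using x by linarith+
  moreover have "x * (m * q) = (x * m) * q" by simp
  ultimately have "real a * q \<le> (x * m) * q" "(x * m) * q < (real a + 1) * q" by simp_all
  then have "real a \<le> x * m" "x * m < real a + 1" using assms(2) by simp_all
  then have "cell m x = a"
    using assms by (subst cell_eq_iff) (auto simp: field_simps)
  then show ?thesis by (simp add: a_def p_def)
qed

text \<open>Translates the cell \<open>p\<close> onto the cell \<open>\<pi> p\<close>. The point 1
  lies in no cell with index below \<open>k\<close> and is fixed, so that the closed interval is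
  mapped into itself.\<close>

definition interval_exchange :: "nat \<Rightarrow> (nat \<Rightarrow> nat) \<Rightarrow> real \<Rightarrow> real" where
  "interval_exchange k \<pi> x = (if x < 1 then x + (real (\<pi> (cell k x)) - real (cell k x)) / k else x)"

lemma interval_exchange_cell:
  assumes k: "k > 0" and \<pi>: "\<pi> ` {..<k} \<subseteq> {..<k}" and x: "x \<in> {0..<1}"
  shows "interval_exchange k \<pi> x \<in> {0..<1}" "cell k (interval_exchange k \<pi> x) = \<pi> (cell k x)"
proof -
  define p where "p = cell k x"
  have pk: "p < k" using cell_less[OF x k] by (simp add: p_def)
  then have \<pi>p: "\<pi> p < k" using \<pi> by auto
  have b: "real p / k \<le> x" "x < (real p + 1) / k"
    using cell_eq_iff[OF k, of x p] x by (auto simp: p_def)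
  define y where "y = interval_exchange k \<pi> x"
  have y: "y = x + (real (\<pi> p) - real p) / k" using x by (simp add: y_def interval_exchange_def p_def)
  have yb: "real (\<pi> p) / k \<le> y" "y < (real (\<pi> p) + 1) / k"
    using b by (auto simp: y add_divide_distrib diff_divide_distrib)
  have "0 \<le> real (\<pi> p) / k" "(real (\<pi> p) + 1) / k \<le> 1" using \<pi>p by (auto simp: field_simps)
  then have y01: "0 \<le> y" "y < 1" using yb by linarith+
  then show "interval_exchange k \<pi> x \<in> {0..<1}" by (simp add: y_def)
  show "cell k (interval_exchange k \<pi> x) = \<pi> (cell k x)"
    using cell_eq_iff[OF k y01(1), of "\<pi> p"] yb by (simp add: y_def p_def)
qed

lemma interval_exchange_inverse:
  assumes k: "k > 0" and \<pi>: "\<pi> ` {..<k} \<subseteq> {..<k}" and inv: "\<And>p. p < k \<Longrightarrow> \<rho> (\<pi> p) = p" and x: "x \<in> {0..<1}"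
  shows "interval_exchange k \<rho> (interval_exchange k \<pi> x) = x"
proof -
  have "interval_exchange k \<rho> (interval_exchange k \<pi> x) =
      interval_exchange k \<pi> x + (real (\<rho> (\<pi> (cell k x))) - real (\<pi> (cell k x))) / k"
    using interval_exchange_cell[OF k \<pi> x] by (simp add: interval_exchange_def[of k \<rho>])
  also have "\<dots> = x"
    using x inv[OF cell_less[OF x k]] by (simp add: interval_exchange_def diff_divide_distrib)
  finally show ?thesis .
qed

lemma sum_emeasure_cells:
  assumes k: "k > 0" and A: "A \<in> sets borel" "A \<subseteq> {0..1}"
  shows "(\<Sum>p<k. emeasure lborel (A \<inter> {x \<in> {0..<1}. cell k x = p})) = emeasure lborel A"
proof -
  have m: "A \<inter> {x \<in> {0..<1}. cell k x = p} \<in> sets borel" for p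
  proof -
    have "{x \<in> space borel. x \<in> {0..<1} \<and> cell k x = p} \<in> sets borel" by measurable
    then show ?thesis using A(1) by (auto intro: sets.Int)
  qed
  have "(\<Sum>p<k. emeasure lborel (A \<inter> {x \<in> {0..<1}. cell k x = p})) =
      emeasure lborel (\<Union>p<k. A \<inter> {x \<in> {0..<1}. cell k x = p})"
    using m by (intro sum_emeasure) (auto simp: disjoint_family_on_def)
  \<comment> \<open>Only the point 1 is missed by the \<open>k\<close> half-open cells.\<close>
  also have "(\<Union>p<k. A \<inter> {x \<in> {0..<1}. cell k x = p}) = A - {1}"
    using A(2) cell_less[OF _ k] by force
  also have "emeasure lborel (A - {1}) = emeasure lborel A"
    using A(1) by (intro emeasure_Diff_null_set) auto
  finally show ?thesis .
qed

text \<open>Inside one cell the map is a translation, under which Lebesgue measure is invariant;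
  summing over the cells, \<open>\<pi>\<close> merely permutes the summands.\<close>

lemma mp_interval_exchange:
  assumes k: "k > 0" and \<pi>: "bij_betw \<pi> {..<k} {..<k}"
  shows "measure_preserving borel_interval borel_interval (interval_exchange k \<pi>)"
proof -
  have \<pi>': "\<pi> ` {..<k} \<subseteq> {..<k}" using \<pi> by (auto simp: bij_betw_def)
  have m: "interval_exchange k \<pi> \<in> borel \<rightarrow>\<^sub>M borel"
    unfolding interval_exchange_def[abs_def]
    by (intro measurable_If borel_measurable_add borel_measurable_divide borel_measurable_diff
        measurable_compose[OF measurable_cell_borel]) auto
  have m': "interval_exchange k \<pi> \<in> borel_interval \<rightarrow>\<^sub>M borel_interval"
  proof (rule measurable_restrict_space2)
    show "interval_exchange k \<pi> \<in> space borel_interval \<rightarrow> {0..1}"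
    proof
      fix x assume "x \<in> space borel_interval"
      then have "x \<in> {0..<1} \<or> x = 1" by auto
      then show "interval_exchange k \<pi> x \<in> {0..1}"
        using interval_exchange_cell(1)[OF k \<pi>', of x] by (auto simp: interval_exchange_def)
    qed
    show "interval_exchange k \<pi> \<in> borel_interval \<rightarrow>\<^sub>M lborel"
      using m by (intro measurable_restrict_space1) simp
  qed
  have em: "emeasure borel_interval A = emeasure lborel A" if "A \<subseteq> {0..1}" "A \<in> sets borel" for A
    using that by (subst emeasure_restrict_space) auto
  have "distr borel_interval borel_interval (interval_exchange k \<pi>) = borel_interval"
  proof (rule measure_eqI)
    fix A assume "A \<in> sets (distr borel_interval borel_interval (interval_exchange k \<pi>))"
    then have A: "A \<in> sets borel" "A \<subseteq> {0..1}" "A \<in> sets borel_interval"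
      by (auto simp: sets_restrict_space_iff)
    let ?S = "interval_exchange k \<pi> -` A \<inter> {0..1}"
    let ?C = "\<lambda>p. {x \<in> {0..<1}. cell k x = p}"
    have S: "?S \<in> sets borel"
      using measurable_sets[OF m A(1)] by auto
    have piece: "emeasure lborel (?S \<inter> ?C p) = emeasure lborel (A \<inter> ?C (\<pi> p))" if p: "p < k" for p
    proof -
      define c where "c = (real (\<pi> p) - real p) / k"
      have AC: "A \<inter> ?C (\<pi> p) \<in> sets borel"
      proof -
        have "{x \<in> space borel. x \<in> {0..<1} \<and> cell k x = \<pi> p} \<in> sets borel" by measurable
        then show ?thesis using A(1) by (auto intro: sets.Int)
      qed
      have \<pi>p: "\<pi> p < k" using \<pi>' p by auto
      have "x \<in> ?S \<inter> ?C p \<longleftrightarrow> c + x \<in> A \<inter> ?C (\<pi> p)" for x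
      proof
        assume x: "x \<in> ?S \<inter> ?C p"
        then have x01: "x \<in> {0..<1}" and p': "cell k x = p" and xA: "interval_exchange k \<pi> x \<in> A"
          by simp_all
        have "interval_exchange k \<pi> x = c + x" using x01 p' by (simp add: interval_exchange_def c_def)
        then show "c + x \<in> A \<inter> ?C (\<pi> p)"
          using xA p' interval_exchange_cell[OF k \<pi>' x01] by simp
      next
        assume x: "c + x \<in> A \<inter> ?C (\<pi> p)"
        then have b: "real (\<pi> p) / k \<le> c + x" "c + x < (real (\<pi> p) + 1) / k"
          using cell_eq_iff[OF k, of "c + x" "\<pi> p"] by auto
        then have b': "real p / k \<le> x" "x < (real p + 1) / k"
          by (auto simp: c_def add_divide_distrib diff_divide_distrib)
        have "0 \<le> real p / k" "(real p + 1) / k \<le> 1" using p by (auto simp: field_simps)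
        then have x01: "0 \<le> x" "x < 1" using b' by linarith+
        then have p': "cell k x = p" using cell_eq_iff[OF k, of x p] b' by simp
        then have "interval_exchange k \<pi> x = c + x"
          using x01 by (simp add: interval_exchange_def c_def)
        then have "interval_exchange k \<pi> x \<in> A" using x by simp
        then show "x \<in> ?S \<inter> ?C p" using p' x01 by simp
      qed
      then have eq: "?S \<inter> ?C p = (+) c -` (A \<inter> ?C (\<pi> p))"
        by (intro set_eqI) (simp only: vimage_eq)
      have "emeasure (distr lborel borel ((+) c)) (A \<inter> ?C (\<pi> p)) =
          emeasure lborel ((+) c -` (A \<inter> ?C (\<pi> p)) \<inter> space lborel)"
        using AC by (intro emeasure_distr) auto
      then show ?thesis by (simp only: eq lborel_distr_plus space_lborel space_borel Int_UNIV_right)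
    qed
    have "emeasure (distr borel_interval borel_interval (interval_exchange k \<pi>)) A = emeasure lborel ?S"
      using A(3) m' S by (subst emeasure_distr) (auto simp: em)
    also have "\<dots> = (\<Sum>p<k. emeasure lborel (?S \<inter> ?C p))"
      by (rule sum_emeasure_cells[OF k S, symmetric]) auto
    also have "\<dots> = (\<Sum>p<k. emeasure lborel (A \<inter> ?C (\<pi> p)))"
      by (intro sum.cong refl piece) auto
    also have "\<dots> = (\<Sum>p<k. emeasure lborel (A \<inter> ?C p))"
      by (rule sum.reindex_bij_betw[OF \<pi>])
    also have "\<dots> = emeasure borel_interval A"
      using sum_emeasure_cells[OF k A(1,2)] em[OF A(2,1)] by simp
    finally show "emeasure (distr borel_interval borel_interval (interval_exchange k \<pi>)) A =
        emeasure borel_interval A" .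
  qed simp
  with m' show ?thesis by (simp add: measure_preserving_def)
qed

text \<open>The half-open interval serves as both co-null sets, and the exchange with the inverse
  permutation is the inverse map on it.\<close>

lemma interval_exchange_ae_bijection:
  assumes k: "k > 0" and \<pi>: "bij_betw \<pi> {..<k} {..<k}"
  shows "interval_exchange k \<pi> \<in> ae_bijections"
proof -
  have mp: "measure_preserving unit_interval unit_interval (interval_exchange k \<pi>)"
    unfolding unit_interval_eq by (rule mp_completion[OF mp_interval_exchange[OF assms]])
  define \<rho> where "\<rho> = the_inv_into {..<k} \<pi>"
  have \<rho>: "bij_betw \<rho> {..<k} {..<k}" unfolding \<rho>_def by (rule bij_betw_the_inv_into[OF \<pi>])
  have inv: "\<rho> (\<pi> p) = p" "\<pi> (\<rho> p) = p" if "p < k" for p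
    using \<pi> that by (auto simp: \<rho>_def bij_betw_def the_inv_into_f_f f_the_inv_into_f)
  have im: "\<pi> ` {..<k} \<subseteq> {..<k}" "\<rho> ` {..<k} \<subseteq> {..<k}" using \<pi> \<rho> by (auto simp: bij_betw_def)
  have bij: "bij_betw (interval_exchange k \<pi>) {0..<1} {0..<1}"
    by (rule bij_betw_byWitness[where f' = "interval_exchange k \<rho>"])
       (use interval_exchange_inverse[OF k im(1) inv(1)] interval_exchange_inverse[OF k im(2) inv(2)]
          interval_exchange_cell(1)[OF k im(1)] interval_exchange_cell(1)[OF k im(2)] in \<open>blast+\<close>)
  have "{0..1} - {0..<1} = {1::real}" by auto
  then have "{0..1} - {0..<1::real} \<in> null_sets lebesgue" by (simp add: null_sets_def)
  then show ?thesis
    unfolding ae_bijections_def using mp bij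
    by (auto simp: measure_preserving_def intro!: exI[of _ "{0..<1::real}"])
qed

section \<open>Concentration of cell counts and edge sums\<close>

lemma expectation_cell_counts:
  assumes m: "m > 0" and k: "k = m * q"
  shows "ess_bounded (unit_cube k) (\<lambda>x. \<Sum>a<m. (real (card {i \<in> {1..k}. cell m (x i) = a}) - q)\<^sup>2)" (is ?B)
    "(\<integral>x. (\<Sum>a<m. (real (card {i \<in> {1..k}. cell m (x i) = a}) - q)\<^sup>2) \<partial>unit_cube k) \<le> k" (is ?E)
proof -
  \<comment> \<open>The centred indicator of cell \<open>a\<close>. Its sum over
    \<open>p < m\<close> is 0, so the products for two distinct nodes integrate to 0, while its
    square has mean at most \<open>1 / m\<close>. Over \<open>m\<close> cells and \<open>k\<close>
    nodes this adds up to \<open>k\<close>.\<close>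
  define y where "y a p = (if p = a then 1 else 0) - 1 / real m" for a p :: nat
  have yb: "\<bar>y a p\<bar> \<le> 2" for a p
  proof -
    have "\<bar>(if p = a then 1 else 0) - z\<bar> \<le> 2" if "0 \<le> z" "z \<le> 1" for z :: real
      using that by simp
    from this[of "1 / real m"] show ?thesis using m unfolding y_def by simp
  qed
  have bd: "ess_bounded (unit_cube k) (\<lambda>x. y a (cell m (x i)))" if "i \<in> {1..k}" for a i
    by (rule ess_bounded_mp[OF mp_coord[OF that], of "\<lambda>z. y a (cell m z)"], rule ess_boundedI[of _ _ 2])
       (auto intro!: borel_measurable_step1 measurable_cell yb)
  have bd2: "ess_bounded (unit_cube k) (\<lambda>x. y a (cell m (x i)) * y a (cell m (x j)))"
    if "i \<in> {1..k}" "j \<in> {1..k}" for a i j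
    by (intro ess_bounded_mult bd that)
  have "(real (card {i \<in> {1..k}. cell m (x i) = a}) - q)\<^sup>2 =
      (\<Sum>i\<in>{1..k}. \<Sum>j\<in>{1..k}. y a (cell m (x i)) * y a (cell m (x j)))" for a and x :: "nat \<Rightarrow> real"
  proof -
    have "real (card {i \<in> {1..k}. cell m (x i) = a}) = (\<Sum>i\<in>{1..k}. if cell m (x i) = a then 1 else 0)"
      by (simp add: sum.If_cases Int_def)
    then have "real (card {i \<in> {1..k}. cell m (x i) = a}) - q = (\<Sum>i\<in>{1..k}. y a (cell m (x i)))"
      using m by (simp add: y_def sum_subtractf k)
    then show ?thesis by (simp add: power2_eq_square sum_product)
  qed
  then have eq: "(\<lambda>x. \<Sum>a<m. (real (card {i \<in> {1..k}. cell m (x i) = a}) - q)\<^sup>2) =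
      (\<lambda>x. \<Sum>a<m. \<Sum>i\<in>{1..k}. \<Sum>j\<in>{1..k}. y a (cell m (x i)) * y a (cell m (x j)))" by (intro ext) simp
  have sumb: "ess_bounded M (\<lambda>x. \<Sum>i\<in>I. h i x)" if "\<And>i. i \<in> I \<Longrightarrow> ess_bounded M (h i)"
    for I :: "nat set" and h and M :: "(nat \<Rightarrow> real) measure"
    using that by (induction I rule: infinite_finite_induct) (auto intro: ess_bounded_const ess_bounded_add)
  show ?B unfolding eq by (intro sumb bd2)
  have int: "(\<integral>x. y a (cell m (x i)) * y a (cell m (x j)) \<partial>unit_cube k) \<le> (if i = j then 1 / m else 0)"
    if a: "a < m" and ij: "i \<in> {1..k}" "j \<in> {1..k}" for a i j
  proof (cases "i = j")
    case True
    have "(\<integral>x. y a (cell m (x i)) * y a (cell m (x j)) \<partial>unit_cube k) = (\<integral>z. (y a (cell m z))\<^sup>2 \<partial>unit_interval)"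
      unfolding True using mp_integral[OF mp_coord[OF ij(2)], of "\<lambda>z. (y a (cell m z))\<^sup>2"]
      by (simp add: power2_eq_square borel_measurable_step1)
    also have "\<dots> = (\<Sum>p<m. (y a p)\<^sup>2) / m" by (rule integral_step1[OF m])
    also have "(\<Sum>p<m. (y a p)\<^sup>2) = (\<Sum>p<m. (if p = a then 1 - 2 / m else 0) + 1 / (real m)\<^sup>2)"
      by (intro sum.cong refl) (simp add: y_def power2_eq_square algebra_simps)
    also have "\<dots> = 1 - 1 / m"
      using a by (simp add: sum.distrib power2_eq_square)
    also have "(1 - 1 / m) / m \<le> 1 / m" by (intro divide_right_mono) auto
    finally show ?thesis using True by simp
  next
    case False
    have "(\<integral>x. y a (cell m (x i)) * y a (cell m (x j)) \<partial>unit_cube k) =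
        (\<integral>z. y a (cell m (fst z)) * y a (cell m (snd z)) \<partial>unit_square)"
      using mp_integral[OF mp_coord_pair[OF ij False], of "\<lambda>z. y a (cell m (fst z)) * y a (cell m (snd z))"]
        borel_measurable_step2[OF measurable_cell, of "\<lambda>p p'. y a p * y a p'" m] by simp
    also have "\<dots> = (\<Sum>p<m. \<Sum>p'<m. y a p * y a p') / (real m)\<^sup>2"
      by (rule integral_step2[OF m])
    also have "(\<Sum>p<m. \<Sum>p'<m. y a p * y a p') = (\<Sum>p<m. y a p) * (\<Sum>p<m. y a p)"
      by (simp add: sum_product)
    also have "(\<Sum>p<m. y a p) = 0" using a by (simp add: y_def sum_subtractf)
    finally show ?thesis using False by simp
  qed
  have i: "integrable (unit_cube k) (\<lambda>x. y a (cell m (x i)) * y a (cell m (x j)))"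
    if "i \<in> {1..k}" "j \<in> {1..k}" for a i j
    using bd2[OF that] by (rule C.ess_bounded_integrable)
  have "(\<integral>x. (\<Sum>a<m. \<Sum>i\<in>{1..k}. \<Sum>j\<in>{1..k}. y a (cell m (x i)) * y a (cell m (x j))) \<partial>unit_cube k) =
      (\<Sum>a<m. \<Sum>i\<in>{1..k}. \<Sum>j\<in>{1..k}. \<integral>x. y a (cell m (x i)) * y a (cell m (x j)) \<partial>unit_cube k)"
    by (simp only: Bochner_Integration.integral_sum Bochner_Integration.integrable_sum i cong: sum.cong)
  also have "\<dots> \<le> (\<Sum>a<m. \<Sum>i\<in>{1..k}. \<Sum>j\<in>{1..k}. if i = j then 1 / m else 0)"
    by (intro sum_mono int) auto
  also have "\<dots> = k" using m by simp
  finally show ?E unfolding eq .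
qed

text \<open>Gathers the two orders of every pair into one summand, so that different summands
  involve different edges and hence independent variables. \<open>G\<close> need not be
  symmetric.\<close>

lemma sum_offdiag:
  fixes G :: "nat \<Rightarrow> nat \<Rightarrow> real"
  shows "(\<Sum>i\<in>{1..k}. \<Sum>j\<in>{1..k}. if i = j then 0 else G i j) =
    (\<Sum>e\<in>vertex_pairs k. G (Min e) (Max e) + G (Max e) (Min e))"
proof -
  let ?L = "{(i, j). i \<in> {1..k} \<and> j \<in> {1..k} \<and> i < j}"
  have fin: "finite ?L" by (rule finite_subset[of _ "{1..k} \<times> {1..k}"]) auto
  have bij: "bij_betw (\<lambda>(i, j). {i, j}) ?L (vertex_pairs k)"
    by (rule bij_betw_byWitness[where f' = "\<lambda>e. (Min e, Max e)"])
       (use vertex_pairsD[of _ k] in \<open>auto simp: vertex_pairs_def min_def max_def\<close>)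
  have "(\<Sum>i\<in>{1..k}. \<Sum>j\<in>{1..k}. if i = j then 0 else G i j) =
      (\<Sum>i\<in>{1..k}. \<Sum>j\<in>{1..k}. (if i < j then G i j else 0) + (if j < i then G i j else 0))"
    by (intro sum.cong refl) auto
  also have "\<dots> = (\<Sum>i\<in>{1..k}. \<Sum>j\<in>{1..k}. if i < j then G i j else 0) +
      (\<Sum>j\<in>{1..k}. \<Sum>i\<in>{1..k}. if j < i then G i j else 0)"
    by (subst (3) sum.swap) (simp add: sum.distrib)
  also have "\<dots> = (\<Sum>i\<in>{1..k}. \<Sum>j\<in>{1..k}. if i < j then G i j + G j i else 0)"
    unfolding sum.distrib[symmetric] by (intro sum.cong refl) auto
  also have "\<dots> = (\<Sum>p\<in>{1..k} \<times> {1..k}. if fst p < snd p then G (fst p) (snd p) + G (snd p) (fst p) else 0)"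
    by (simp add: sum.cartesian_product case_prod_beta)
  also have "\<dots> = (\<Sum>p\<in>?L. G (fst p) (snd p) + G (snd p) (fst p))"
    by (intro sum.mono_neutral_cong_right) auto
  also have "\<dots> = (\<Sum>p\<in>?L. (\<lambda>e. G (Min e) (Max e) + G (Max e) (Min e)) ((\<lambda>(i, j). {i, j}) p))"
    by (intro sum.cong refl) (auto simp: min_def max_def)
  also have "\<dots> = (\<Sum>e\<in>vertex_pairs k. G (Min e) (Max e) + G (Max e) (Min e))"
    by (rule sum.reindex_bij_betw[OF bij])
  finally show ?thesis .
qed

lemma card_vertex_pairs: "2 * card (vertex_pairs k) \<le> k * k"
proof -
  have "(\<Sum>i\<in>{1..k}. \<Sum>j\<in>{1..k}. if i = j then 0 else 1 :: real) \<le> (\<Sum>i\<in>{1..k}. \<Sum>j\<in>{1..k}. 1)"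
    by (intro sum_mono) auto
  then have "2 * real (card (vertex_pairs k)) \<le> real k * real k"
    unfolding sum_offdiag[where G = "\<lambda>_ _. 1"] by simp
  then have "real (2 * card (vertex_pairs k)) \<le> real (k * k)" by simp
  then show ?thesis by (simp only: of_nat_le_iff)
qed

text \<open>For fixed positions the edges are independent, and Hoeffding's inequality applies. With
  \<open>t\<close> proportional to \<open>k^2\<close> the exponent is of order \<open>k^2\<close>,
  which is what a union bound over exponentially many tests requires.\<close>

lemma edge_noise:
  assumes W: "(W, f) \<in> graphon_signals r" "x \<in> space (unit_cube k)"
    and B: "\<And>i j. \<bar>B i j\<bar> \<le> (1::real)" and k: "k \<ge> 2" and t: "t \<ge> 0"
  shows "measure_pmf.prob (random_edges k W x)
      {E. \<bar>\<Sum>i\<in>{1..k}. \<Sum>j\<in>{1..k}. if i = j then 0 else (of_bool ({i, j} \<in> E) - edge_value W x {i, j}) * B i j\<bar> \<ge> t}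
    \<le> 2 * exp (- t\<^sup>2 / (4 * (real k)\<^sup>2))"
proof -
  let ?P = "vertex_pairs k"
  let ?p = "Pi_pmf ?P False (\<lambda>e. bernoulli_pmf (edge_value W x e))"
  define b where "b e = B (Min e) (Max e) + B (Max e) (Min e)" for e
  define X where "X e h = (if h e then b e else 0)" for e and h :: "nat set \<Rightarrow> bool"
  have bb: "\<bar>b e\<bar> \<le> 2" for e using B[of "Min e" "Max e"] B[of "Max e" "Min e"] by (simp add: b_def)
  \<comment> \<open>At least one pair is needed to make the sum of the squared ranges
    positive.\<close>
  have "vertex_pairs k \<noteq> {}"
    using k by (auto simp: vertex_pairs_def intro!: exI[of _ "{1, 2}"])
  then have P0: "card ?P > 0" using finite_vertex_pairs by (simp add: card_gt_0_iff)
  have EX: "measure_pmf.expectation ?p (X e) = edge_value W x e * b e" if "e \<in> ?P" for e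
  proof -
    have "measure_pmf.expectation ?p (X e) =
        measure_pmf.expectation (map_pmf (\<lambda>h. h e) ?p) (\<lambda>v. if v then b e else 0)"
      by (simp add: X_def[abs_def])
    also have "map_pmf (\<lambda>h. h e) ?p = bernoulli_pmf (edge_value W x e)"
      using that by (simp add: Pi_pmf_component finite_vertex_pairs)
    also have "measure_pmf.expectation (bernoulli_pmf (edge_value W x e)) (\<lambda>v. if v then b e else 0) =
        edge_value W x e * b e"
      using edge_value_01[OF W that] by simp
    finally show ?thesis .
  qed
  interpret H: Hoeffding_ineq "measure_pmf ?p" ?P X "\<lambda>_. -2" "\<lambda>_. 2" "\<Sum>e\<in>?P. edge_value W x e * b e"
  proof unfold_locales
    show "finite ?P" by (rule finite_vertex_pairs)
    have "prob_space.indep_vars (measure_pmf ?p) (\<lambda>_. borel) (\<lambda>e h. (\<lambda>v. if v then b e else 0) (h e)) ?P"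
      by (rule prob_space.indep_vars_compose2[OF measure_pmf.prob_space_axioms
            indep_vars_Pi_pmf[OF finite_vertex_pairs]]) simp
    then show "prob_space.indep_vars (measure_pmf ?p) (\<lambda>_. borel) X ?P" by (simp add: X_def[abs_def])
    show "AE h in measure_pmf ?p. X e h \<in> {-2..2}" for e
      using bb[of e] by (intro AE_I2) (auto simp: X_def)
    show "(\<Sum>e\<in>?P. edge_value W x e * b e) \<equiv> (\<Sum>e\<in>?P. measure_pmf.expectation ?p (X e))"
      by (rule eq_reflection) (simp add: EX)
  qed
  have sum: "(\<Sum>i\<in>{1..k}. \<Sum>j\<in>{1..k}. if i = j then 0 else (of_bool ({i, j} \<in> E) - edge_value W x {i, j}) * B i j) =
      (\<Sum>e\<in>?P. of_bool (e \<in> E) * b e) - (\<Sum>e\<in>?P. edge_value W x e * b e)" for E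
    unfolding sum_offdiag sum_subtractf[symmetric]
  proof (intro sum.cong refl)
    fix e assume "e \<in> ?P"
    then have "{Min e, Max e} = e" "{Max e, Min e} = e"
      using vertex_pairsD(4) by (metis, metis insert_commute)
    then show "(of_bool ({Min e, Max e} \<in> E) - edge_value W x {Min e, Max e}) * B (Min e) (Max e) +
         (of_bool ({Max e, Min e} \<in> E) - edge_value W x {Max e, Min e}) * B (Max e) (Min e) =
         of_bool (e \<in> E) * b e - edge_value W x e * b e"
      by (simp add: b_def algebra_simps)
  qed
  have "measure_pmf.prob (random_edges k W x)
      {E. \<bar>\<Sum>i\<in>{1..k}. \<Sum>j\<in>{1..k}. if i = j then 0 else (of_bool ({i, j} \<in> E) - edge_value W x {i, j}) * B i j\<bar> \<ge> t} =
    measure_pmf.prob ?p {h. \<bar>(\<Sum>e\<in>?P. X e h) - (\<Sum>e\<in>?P. edge_value W x e * b e)\<bar> \<ge> t}"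
  proof -
    have "(\<Sum>e\<in>?P. of_bool (e \<in> ?P \<and> h e) * b e) = (\<Sum>e\<in>?P. X e h)" for h
      by (intro sum.cong refl) (auto simp: X_def)
    then show ?thesis
      by (simp only: random_edges_def measure_map_pmf sum vimage_def mem_Collect_eq)
  qed
  \<comment> \<open>Each summand is confined to an interval of length 4, because the two orders of
    an edge contribute up to 1 each. With at most \<open>k^2 / 2\<close> pairs the denominator is at
    most \<open>8 * k^2\<close>.\<close>
  also have "\<dots> \<le> 2 * exp (- 2 * t\<^sup>2 / (\<Sum>e\<in>?P. (2 - (-2))\<^sup>2))"
    using H.Hoeffding_ineq_abs_ge[OF t] P0 by simp
  also have "\<dots> \<le> 2 * exp (- t\<^sup>2 / (4 * (real k)\<^sup>2))"
  proof -
    have "2 * real (card ?P) \<le> (real k)\<^sup>2"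
      using card_vertex_pairs[of k] by (simp add: power2_eq_square flip: of_nat_mult)
    then have "2 * t\<^sup>2 / (8 * (real k)\<^sup>2) \<le> 2 * t\<^sup>2 / (16 * real (card ?P))"
      using P0 k by (intro divide_left_mono) auto
    then show ?thesis by simp
  qed
  finally show ?thesis .
qed

subsection \<open>Graphs fitting a step function\<close>

lemma sum_if_diag:
  fixes c :: real
  shows "(\<Sum>i\<in>{1..k}. \<Sum>j\<in>{1..k}. if i = j then c else 0) = real k * c"
  by simp

text \<open>Purely deterministic bookkeeping: \<open>w\<close> holds edge probabilities,
  \<open>X\<close> the realised edges, \<open>c\<close> the blocks containing the sample points,
  \<open>b\<close> the blocks assigned to the nodes, and \<open>B\<close> is the test. The total
  error consists of noise, step function approximation, misplaced nodes and the diagonal.\<close>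

lemma sample_deviation:
  fixes u X w B :: "nat \<Rightarrow> nat \<Rightarrow> real" and a s :: "nat \<Rightarrow> real" and c b :: "nat \<Rightarrow> nat"
  assumes u: "\<And>i j. \<bar>u i j\<bar> \<le> 1" and a: "\<And>i. \<bar>a i\<bar> \<le> r" and B: "\<And>i j. \<bar>B i j\<bar> \<le> 1"
    and edges: "(\<Sum>i\<in>{1..k}. \<Sum>j\<in>{1..k}. if i = j then 0 else \<bar>w i j - u (c i) (c j)\<bar>) \<le> errw"
    and nodes: "(\<Sum>i\<in>{1..k}. \<bar>s i - a (c i)\<bar>) \<le> errs"
    and noise: "\<bar>\<Sum>i\<in>{1..k}. \<Sum>j\<in>{1..k}. if i = j then 0 else (X i j - w i j) * B i j\<bar> \<le> errn"
    and bad: "real (card {i \<in> {1..k}. b i \<noteq> c i}) \<le> d"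
  shows "(\<Sum>i\<in>{1..k}. \<bar>s i - a (b i)\<bar>) \<le> errs + 2 * r * d"
    "\<bar>\<Sum>i\<in>{1..k}. \<Sum>j\<in>{1..k}. ((if i = j then 0 else X i j) - u (b i) (b j)) * B i j\<bar> \<le> errn + errw + 4 * d * k + k"
proof -
  define h where "h i = (if b i \<noteq> c i then 1 else 0 :: real)" for i
  have hsum: "(\<Sum>i\<in>{1..k}. h i) \<le> d"
    using bad by (simp add: h_def sum.If_cases Int_def)
  have r: "r \<ge> 0" using a[of 0] by linarith
  have "(\<Sum>i\<in>{1..k}. \<bar>s i - a (b i)\<bar>) \<le> (\<Sum>i\<in>{1..k}. \<bar>s i - a (c i)\<bar> + 2 * r * h i)"
  proof (rule sum_mono)
    fix i
    show "\<bar>s i - a (b i)\<bar> \<le> \<bar>s i - a (c i)\<bar> + 2 * r * h i"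
      using a[of "b i"] a[of "c i"] by (auto simp: h_def)
  qed
  also have "\<dots> = (\<Sum>i\<in>{1..k}. \<bar>s i - a (c i)\<bar>) + 2 * r * (\<Sum>i\<in>{1..k}. h i)"
    by (simp add: sum.distrib sum_distrib_left)
  also have "\<dots> \<le> errs + 2 * r * d"
    using nodes hsum r by (intro add_mono mult_left_mono) auto
  finally show "(\<Sum>i\<in>{1..k}. \<bar>s i - a (b i)\<bar>) \<le> errs + 2 * r * d" .
  let ?D = "\<lambda>i j. ((if i = j then 0 else X i j) - u (b i) (b j)) * B i j"
  let ?N = "\<lambda>i j. if i = j then 0 else (X i j - w i j) * B i j"
  \<comment> \<open>A misplaced end point changes the step function by at most 2, which sums to
    \<open>4 * d * k\<close> over all pairs. On the diagonal, where a graph without loops has entry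
    0, each of the \<open>k\<close> terms is at most 1.\<close>
  let ?E = "\<lambda>i j. (if i = j then 0 else \<bar>w i j - u (c i) (c j)\<bar>) + (2 * h i + 2 * h j) + (if i = j then 1 else 0)"
  have pt: "\<bar>?D i j - ?N i j\<bar> \<le> ?E i j" for i j
  proof (cases "i = j")
    case True
    have "\<bar>u (b j) (b j) * B j j\<bar> \<le> 1"
      unfolding abs_mult using u B by (intro mult_le_one) auto
    then show ?thesis using True by (cases "b j = c j") (auto simp: h_def)
  next
    case False
    have "?D i j - ?N i j = ((w i j - u (c i) (c j)) + (u (c i) (c j) - u (b i) (b j))) * B i j"
      using False by (simp add: algebra_simps)
    also have "\<bar>\<dots>\<bar> \<le> \<bar>(w i j - u (c i) (c j)) + (u (c i) (c j) - u (b i) (b j))\<bar>"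
      unfolding abs_mult using B by (intro mult_left_le) auto
    also have "\<dots> \<le> \<bar>w i j - u (c i) (c j)\<bar> + \<bar>u (c i) (c j) - u (b i) (b j)\<bar>" by (rule abs_triangle_ineq)
    also have "\<bar>u (c i) (c j) - u (b i) (b j)\<bar> \<le> 2 * h i + 2 * h j"
    proof (cases "b i = c i \<and> b j = c j")
      case False
      then show ?thesis using u[of "c i" "c j"] u[of "b i" "b j"] by (auto simp: h_def)
    qed (simp add: h_def)
    finally show ?thesis using False by simp
  qed
  have "\<bar>(\<Sum>i\<in>{1..k}. \<Sum>j\<in>{1..k}. ?D i j) - (\<Sum>i\<in>{1..k}. \<Sum>j\<in>{1..k}. ?N i j)\<bar> =
      \<bar>\<Sum>i\<in>{1..k}. \<Sum>j\<in>{1..k}. ?D i j - ?N i j\<bar>"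
    by (simp only: sum_subtractf)
  also have "\<dots> \<le> (\<Sum>i\<in>{1..k}. \<Sum>j\<in>{1..k}. ?E i j)"
    by (intro order_trans[OF sum_abs] sum_mono pt)
  also have "\<dots> = (\<Sum>i\<in>{1..k}. \<Sum>j\<in>{1..k}. if i = j then 0 else \<bar>w i j - u (c i) (c j)\<bar>) +
      4 * (\<Sum>i\<in>{1..k}. h i) * k + k"
    unfolding sum.distrib sum_if_diag by (simp flip: sum_distrib_left)
  also have "\<dots> \<le> errw + 4 * d * k + k"
    using edges hsum by (intro add_mono mult_right_mono mult_left_mono) auto
  finally show "\<bar>\<Sum>i\<in>{1..k}. \<Sum>j\<in>{1..k}. ?D i j\<bar> \<le> errn + errw + 4 * d * k + k"
    using noise by linarith
qed

text \<open>A permutation \<open>\<sigma>\<close> places the node \<open>i\<close> in the cell \<open>\<sigma> i\<close> of the partition into \<open>m * q\<close> cells, which lies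
  in the cell \<open>\<sigma> i div q\<close> of the partition into \<open>m\<close> cells. The tests range over all \<open>\<tau>\<close> because one of
  them will be the arrangement belonging to the other graphon-signal, which is not known in advance.\<close>

definition fitting_permutations ::
    "nat \<Rightarrow> nat \<Rightarrow> (nat \<Rightarrow> nat \<Rightarrow> real) \<Rightarrow> (nat \<Rightarrow> nat \<Rightarrow> real) set \<Rightarrow> real \<Rightarrow> nat set set \<Rightarrow> (nat \<Rightarrow> nat) set" where
  "fitting_permutations m q u T \<delta> E = {\<sigma> \<in> {1..m * q} \<rightarrow>\<^sub>E {..<m * q}. bij_betw \<sigma> {1..m * q} {..<m * q} \<and>
     (\<forall>\<beta>\<in>T. \<forall>\<tau>\<in>{1..m * q} \<rightarrow>\<^sub>E {..<m}.
       \<bar>\<Sum>i\<in>{1..m * q}. \<Sum>j\<in>{1..m * q}. ((if i = j then 0 else of_bool ({i, j} \<in> E)) - u (\<sigma> i div q) (\<sigma> j div q)) *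
          \<beta> (\<tau> i) (\<tau> j)\<bar> \<le> \<delta> * (real (m * q))\<^sup>2)}"

text \<open>The positions of the sampled nodes do not occur, so the event can be evaluated under the
  law of either graphon-signal. Being a finite union over \<open>E\<close> and
  \<open>\<sigma>\<close>, it is measurable.\<close>

definition fitting_graphs ::
    "nat \<Rightarrow> nat \<Rightarrow> (nat \<Rightarrow> nat \<Rightarrow> real) \<Rightarrow> (nat \<Rightarrow> real) \<Rightarrow> (nat \<Rightarrow> nat \<Rightarrow> real) set \<Rightarrow> real \<Rightarrow>
      (nat set set \<times> (nat \<Rightarrow> real)) set" where
  "fitting_graphs m q u a T \<delta> = (\<Union>E\<in>Pow (vertex_pairs (m * q)). \<Union>\<sigma>\<in>fitting_permutations m q u T \<delta> E.
     {E} \<times> {s \<in> space (Pi\<^sub>M {1..m * q} (\<lambda>_. borel)). (\<Sum>i\<in>{1..m * q}. \<bar>s i - a (\<sigma> i div q)\<bar>) \<le> \<delta> * real (m * q)})"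

lemma sets_fitting_graphs:
  "fitting_graphs m q u a T \<delta> \<in> sets (simple_graph_space (m * q))"
  unfolding fitting_graphs_def
proof (intro sets.finite_UN pair_measureI)
  show "finite (Pow (vertex_pairs (m * q)))" using finite_vertex_pairs by simp
  show "finite (fitting_permutations m q u T \<delta> E)" for E
    by (rule finite_subset[of _ "{1..m * q} \<rightarrow>\<^sub>E {..<m * q}"])
       (auto simp: fitting_permutations_def intro: finite_PiE)
  show "{s \<in> space (Pi\<^sub>M {1..m * q} (\<lambda>_. borel)). (\<Sum>i\<in>{1..m * q}. \<bar>s i - a (\<sigma> i div q)\<bar>) \<le> \<delta> * real (m * q)}
      \<in> sets (Pi\<^sub>M {1..m * q} (\<lambda>_. borel))" for \<sigma>
  proof -
    have "(\<lambda>s. \<Sum>i\<in>{1..m * q}. \<bar>s i - a (\<sigma> i div q)\<bar>) \<in> borel_measurable (Pi\<^sub>M {1..m * q} (\<lambda>_. borel))"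
      by (intro borel_measurable_sum borel_measurable_abs borel_measurable_diff
          measurable_component_singleton borel_measurable_const)
    then show ?thesis by measurable
  qed
qed auto

lemma exp_5_ge_32: "exp (5::real) \<ge> 32"
proof -
  have "(2::real) ^ 5 \<le> exp 1 ^ 5"
    using exp_ge_add_one_self[of 1] by (intro power_mono) auto
  also have "\<dots> = exp (5::real)" by (simp flip: exp_of_nat_mult)
  finally show ?thesis by simp
qed

text \<open>For well spread positions only the edges are random. The permutation is chosen from the
  positions alone, before the edges are drawn, so the union bound runs over the tests only: at most
  two choices of \<open>\<beta>\<close> and \<open>m ^ k\<close> of \<open>\<tau>\<close>, each with
  the factor 2 of Hoeffding's inequality.\<close>

lemma sampled_graph_fits_pointwise:
  assumes W: "(W, f) \<in> graphon_signals r" "x \<in> space (unit_cube k)" and k: "k = m * q" "q > 0" "k \<ge> 2"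
    and \<eta>: "\<eta> > 0" "1 / \<eta> \<le> k"
    and u: "\<And>i j. \<bar>u i j\<bar> \<le> 1" and a: "\<And>i. \<bar>a i\<bar> \<le> r"
    and T: "finite T" "card T \<le> 2" "\<forall>\<beta>\<in>T. \<forall>i j. \<bar>\<beta> i j\<bar> \<le> 1"
    and tail: "4 * real m ^ k * exp (- (\<eta>\<^sup>2 * (real k)\<^sup>2 / 4)) \<le> 1 / 8"
    and edges: "(\<Sum>i\<in>{1..k}. \<Sum>j\<in>{1..k}. if i = j then 0 else \<bar>W (x i, x j) - u (cell m (x i)) (cell m (x j))\<bar>) \<le> 24 * \<eta> * (real k)\<^sup>2"
    and nodes: "(\<Sum>i\<in>{1..k}. \<bar>f (x i) - a (cell m (x i))\<bar>) \<le> 24 * \<eta> * k"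
    and counts: "(\<Sum>a<m. (real (card {i \<in> {1..k}. cell m (x i) = a}) - q)\<^sup>2) \<le> 24 * real k"
    and large: "24 * real m \<le> \<eta>\<^sup>2 * k"
  shows "measure_pmf.prob (random_edges k W x) {E. (E, node_signal k f x) \<in> fitting_graphs m q u a T ((30 + 2 * r) * \<eta>)} \<ge> 7 / 8"
proof -
  \<comment> \<open>For the edges 30 collects 1 from noise, 24 from approximation, 4 from misplaced
    nodes and 1 from the diagonal, in multiples of \<open>\<eta> * k^2\<close>. The nodes need
    \<open>24 + 2 * r\<close> in multiples of \<open>\<eta> * k\<close>.\<close>
  let ?\<delta> = "(30 + 2 * r) * \<eta>"
  define c where "c i = cell m (x i)" for i
  obtain \<sigma>0 where \<sigma>0: "bij_betw \<sigma>0 {1..m * q} {..<m * q}"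
    "card {i \<in> {1..m * q}. \<sigma>0 i div q \<noteq> c i} \<le> (\<Sum>a<m. q - card {i \<in> {1..m * q}. c i = a})"
    using ex_block_assignment[OF k(2)] by blast
  define \<sigma> where "\<sigma> = restrict \<sigma>0 {1..k}"
  have \<sigma>b: "bij_betw \<sigma> {1..k} {..<k}"
    using \<sigma>0(1) unfolding \<sigma>_def k(1) by (rule bij_betw_cong[THEN iffD1, rotated]) simp
  have \<sigma>E: "\<sigma> \<in> {1..k} \<rightarrow>\<^sub>E {..<k}"
    using \<sigma>b by (auto simp: \<sigma>_def bij_betw_def)
  have "{i \<in> {1..k}. \<sigma> i div q \<noteq> c i} = {i \<in> {1..m * q}. \<sigma>0 i div q \<noteq> c i}"
    by (auto simp: \<sigma>_def k(1))
  then have bad0: "card {i \<in> {1..k}. \<sigma> i div q \<noteq> c i} \<le> (\<Sum>a<m. q - card {i \<in> {1..k}. c i = a})"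
    using \<sigma>0(2) by (simp add: k(1))
  \<comment> \<open>The Cauchy-Schwarz inequality over the \<open>m\<close> blocks turns the second
    moment bound on the counts into a bound on the vacancies: their square is at most
    \<open>24 * k * m\<close>, hence at most \<open>(\<eta> * k)^2\<close> by
    \<open>large\<close>.\<close>
  have bad: "real (card {i \<in> {1..k}. \<sigma> i div q \<noteq> c i}) \<le> \<eta> * k"
  proof -
    let ?z = "\<lambda>a. real (q - card {i \<in> {1..k}. c i = a})"
    have "(real (card {i \<in> {1..k}. \<sigma> i div q \<noteq> c i}))\<^sup>2 \<le> (\<Sum>a<m. ?z a)\<^sup>2"
      using bad0 by (intro power_mono) (auto simp flip: of_nat_sum)
    also have "\<dots> = (\<Sum>a<m. ?z a * 1)\<^sup>2" by simp
    also have "\<dots> \<le> (\<Sum>a<m. (?z a)\<^sup>2) * (\<Sum>a<m. 1\<^sup>2)" by (rule Cauchy_Schwarz_ineq_sum)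
    also have "\<dots> \<le> (\<Sum>a<m. (real (card {i \<in> {1..k}. c i = a}) - q)\<^sup>2) * (\<Sum>a<m. 1\<^sup>2)"
    proof (intro mult_right_mono sum_mono)
      fix a
      have "\<bar>?z a\<bar> \<le> \<bar>real (card {i \<in> {1..k}. c i = a}) - q\<bar>" by (simp add: of_nat_diff_if)
      then show "(?z a)\<^sup>2 \<le> (real (card {i \<in> {1..k}. c i = a}) - q)\<^sup>2" by (simp only: abs_le_square_iff)
    qed auto
    also have "\<dots> \<le> 24 * real k * m"
      using counts by (simp add: c_def mult_right_mono)
    also have "24 * real k * m = 24 * real m * k" by simp
    also have "\<dots> \<le> \<eta>\<^sup>2 * k * k" by (intro mult_right_mono large) simp
    also have "\<dots> = (\<eta> * k)\<^sup>2" by (simp add: power2_eq_square)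
    finally show ?thesis by (rule power2_le_imp_le) (use \<eta>(1) in simp)
  qed
  have xi: "x i \<in> {0..1}" if "i \<in> {1..k}" for i using W(2) that by (auto simp: space_unit_cube PiE_iff)
  have w: "W (x i, x j) = edge_value W x {i, j}" if "i \<in> {1..k}" "j \<in> {1..k}" for i j
    using edge_value_pair[of W x i j] graphon_signalsD(1)[OF W(1)] xi that by (simp add: is_graphon_def)
  have edges': "(\<Sum>i\<in>{1..k}. \<Sum>j\<in>{1..k}. if i = j then 0 else \<bar>edge_value W x {i, j} - u (c i) (c j)\<bar>) \<le> 24 * \<eta> * (real k)\<^sup>2"
  proof -
    have "(\<Sum>i\<in>{1..k}. \<Sum>j\<in>{1..k}. if i = j then 0 else \<bar>edge_value W x {i, j} - u (c i) (c j)\<bar>) =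
        (\<Sum>i\<in>{1..k}. \<Sum>j\<in>{1..k}. if i = j then 0 else \<bar>W (x i, x j) - u (cell m (x i)) (cell m (x j))\<bar>)"
      by (intro sum.cong refl) (simp only: w c_def)
    then show ?thesis using edges by simp
  qed
  have r: "r \<ge> 0" using graphon_signalsD(9)[OF W(1)] .
  have k1: "real k \<le> \<eta> * (real k)\<^sup>2"
  proof -
    have "1 \<le> \<eta> * k" using \<eta> by (simp add: field_simps)
    then have "1 * real k \<le> (\<eta> * k) * k" by (intro mult_right_mono) auto
    then show ?thesis by (simp add: power2_eq_square mult.assoc)
  qed
  define Noise where "Noise \<beta> \<tau> = {E. \<bar>\<Sum>i\<in>{1..k}. \<Sum>j\<in>{1..k}. if i = j then 0 else
      (of_bool ({i, j} \<in> E) - edge_value W x {i, j}) * \<beta> (\<tau> i) (\<tau> j)\<bar> \<ge> \<eta> * (real k)\<^sup>2}" for \<beta> :: "nat \<Rightarrow> nat \<Rightarrow> real" and \<tau> :: "nat \<Rightarrow> nat"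
  let ?I = "T \<times> ({1..k} \<rightarrow>\<^sub>E {..<m})"
  let ?p = "random_edges k W x"
  have finI: "finite ?I" using T(1) by (intro finite_cartesian_product finite_PiE) auto
  have noise: "measure_pmf.prob ?p (\<Union>(\<beta>, \<tau>)\<in>?I. Noise \<beta> \<tau>) \<le> 1 / 8"
  proof -
    have "measure_pmf.prob ?p (\<Union>z\<in>?I. Noise (fst z) (snd z)) \<le> (\<Sum>z\<in>?I. measure_pmf.prob ?p (Noise (fst z) (snd z)))"
      using finI by (intro measure_pmf.finite_measure_subadditive_finite) auto
    also have "\<dots> \<le> (\<Sum>z\<in>?I. 2 * exp (- (\<eta> * (real k)\<^sup>2)\<^sup>2 / (4 * (real k)\<^sup>2)))"
    proof (rule sum_mono)
      fix z assume "z \<in> ?I"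
      then have "fst z \<in> T" by auto
      then show "measure_pmf.prob ?p (Noise (fst z) (snd z)) \<le> 2 * exp (- (\<eta> * (real k)\<^sup>2)\<^sup>2 / (4 * (real k)\<^sup>2))"
        unfolding Noise_def using \<eta> by (intro edge_noise[OF W _ k(3)] T(3)[rule_format]) auto
    qed
    also have "\<dots> = real (card ?I) * (2 * exp (- (\<eta>\<^sup>2 * (real k)\<^sup>2 / 4)))"
    proof -
      have "(\<eta> * (real k)\<^sup>2)\<^sup>2 / (4 * (real k)\<^sup>2) = \<eta>\<^sup>2 * (real k)\<^sup>2 / 4"
        using k(3) by (simp add: power2_eq_square)
      then show ?thesis by simp
    qed
    also have "\<dots> \<le> (2 * real m ^ k) * (2 * exp (- (\<eta>\<^sup>2 * (real k)\<^sup>2 / 4)))"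
    proof (rule mult_right_mono)
      have "card ?I = card T * m ^ k" by (simp add: card_cartesian_product card_PiE)
      also have "\<dots> \<le> 2 * m ^ k" using T(2) by (rule mult_right_mono) simp
      finally have "real (card ?I) \<le> real (2 * m ^ k)" by (simp only: of_nat_le_iff)
      then show "real (card ?I) \<le> 2 * real m ^ k" by simp
    qed simp
    also have "\<dots> \<le> 1 / 8" using tail by simp
    finally show ?thesis by (simp add: case_prod_beta)
  qed
  have fits: "(E, node_signal k f x) \<in> fitting_graphs m q u a T ?\<delta>"
    if E: "E \<in> Pow (vertex_pairs k)" "E \<notin> (\<Union>(\<beta>, \<tau>)\<in>?I. Noise \<beta> \<tau>)" for E
  proof -
    have no: "\<bar>\<Sum>i\<in>{1..k}. \<Sum>j\<in>{1..k}. if i = j then 0 else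
      (of_bool ({i, j} \<in> E) - edge_value W x {i, j}) * \<beta> (\<tau> i) (\<tau> j)\<bar> \<le> \<eta> * (real k)\<^sup>2"
      if "\<beta> \<in> T" "\<tau> \<in> {1..k} \<rightarrow>\<^sub>E {..<m}" for \<beta> \<tau>
      using E(2) that by (fastforce simp: Noise_def)
    note dev = sample_deviation[where X = "\<lambda>i j. of_bool ({i, j} \<in> E)" and w = "\<lambda>i j. edge_value W x {i, j}"
        and b = "\<lambda>i. \<sigma> i div q" and s = "\<lambda>i. f (x i)", OF u a _ edges' nodes[folded c_def] _ bad]
    \<comment> \<open>The bound for the nodes does not mention the test, so the zero test with noise
      error 0 can be inserted.\<close>
    have 1: "(\<Sum>i\<in>{1..k}. \<bar>f (x i) - a (\<sigma> i div q)\<bar>) \<le> 24 * \<eta> * k + 2 * r * (\<eta> * k)"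
      by (rule dev(1)[where B = "\<lambda>_ _. 0" and errn = 0])
         (simp_all only: mult_zero_right if_cancel sum.neutral_const abs_zero order_refl zero_le_one)
    also have "\<dots> \<le> ?\<delta> * k"
      using \<eta> r by (simp add: algebra_simps)
    finally have s: "(\<Sum>i\<in>{1..k}. \<bar>node_signal k f x i - a (\<sigma> i div q)\<bar>) \<le> ?\<delta> * k"
      by (simp add: node_signal_def)
    have "\<bar>\<Sum>i\<in>{1..k}. \<Sum>j\<in>{1..k}. ((if i = j then 0 else of_bool ({i, j} \<in> E)) - u (\<sigma> i div q) (\<sigma> j div q)) *
          \<beta> (\<tau> i) (\<tau> j)\<bar> \<le> ?\<delta> * (real k)\<^sup>2"
      if \<beta>: "\<beta> \<in> T" and \<tau>: "\<tau> \<in> {1..k} \<rightarrow>\<^sub>E {..<m}" for \<beta> \<tau>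
    proof -
      have "\<bar>\<Sum>i\<in>{1..k}. \<Sum>j\<in>{1..k}. ((if i = j then 0 else of_bool ({i, j} \<in> E)) - u (\<sigma> i div q) (\<sigma> j div q)) *
          \<beta> (\<tau> i) (\<tau> j)\<bar> \<le> \<eta> * (real k)\<^sup>2 + 24 * \<eta> * (real k)\<^sup>2 + 4 * (\<eta> * k) * k + k"
        by (rule dev(2)[OF _ no[OF that]]) (rule T(3)[rule_format, OF \<beta>])
      also have "\<dots> \<le> 30 * \<eta> * (real k)\<^sup>2" using k1 by (simp add: power2_eq_square)
      also have "\<dots> \<le> ?\<delta> * (real k)\<^sup>2" using r \<eta> by (intro mult_right_mono) (auto simp: algebra_simps)
      finally show ?thesis .
    qed
    then have "\<sigma> \<in> fitting_permutations m q u T ?\<delta> E"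
      unfolding fitting_permutations_def using \<sigma>E \<sigma>b by (simp add: k(1))
    moreover have "node_signal k f x \<in> space (Pi\<^sub>M {1..m * q} (\<lambda>_. borel))"
      using node_signal_space[of k f x] by (simp only: k(1))
    ultimately show ?thesis
      unfolding fitting_graphs_def using E(1) s by (auto simp: k(1) intro!: bexI[of _ \<sigma>])
  qed
  have "1 = measure_pmf.prob ?p UNIV" by simp
  also have "\<dots> \<le> measure_pmf.prob ?p ({E. (E, node_signal k f x) \<in> fitting_graphs m q u a T ?\<delta>} \<union> (\<Union>(\<beta>, \<tau>)\<in>?I. Noise \<beta> \<tau>))"
  proof (rule measure_pmf.finite_measure_mono_AE[OF AE_pmfI])
    fix E assume "E \<in> set_pmf ?p"
    then have "E \<in> Pow (vertex_pairs k)" using set_pmf_random_edges by (rule subsetD[rotated])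
    then show "E \<in> UNIV \<longrightarrow> E \<in> {E. (E, node_signal k f x) \<in> fitting_graphs m q u a T ?\<delta>} \<union> (\<Union>(\<beta>, \<tau>)\<in>?I. Noise \<beta> \<tau>)"
      using fits[of E] by (cases "E \<in> (\<Union>(\<beta>, \<tau>)\<in>?I. Noise \<beta> \<tau>)") simp_all
  qed simp
  also have "\<dots> \<le> measure_pmf.prob ?p {E. (E, node_signal k f x) \<in> fitting_graphs m q u a T ?\<delta>} +
      measure_pmf.prob ?p (\<Union>(\<beta>, \<tau>)\<in>?I. Noise \<beta> \<tau>)"
    by (rule measure_Un_le) auto
  finally show ?thesis using noise by linarith
qed

subsection \<open>The equivalence\<close>

text \<open>Markov's inequality, passed to the complementary event.\<close>

lemma (in prob_space) prob_less_of_expectation: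
  assumes T: "integrable M T" "AE x in M. 0 \<le> T x" and c: "c > 0"
  shows "1 - expectation T / c \<le> prob {x \<in> space M. T x < c}"
proof -
  have m: "{x \<in> space M. T x < c} \<in> sets M" "{x \<in> space M. T x \<ge> c} \<in> sets M"
    using borel_measurable_iff_less[THEN iffD1, OF borel_measurable_integrable[OF T(1)]]
      borel_measurable_iff_ge[THEN iffD1, OF borel_measurable_integrable[OF T(1)]] by blast+
  have i: "integrable M (\<lambda>x. c * indicator {x \<in> space M. T x \<ge> c} x)"
    by (intro integrable_mult_right integrable_real_indicator m(2)) (simp add: less_top[symmetric])
  have "c * prob {x \<in> space M. T x \<ge> c} = expectation (\<lambda>x. c * indicator {x \<in> space M. T x \<ge> c} x)"
    by (simp add: Int_absorb2 Collect_subset del: Int_Collect)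
  also have "\<dots> \<le> expectation T"
  proof (rule integral_mono_AE[OF i T(1)])
    show "AE x in M. c * indicator {x \<in> space M. T x \<ge> c} x \<le> T x"
      using T(2) by eventually_elim (simp add: indicator_def)
  qed
  finally have "prob {x \<in> space M. T x \<ge> c} \<le> expectation T / c"
    using c by (simp add: field_simps)
  moreover have "prob {x \<in> space M. T x \<ge> c} = 1 - prob {x \<in> space M. T x < c}"
  proof -
    have "{x \<in> space M. T x \<ge> c} = space M - {x \<in> space M. T x < c}" by auto
    then show ?thesis using prob_compl[OF m(1)] by simp
  qed
  ultimately show ?thesis by linarith
qed

lemma ess_bounded_abs: "ess_bounded M h \<Longrightarrow> ess_bounded M (\<lambda>x. \<bar>h x\<bar>)"
  by (auto simp: ess_bounded_def)

text \<open>Good positions have probability at least \<open>7 / 8\<close>, and given such positions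
  the edges are good with probability at least \<open>7 / 8\<close>. The product
  \<open>49 / 64\<close> still exceeds one half.\<close>

lemma sampled_graph_fits:
  assumes W: "(W, f) \<in> graphon_signals r" and k: "k = m * q" "m > 0" "q > 0" "k \<ge> 2"
    and \<eta>: "\<eta> > 0" "1 / \<eta> \<le> k"
    and u: "\<And>i j. \<bar>u i j\<bar> \<le> 1" and a: "\<And>i. \<bar>a i\<bar> \<le> r"
    and T: "finite T" "card T \<le> 2" "\<forall>\<beta>\<in>T. \<forall>i j. \<bar>\<beta> i j\<bar> \<le> 1"
    and tail: "4 * real m ^ k * exp (- (\<eta>\<^sup>2 * (real k)\<^sup>2 / 4)) \<le> 1 / 8"
    and large: "24 * real m \<le> \<eta>\<^sup>2 * k"
    and Wu: "(\<integral>z. \<bar>W z - u (cell m (fst z)) (cell m (snd z))\<bar> \<partial>unit_square) < \<eta>"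
    and fa: "(\<integral>x. \<bar>f x - a (cell m x)\<bar> \<partial>unit_interval) < \<eta>"
  shows "emeasure (sampled_simple_graph k (W, f)) (fitting_graphs m q u a T ((30 + 2 * r) * \<eta>)) > 1 / 2"
proof -
  note WD = graphon_signalsD[OF W]
  define T1 where "T1 x = (\<Sum>i\<in>{1..k}. \<Sum>j\<in>{1..k}. if i = j then 0 else \<bar>W (x i, x j) - u (cell m (x i)) (cell m (x j))\<bar>)" for x
  define T2 where "T2 x = (\<Sum>i\<in>{1..k}. \<bar>f (x i) - a (cell m (x i))\<bar>)" for x
  define T3 where "T3 x = (\<Sum>a<m. (real (card {i \<in> {1..k}. cell m (x i) = a}) - q)\<^sup>2)" for x
  have k0: "real k > 0" using k by simp
  have nonneg: "T1 x \<ge> 0" "T2 x \<ge> 0" "T3 x \<ge> 0" for x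
    by (auto simp: T1_def T2_def T3_def intro!: sum_nonneg)
  have sq: "(\<lambda>z. \<bar>W z - u (cell m (fst z)) (cell m (snd z))\<bar>) \<in> borel_measurable unit_square"
    using WD(2) borel_measurable_step2[OF measurable_cell, of u] by simp
  have iv: "(\<lambda>x. \<bar>f x - a (cell m x)\<bar>) \<in> borel_measurable unit_interval"
    using WD(5) borel_measurable_step1[OF measurable_cell, of a] by simp
  have bsq: "ess_bounded unit_square (\<lambda>z. \<bar>W z - u (cell m (fst z)) (cell m (snd z))\<bar>)"
    by (intro ess_bounded_abs ess_bounded_diff ess_boundedI[OF WD(2,4)]
        ess_boundedI[of _ _ 1, OF borel_measurable_step2[OF measurable_cell]] AE_I2 u)
  have biv: "ess_bounded unit_interval (\<lambda>x. \<bar>f x - a (cell m x)\<bar>)"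
    by (intro ess_bounded_abs ess_bounded_diff ess_boundedI[OF WD(5,6)]
        ess_boundedI[of _ _ r, OF borel_measurable_step1[OF measurable_cell]] AE_I2 a)
  have i1: "integrable (unit_cube k) (\<lambda>x. if i = j then 0 else \<bar>W (x i, x j) - u (cell m (x i)) (cell m (x j))\<bar>)"
    if "i \<in> {1..k}" "j \<in> {1..k}" for i j
    using C.ess_bounded_integrable[OF ess_bounded_mp[OF mp_coord_pair[OF that] bsq]] by (cases "i = j") auto
  have i2: "integrable (unit_cube k) (\<lambda>x. \<bar>f (x i) - a (cell m (x i))\<bar>)" if "i \<in> {1..k}" for i
    using C.ess_bounded_integrable[OF ess_bounded_mp[OF mp_coord[OF that] biv]] .
  have E1: "integrable (unit_cube k) T1" "(\<integral>x. T1 x \<partial>unit_cube k) \<le> \<eta> * (real k)\<^sup>2"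
  proof -
    show "integrable (unit_cube k) T1"
      unfolding T1_def by (intro Bochner_Integration.integrable_sum i1)
    have "(\<integral>x. T1 x \<partial>unit_cube k) = (\<Sum>i\<in>{1..k}. \<Sum>j\<in>{1..k}. \<integral>x. (if i = j then 0 else \<bar>W (x i, x j) - u (cell m (x i)) (cell m (x j))\<bar>) \<partial>unit_cube k)"
      unfolding T1_def
      by (simp only: Bochner_Integration.integral_sum Bochner_Integration.integrable_sum i1 cong: sum.cong)
    also have "\<dots> \<le> (\<Sum>i\<in>{1..k}. \<Sum>j\<in>{1..k}. \<eta>)"
    proof (intro sum_mono)
      fix i j assume ij: "i \<in> {1..k}" "j \<in> {1..k}"
      show "(\<integral>x. (if i = j then 0 else \<bar>W (x i, x j) - u (cell m (x i)) (cell m (x j))\<bar>) \<partial>unit_cube k) \<le> \<eta>"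
      proof (cases "i = j")
        case False
        then show ?thesis
          using mp_integral[OF mp_coord_pair[OF ij False] sq] Wu by simp
      qed (use \<eta> in simp)
    qed
    finally show "(\<integral>x. T1 x \<partial>unit_cube k) \<le> \<eta> * (real k)\<^sup>2"
      by (simp add: power2_eq_square mult_ac)
  qed
  have E2: "integrable (unit_cube k) T2" "(\<integral>x. T2 x \<partial>unit_cube k) \<le> \<eta> * k"
  proof -
    show "integrable (unit_cube k) T2"
      unfolding T2_def by (intro Bochner_Integration.integrable_sum i2)
    have "(\<integral>x. T2 x \<partial>unit_cube k) = (\<Sum>i\<in>{1..k}. \<integral>x. \<bar>f (x i) - a (cell m (x i))\<bar> \<partial>unit_cube k)"
      unfolding T2_def by (simp only: Bochner_Integration.integral_sum i2 cong: sum.cong)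
    also have "\<dots> \<le> (\<Sum>i\<in>{1..k}. \<eta>)"
    proof (intro sum_mono)
      fix i assume i: "i \<in> {1..k}"
      show "(\<integral>x. \<bar>f (x i) - a (cell m (x i))\<bar> \<partial>unit_cube k) \<le> \<eta>"
        using mp_integral[OF mp_coord[OF i] iv] fa by simp
    qed
    finally show "(\<integral>x. T2 x \<partial>unit_cube k) \<le> \<eta> * k" by (simp add: mult_ac)
  qed
  have E3: "integrable (unit_cube k) T3" "(\<integral>x. T3 x \<partial>unit_cube k) \<le> k"
    unfolding T3_def using expectation_cell_counts[OF k(2,1)] C.ess_bounded_integrable by auto
  \<comment> \<open>Each term is scaled to have mean at most 1, so one application of Markov's
    inequality at \<open>24 = 8 * 3\<close> controls all three quantities at once.\<close>
  define S where "S x = T1 x / (\<eta> * (real k)\<^sup>2) + T2 x / (\<eta> * k) + T3 x / k" for x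
  have iS: "integrable (unit_cube k) S"
    unfolding S_def using E1(1) E2(1) E3(1) by simp
  have "(\<integral>x. S x \<partial>unit_cube k) = (\<integral>x. T1 x \<partial>unit_cube k) / (\<eta> * (real k)\<^sup>2) +
      (\<integral>x. T2 x \<partial>unit_cube k) / (\<eta> * k) + (\<integral>x. T3 x \<partial>unit_cube k) / k"
    unfolding S_def using E1(1) E2(1) E3(1) by simp
  also have "\<dots> \<le> 1 + 1 + 1"
    using E1(2) E2(2) E3(2) \<eta>(1) k0 by (intro add_mono) (simp_all add: divide_le_eq)
  finally have ES: "(\<integral>x. S x \<partial>unit_cube k) \<le> 3" by simp
  have Snn: "S x \<ge> 0" for x
    unfolding S_def using nonneg[of x] \<eta>(1) k0 by (intro add_nonneg_nonneg divide_nonneg_nonneg) auto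
  define G where "G = {x \<in> space (unit_cube k). S x < 24}"
  have G: "G \<in> sets (unit_cube k)"
    unfolding G_def using borel_measurable_iff_less[THEN iffD1, OF borel_measurable_integrable[OF iS]] by blast
  have PG: "measure (unit_cube k) G \<ge> 7 / 8"
    using C.prob_less_of_expectation[OF iS, of 24] Snn ES unfolding G_def by simp
  have pw: "measure_pmf.prob (random_edges k W x) {E. (E, node_signal k f x) \<in> fitting_graphs m q u a T ((30 + 2 * r) * \<eta>)} \<ge> 7 / 8"
    if "x \<in> G" for x
  proof -
    from that have x: "x \<in> space (unit_cube k)" and S: "S x < 24" by (auto simp: G_def)
    have p: "T1 x / (\<eta> * (real k)\<^sup>2) \<ge> 0" "T2 x / (\<eta> * k) \<ge> 0" "T3 x / k \<ge> 0"
      using nonneg[of x] \<eta>(1) k0 by (auto intro!: divide_nonneg_nonneg)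
    then have "T1 x / (\<eta> * (real k)\<^sup>2) \<le> 24" "T2 x / (\<eta> * k) \<le> 24" "T3 x / k \<le> 24"
      using S unfolding S_def by linarith+
    then have "T1 x \<le> 24 * \<eta> * (real k)\<^sup>2" "T2 x \<le> 24 * \<eta> * k" "T3 x \<le> 24 * real k"
      using \<eta>(1) k0 by (simp_all add: divide_le_eq mult.assoc)
    then show ?thesis
      using sampled_graph_fits_pointwise[where u = u and a = a, OF W x k(1,3,4) \<eta> u a T tail _ _ _ large]
      unfolding T1_def T2_def T3_def by blast
  qed
  have A: "fitting_graphs m q u a T ((30 + 2 * r) * \<eta>) \<in> sets (simple_graph_space k)"
    using sets_fitting_graphs[of m q u a T] by (simp only: k(1))
  have "ennreal (49 / 64) = ennreal (7 / 8) * ennreal (7 / 8)"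
    by (simp flip: ennreal_mult)
  also have "\<dots> \<le> ennreal (7 / 8) * emeasure (unit_cube k) G"
    using PG by (intro mult_left_mono) (auto simp: C.emeasure_eq_measure intro!: ennreal_leI)
  also have "\<dots> = (\<integral>\<^sup>+x. ennreal (7 / 8) * indicator G x \<partial>unit_cube k)"
    using G by (simp add: nn_integral_cmult_indicator)
  also have "\<dots> \<le> emeasure (sampled_simple_graph k (W, f)) (fitting_graphs m q u a T ((30 + 2 * r) * \<eta>))"
    unfolding emeasure_sampled_simple_graph[OF W A]
  proof (rule nn_integral_mono)
    fix x
    show "ennreal (7 / 8) * indicator G x \<le>
      emeasure (measure_pmf (random_edges k W x)) {E. (E, node_signal k f x) \<in> fitting_graphs m q u a T ((30 + 2 * r) * \<eta>)}"
      using pw[of x] by (cases "x \<in> G") (auto simp: measure_pmf.emeasure_eq_measure intro!: ennreal_leI)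
  qed
  finally have *: "ennreal (49 / 64) \<le> emeasure (sampled_simple_graph k (W, f)) (fitting_graphs m q u a T ((30 + 2 * r) * \<eta>))" .
  have "(1 / 2 :: ennreal) = ennreal 1 / ennreal 2" by (simp only: ennreal_1 ennreal_numeral)
  also have "\<dots> = ennreal (1 / 2)" by (rule divide_ennreal) simp_all
  also have "\<dots> < ennreal (49 / 64)" by (rule ennreal_lessI) simp_all
  finally show ?thesis using * by (rule less_le_trans)
qed

lemma emeasure_sampled_simple_graph_le_1:
  assumes W: "(W, f) \<in> graphon_signals r" and A: "A \<in> sets (simple_graph_space k)"
  shows "emeasure (sampled_simple_graph k (W, f)) A \<le> 1"
proof -
  have "emeasure (sampled_simple_graph k (W, f)) A \<le> (\<integral>\<^sup>+x. 1 \<partial>unit_cube k)"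
    unfolding emeasure_sampled_simple_graph[OF W A]
    by (intro nn_integral_mono) (simp add: measure_pmf.emeasure_le_1)
  also have "\<dots> = 1" using C.emeasure_space_1 by simp
  finally show ?thesis .
qed

text \<open>The graph itself is the intermediary: the step functions arranged by
  \<open>\<sigma>\<close> and by \<open>\<rho>\<close> both agree with it in all tests, and their
  difference can be tested against both of them. No closeness of either step function to the graph
  in L1 or L2 is claimed.\<close>

lemma fitting_graphs_common_imp_close:
  fixes u v :: "nat \<Rightarrow> nat \<Rightarrow> real" and a b :: "nat \<Rightarrow> real"
  assumes k: "k = m * q" "m > 0" "q > 0"
    and u: "\<And>i j. \<bar>u i j\<bar> \<le> 1" "\<And>i j. \<bar>v i j\<bar> \<le> 1"
    and fit: "z \<in> fitting_graphs m q u a {u, v} \<delta>" "z \<in> fitting_graphs m q v b {u, v} \<delta>"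
  obtains \<phi> where "\<phi> \<in> ae_bijections"
    "(\<integral>z. (u (cell m (fst z)) (cell m (snd z)) - v (cell m (\<phi> (fst z))) (cell m (\<phi> (snd z))))\<^sup>2 \<partial>unit_square) \<le> 4 * \<delta>"
    "(\<integral>x. \<bar>a (cell m x) - b (cell m (\<phi> x))\<bar> \<partial>unit_interval) \<le> 2 * \<delta>"
proof -
  have k0: "k > 0" using k by simp
  obtain E s where z: "z = (E, s)" by (cases z)
  obtain \<sigma> where \<sigma>: "\<sigma> \<in> fitting_permutations m q u {u, v} \<delta> E" "(\<Sum>i\<in>{1..k}. \<bar>s i - a (\<sigma> i div q)\<bar>) \<le> \<delta> * k"
    using fit(1) unfolding z fitting_graphs_def k(1) by auto
  obtain \<rho> where \<rho>: "\<rho> \<in> fitting_permutations m q v {u, v} \<delta> E" "(\<Sum>i\<in>{1..k}. \<bar>s i - b (\<rho> i div q)\<bar>) \<le> \<delta> * k"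
    using fit(2) unfolding z fitting_graphs_def k(1) by auto
  have \<sigma>b: "bij_betw \<sigma> {1..k} {..<k}" and \<rho>b: "bij_betw \<rho> {1..k} {..<k}"
    using \<sigma>(1) \<rho>(1) by (auto simp: fitting_permutations_def k(1))
  define X where "X i j = (if i = j then 0 else of_bool ({i, j} \<in> E) :: real)" for i j :: nat
  define P where "P i j = u (\<sigma> i div q) (\<sigma> j div q)" for i j
  define R where "R i j = v (\<rho> i div q) (\<rho> j div q)" for i j
  define L where "L F = (\<Sum>i\<in>{1..k}. \<Sum>j\<in>{1..k}. F i j)" for F :: "nat \<Rightarrow> nat \<Rightarrow> real"
  \<comment> \<open>Any bijection from nodes to cells induces an admissible \<open>\<tau>\<close>.
    Hence the arrangement \<open>\<kappa>\<close> may be tested against a step function placed by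
    the other arrangement.\<close>
  have test: "\<bar>L (\<lambda>i j. (X i j - w (\<kappa> i div q) (\<kappa> j div q)) * \<beta> (\<sigma>' i div q) (\<sigma>' j div q))\<bar> \<le> \<delta> * (real k)\<^sup>2"
    if \<kappa>: "\<kappa> \<in> fitting_permutations m q w {u, v} \<delta> E" and \<beta>: "\<beta> \<in> {u, v}" and \<sigma>': "bij_betw \<sigma>' {1..k} {..<k}" for w \<kappa> \<beta> \<sigma>'
  proof -
    let ?\<tau> = "\<lambda>i\<in>{1..m * q}. \<sigma>' i div q"
    have "?\<tau> \<in> {1..m * q} \<rightarrow>\<^sub>E {..<m}"
      using \<sigma>' by (auto simp: k(1) bij_betw_def intro!: less_mult_imp_div_less)
    then have "\<bar>\<Sum>i\<in>{1..m * q}. \<Sum>j\<in>{1..m * q}. ((if i = j then 0 else of_bool ({i, j} \<in> E)) - w (\<kappa> i div q) (\<kappa> j div q)) *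
          \<beta> (?\<tau> i) (?\<tau> j)\<bar> \<le> \<delta> * (real (m * q))\<^sup>2"
      using \<kappa> \<beta> unfolding fitting_permutations_def by blast
    also have "(\<Sum>i\<in>{1..m * q}. \<Sum>j\<in>{1..m * q}. ((if i = j then 0 else of_bool ({i, j} \<in> E)) - w (\<kappa> i div q) (\<kappa> j div q)) *
          \<beta> (?\<tau> i) (?\<tau> j)) = L (\<lambda>i j. (X i j - w (\<kappa> i div q) (\<kappa> j div q)) * \<beta> (\<sigma>' i div q) (\<sigma>' j div q))"
      unfolding L_def k(1) X_def by (intro sum.cong refl) simp
    finally show ?thesis by (simp only: k(1))
  qed
  have Lsub: "L F - L F' = L (\<lambda>i j. F i j - F' i j)" for F F'
    by (simp add: L_def sum_subtractf)
  \<comment> \<open>Write \<open>(P - R)^2\<close> as \<open>(P - R) * P - (P - R) * R\<close> and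
    \<open>P - R\<close> as \<open>(X - R) - (X - P)\<close>; each of the four resulting sums is one
    of the tests.\<close>
  have "L (\<lambda>i j. (P i j - R i j)\<^sup>2) =
      (L (\<lambda>i j. (X i j - R i j) * P i j) - L (\<lambda>i j. (X i j - P i j) * P i j)) -
      (L (\<lambda>i j. (X i j - R i j) * R i j) - L (\<lambda>i j. (X i j - P i j) * R i j))"
    unfolding Lsub by (simp add: power2_eq_square algebra_simps)
  also have "\<dots> \<le> 4 * (\<delta> * (real k)\<^sup>2)"
    using test[OF \<rho>(1) _ \<sigma>b, of u] test[OF \<sigma>(1) _ \<sigma>b, of u] test[OF \<rho>(1) _ \<rho>b, of v] test[OF \<sigma>(1) _ \<rho>b, of v]
    by (simp add: P_def R_def)
  finally have LPR: "L (\<lambda>i j. (P i j - R i j)\<^sup>2) \<le> 4 * \<delta> * (real k)\<^sup>2" by simp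
  \<comment> \<open>Moves the cell that a node occupies under \<open>\<sigma>\<close> to the cell
    that the same node occupies under \<open>\<rho>\<close>.\<close>
  define \<pi> where "\<pi> p = \<rho> (the_inv_into {1..k} \<sigma> p)" for p
  have \<pi>: "bij_betw \<pi> {..<k} {..<k}"
    using bij_betw_trans[OF bij_betw_the_inv_into[OF \<sigma>b] \<rho>b] by (simp add: \<pi>_def[abs_def] comp_def)
  have \<pi>\<sigma>: "\<pi> (\<sigma> i) = \<rho> i" if "i \<in> {1..k}" for i
    using \<sigma>b that by (simp add: \<pi>_def bij_betw_def the_inv_into_f_f)
  have \<pi>': "\<pi> ` {..<k} \<subseteq> {..<k}" using \<pi> by (auto simp: bij_betw_def)
  define \<phi> where "\<phi> = interval_exchange k \<pi>"
  have \<phi>: "\<phi> \<in> ae_bijections" unfolding \<phi>_def by (rule interval_exchange_ae_bijection[OF k0 \<pi>])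
  have cells: "cell m x = cell k x div q" "cell m (\<phi> x) = \<pi> (cell k x) div q" if "x \<in> {0..1}" "x < 1" for x
  proof -
    have x: "x \<in> {0..<1}" using that by simp
    show "cell m x = cell k x div q" using cell_div[OF k(2,3), of x] x by (simp add: k(1))
    have "cell m (\<phi> x) = cell k (\<phi> x) div q"
      using cell_div[OF k(2,3), of "\<phi> x"] interval_exchange_cell(1)[OF k0 \<pi>' x] by (simp add: k(1) \<phi>_def)
    then show "cell m (\<phi> x) = \<pi> (cell k x) div q"
      using interval_exchange_cell(2)[OF k0 \<pi>' x] by (simp add: \<phi>_def)
  qed
  have cm: "cell m \<in> unit_interval \<rightarrow>\<^sub>M count_space UNIV" "(\<lambda>x. cell m (\<phi> x)) \<in> unit_interval \<rightarrow>\<^sub>M count_space UNIV"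
    using mp_measurable[OF ae_bijections_mp[OF \<phi>] measurable_cell] by auto
  let ?h = "\<lambda>p p'. (u (p div q) (p' div q) - v (\<pi> p div q) (\<pi> p' div q))\<^sup>2"
  have "(\<integral>z. (u (cell m (fst z)) (cell m (snd z)) - v (cell m (\<phi> (fst z))) (cell m (\<phi> (snd z))))\<^sup>2 \<partial>unit_square) =
      (\<integral>z. ?h (cell k (fst z)) (cell k (snd z)) \<partial>unit_square)"
  proof (rule integral_cong_AE)
    show "AE z in unit_square. (u (cell m (fst z)) (cell m (snd z)) - v (cell m (\<phi> (fst z))) (cell m (\<phi> (snd z))))\<^sup>2 =
       ?h (cell k (fst z)) (cell k (snd z))"
      using mp_AE[OF mp_fst AE_less_1] mp_AE[OF mp_snd AE_less_1] AE_space
    proof eventually_elim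
      case (elim z)
      then have "fst z \<in> {0..1}" "snd z \<in> {0..1}" by auto
      then show ?case using cells[of "fst z"] cells[of "snd z"] elim by simp
    qed
    show "(\<lambda>z. (u (cell m (fst z)) (cell m (snd z)) - v (cell m (\<phi> (fst z))) (cell m (\<phi> (snd z))))\<^sup>2) \<in> borel_measurable unit_square"
      using borel_measurable_step2[OF cm(1), of u] borel_measurable_step2[OF cm(2), of v] by simp
    show "(\<lambda>z. ?h (cell k (fst z)) (cell k (snd z))) \<in> borel_measurable unit_square"
      by (rule borel_measurable_step2[OF measurable_cell])
  qed
  also have "\<dots> = (\<Sum>p<k. \<Sum>p'<k. ?h p p') / (real k)\<^sup>2"
    by (rule integral_step2[OF k0])
  \<comment> \<open>Sums over cells become sums over nodes through \<open>\<sigma>\<close>, and then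
    \<open>\<pi> (\<sigma> i) = \<rho> i\<close> brings in the second arrangement.\<close>
  also have "(\<Sum>p<k. \<Sum>p'<k. ?h p p') = L (\<lambda>i j. (P i j - R i j)\<^sup>2)"
    unfolding L_def P_def R_def sum.reindex_bij_betw[OF \<sigma>b, symmetric]
    by (intro sum.cong refl) (simp add: \<pi>\<sigma>)
  also have "L (\<lambda>i j. (P i j - R i j)\<^sup>2) / (real k)\<^sup>2 \<le> 4 * \<delta>"
    using LPR k0 by (simp add: divide_le_eq)
  finally have 1: "(\<integral>z. (u (cell m (fst z)) (cell m (snd z)) - v (cell m (\<phi> (fst z))) (cell m (\<phi> (snd z))))\<^sup>2 \<partial>unit_square) \<le> 4 * \<delta>" .
  let ?g = "\<lambda>p. \<bar>a (p div q) - b (\<pi> p div q)\<bar>"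
  have "(\<integral>x. \<bar>a (cell m x) - b (cell m (\<phi> x))\<bar> \<partial>unit_interval) = (\<integral>x. ?g (cell k x) \<partial>unit_interval)"
  proof (rule integral_cong_AE)
    show "AE x in unit_interval. \<bar>a (cell m x) - b (cell m (\<phi> x))\<bar> = ?g (cell k x)"
      using AE_less_1 AE_space
    proof eventually_elim
      case (elim x)
      then have "x \<in> {0..1}" by auto
      then show ?case using cells[of x] elim by simp
    qed
    show "(\<lambda>x. \<bar>a (cell m x) - b (cell m (\<phi> x))\<bar>) \<in> borel_measurable unit_interval"
      using borel_measurable_step1[OF cm(1), of a] borel_measurable_step1[OF cm(2), of b] by simp
    show "(\<lambda>x. ?g (cell k x)) \<in> borel_measurable unit_interval"
      by (rule borel_measurable_step1[OF measurable_cell])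
  qed
  also have "\<dots> = (\<Sum>p<k. ?g p) / k" by (rule integral_step1[OF k0])
  also have "(\<Sum>p<k. ?g p) = (\<Sum>i\<in>{1..k}. \<bar>a (\<sigma> i div q) - b (\<rho> i div q)\<bar>)"
    unfolding sum.reindex_bij_betw[OF \<sigma>b, symmetric] by (intro sum.cong refl) (simp add: \<pi>\<sigma>)
  also have "\<dots> / k \<le> 2 * \<delta>"
  proof -
    have "(\<Sum>i\<in>{1..k}. \<bar>a (\<sigma> i div q) - b (\<rho> i div q)\<bar>) \<le>
        (\<Sum>i\<in>{1..k}. \<bar>s i - a (\<sigma> i div q)\<bar> + \<bar>s i - b (\<rho> i div q)\<bar>)"
      by (intro sum_mono) linarith
    then have "(\<Sum>i\<in>{1..k}. \<bar>a (\<sigma> i div q) - b (\<rho> i div q)\<bar>) \<le> 2 * \<delta> * k"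
      using \<sigma>(2) \<rho>(2) unfolding sum.distrib by linarith
    then show ?thesis using k0 by (simp add: divide_le_eq)
  qed
  finally have 2: "(\<integral>x. \<bar>a (cell m x) - b (cell m (\<phi> x))\<bar> \<partial>unit_interval) \<le> 2 * \<delta>" .
  show thesis by (rule that[OF \<phi> 1 2])
qed

text \<open>The logarithm of the number of tests is linear in \<open>k\<close>, whereas the
  Hoeffding exponent is quadratic.\<close>

lemma union_bound_tail:
  fixes m :: nat and \<eta> :: real
  assumes m: "m > 0" and \<eta>: "\<eta> > 0"
  obtains K :: nat where "K \<ge> 2" "\<And>k. k \<ge> K \<Longrightarrow> 1 / \<eta> \<le> k" "\<And>k. k \<ge> K \<Longrightarrow> 24 * real m \<le> \<eta>\<^sup>2 * k"
    "\<And>k. k \<ge> K \<Longrightarrow> 4 * real m ^ k * exp (- (\<eta>\<^sup>2 * (real k)\<^sup>2 / 4)) \<le> 1 / 8"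
proof -
  \<comment> \<open>The last entry makes \<open>k * \<eta>^2 / 4\<close> at least
    \<open>ln m + 5\<close>, so the total exponent is at most \<open>- 5 * k\<close>; then
    \<open>4 * exp (- 5) \<le> 4 / 32\<close> gives the required \<open>1 / 8\<close>.\<close>
  obtain K :: nat where K: "max (max 2 (1 / \<eta>)) (max (24 * real m / \<eta>\<^sup>2) (4 * (ln m + 5) / \<eta>\<^sup>2)) \<le> K"
    using real_arch_simple by blast
  show thesis
  proof (rule that[of K])
    show "K \<ge> 2" using K by simp
    fix k assume "k \<ge> K"
    then have k: "max (max 2 (1 / \<eta>)) (max (24 * real m / \<eta>\<^sup>2) (4 * (ln m + 5) / \<eta>\<^sup>2)) \<le> k"
      using K by linarith
    then show "1 / \<eta> \<le> k" by simp
    have "24 * real m / \<eta>\<^sup>2 \<le> k" "4 * (ln m + 5) / \<eta>\<^sup>2 \<le> k" using k by simp_all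
    then have k': "24 * real m \<le> k * \<eta>\<^sup>2" "4 * (ln m + 5) \<le> k * \<eta>\<^sup>2"
      using \<eta> by (simp_all only: pos_divide_le_eq zero_less_power)
    then show "24 * real m \<le> \<eta>\<^sup>2 * k" by (simp add: mult.commute)
    have "real m ^ k = exp (k * ln m)" using m by (simp add: exp_of_nat_mult)
    then have "4 * real m ^ k * exp (- (\<eta>\<^sup>2 * (real k)\<^sup>2 / 4)) = 4 * exp (k * ln m - \<eta>\<^sup>2 * (real k)\<^sup>2 / 4)"
      by (simp flip: exp_add)
    also have "k * ln m - \<eta>\<^sup>2 * (real k)\<^sup>2 / 4 = k * (ln m - k * \<eta>\<^sup>2 / 4)"
      by (simp add: power2_eq_square algebra_simps)
    also have "\<dots> \<le> real k * (-5)" using k' by (intro mult_left_mono) auto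
    also have "\<dots> \<le> -5" using k by simp
    finally have "4 * real m ^ k * exp (- (\<eta>\<^sup>2 * (real k)\<^sup>2 / 4)) \<le> 4 * exp (-5)" by simp
    also have "\<dots> \<le> 4 / 32" using exp_5_ge_32 by (simp add: exp_minus field_simps)
    finally show "4 * real m ^ k * exp (- (\<eta>\<^sup>2 * (real k)\<^sup>2 / 4)) \<le> 1 / 8" by simp
  qed
qed

lemma sampled_simple_imp_L1_close:
  assumes W: "(W, f) \<in> graphon_signals r" and V: "(V, g) \<in> graphon_signals r"
    and eq: "\<And>k. k \<ge> 1 \<Longrightarrow> sampled_simple_graph k (W, f) = sampled_simple_graph k (V, g)"
  shows "L1_close W f V g"
  unfolding L1_close_def
proof (intro allI impI)
  fix e :: real assume e: "e > 0"
  note WD = graphon_signalsD[OF W] and VD = graphon_signalsD[OF V]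
  \<comment> \<open>For the kernel, \<open>4 * \<delta> \<le> e^2 / 5\<close> lies below
    \<open>(e / 2)^2\<close>, and the two approximation errors below
    \<open>\<eta> \<le> e / 4\<close> use up the other half of \<open>e\<close>. For the signal,
    \<open>2 * \<delta> \<le> 2 * e / 5\<close> together with two such errors stays below
    \<open>e\<close>.\<close>
  define \<delta>0 where "\<delta>0 = min (e\<^sup>2 / 20) (e / 5)"
  define \<eta> where "\<eta> = min (e / 4) (\<delta>0 / (30 + 2 * r))"
  define \<delta> where "\<delta> = (30 + 2 * r) * \<eta>"
  have r: "r \<ge> 0" by (rule WD(9))
  have \<delta>0: "\<delta>0 > 0" using e by (simp add: \<delta>0_def)
  have \<eta>: "\<eta> > 0" "\<eta> \<le> e / 4"
    using e r \<delta>0 by (simp add: \<eta>_def) (simp only: \<eta>_def min.cobounded1)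
  have "\<delta> \<le> (30 + 2 * r) * (\<delta>0 / (30 + 2 * r))"
    unfolding \<delta>_def using r by (intro mult_left_mono) (auto simp: \<eta>_def)
  then have \<delta>: "\<delta> \<le> e\<^sup>2 / 20" "\<delta> \<le> e / 5" using r by (auto simp: \<delta>0_def)
  obtain N1 where N1: "\<And>m. m \<ge> N1 \<Longrightarrow> \<exists>u. (\<forall>i j. \<bar>u i j\<bar> \<le> 1) \<and>
      (\<integral>z. \<bar>W z - u (cell m (fst z)) (cell m (snd z))\<bar> \<partial>unit_square) < \<eta>"
    using L1_approx_step2[OF WD(2,4) _ \<eta>(1)] by auto
  obtain N2 where N2: "\<And>m. m \<ge> N2 \<Longrightarrow> \<exists>u. (\<forall>i j. \<bar>u i j\<bar> \<le> 1) \<and>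
      (\<integral>z. \<bar>V z - u (cell m (fst z)) (cell m (snd z))\<bar> \<partial>unit_square) < \<eta>"
    using L1_approx_step2[OF VD(2,4) _ \<eta>(1)] by auto
  obtain N3 where N3: "\<And>m. m \<ge> N3 \<Longrightarrow> \<exists>a. (\<forall>i. \<bar>a i\<bar> \<le> r) \<and>
      (\<integral>x. \<bar>f x - a (cell m x)\<bar> \<partial>unit_interval) < \<eta>"
    using L1_approx_step1[OF WD(5,6,9) \<eta>(1)] by auto
  obtain N4 where N4: "\<And>m. m \<ge> N4 \<Longrightarrow> \<exists>a. (\<forall>i. \<bar>a i\<bar> \<le> r) \<and>
      (\<integral>x. \<bar>g x - a (cell m x)\<bar> \<partial>unit_interval) < \<eta>"
    using L1_approx_step1[OF VD(5,6,9) \<eta>(1)] by auto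
  \<comment> \<open>A single partition for all four functions: the exchange constructed below must
    act on the cells of both sides.\<close>
  define m where "m = Max {1, N1, N2, N3, N4}"
  have m: "m > 0" "m \<ge> N1" "m \<ge> N2" "m \<ge> N3" "m \<ge> N4"
    unfolding m_def by (auto intro!: Max_ge simp del: Max_less_iff simp: less_eq_Suc_le)
  obtain u where u: "\<And>i j. \<bar>u i j\<bar> \<le> 1" "(\<integral>z. \<bar>W z - u (cell m (fst z)) (cell m (snd z))\<bar> \<partial>unit_square) < \<eta>"
    using N1[OF m(2)] by auto
  obtain v where v: "\<And>i j. \<bar>v i j\<bar> \<le> 1" "(\<integral>z. \<bar>V z - v (cell m (fst z)) (cell m (snd z))\<bar> \<partial>unit_square) < \<eta>"
    using N2[OF m(3)] by auto
  obtain a where a: "\<And>i. \<bar>a i\<bar> \<le> r" "(\<integral>x. \<bar>f x - a (cell m x)\<bar> \<partial>unit_interval) < \<eta>"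
    using N3[OF m(4)] by auto
  obtain b where b: "\<And>i. \<bar>b i\<bar> \<le> r" "(\<integral>x. \<bar>g x - b (cell m x)\<bar> \<partial>unit_interval) < \<eta>"
    using N4[OF m(5)] by auto
  obtain K :: nat where K: "K \<ge> 2" "\<And>k. k \<ge> K \<Longrightarrow> 1 / \<eta> \<le> k" "\<And>k. k \<ge> K \<Longrightarrow> 24 * real m \<le> \<eta>\<^sup>2 * k"
    "\<And>k. k \<ge> K \<Longrightarrow> 4 * real m ^ k * exp (- (\<eta>\<^sup>2 * (real k)\<^sup>2 / 4)) \<le> 1 / 8"
    using union_bound_tail[OF m(1) \<eta>(1)] by blast
  \<comment> \<open>A multiple of \<open>m\<close>, so that every block consists of exactly
    \<open>K\<close> of the \<open>k\<close> cells and each node can occupy one cell. It is also at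
    least \<open>K\<close>, as the tail estimates demand.\<close>
  define k where "k = m * K"
  have kK: "k \<ge> K" using m(1) by (simp add: k_def)
  have K0: "K > 0" and k2: "k \<ge> 2" using K(1) kK by simp_all
  have T: "finite {u, v}" "card {u, v} \<le> 2" "\<forall>\<beta>\<in>{u, v}. \<forall>i j. \<bar>\<beta> i j\<bar> \<le> 1"
    using u(1) v(1) by (auto simp: card_insert_if)
  let ?G = "sampled_simple_graph k (W, f)"
  let ?A = "fitting_graphs m K u a {u, v} \<delta>" and ?B = "fitting_graphs m K v b {u, v} \<delta>"
  have A: "emeasure ?G ?A > 1 / 2"
    unfolding \<delta>_def
    by (rule sampled_graph_fits[OF W k_def m(1) K0 k2 \<eta>(1) K(2)[OF kK] u(1) a(1) T K(4)[OF kK] K(3)[OF kK] u(2) a(2)])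
  have "emeasure (sampled_simple_graph k (V, g)) ?B > 1 / 2"
    unfolding \<delta>_def
    by (rule sampled_graph_fits[OF V k_def m(1) K0 k2 \<eta>(1) K(2)[OF kK] v(1) b(1) T K(4)[OF kK] K(3)[OF kK] v(2) b(2)])
  \<comment> \<open>The equality of the laws is used here, and only for this one size
    \<open>k\<close>. Both events now have probability above one half under the same law and cannot
    be disjoint.\<close>
  then have B: "emeasure ?G ?B > 1 / 2" using eq[of k] k2 by simp
  have AB: "?A \<in> sets (simple_graph_space k)" "?B \<in> sets (simple_graph_space k)"
    using sets_fitting_graphs by (simp_all only: k_def)
  have "?A \<inter> ?B \<noteq> {}"
  proof
    assume disj: "?A \<inter> ?B = {}"
    have "1 = (1 / 2 + 1 / 2 :: ennreal)"
      by (simp add: ennreal_divide_self flip: add_divide_distrib_ennreal)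
    also have "\<dots> < emeasure ?G ?A + emeasure ?G ?B" using A B by (rule add_strict_mono)
    also have "\<dots> = emeasure ?G (?A \<union> ?B)"
      using AB disj by (intro plus_emeasure) (simp_all only: sets_sampled_simple_graph)
    also have "\<dots> \<le> 1"
      by (intro emeasure_sampled_simple_graph_le_1[OF W] sets.Un AB)
    finally show False by simp
  qed
  then obtain z where z: "z \<in> ?A" "z \<in> ?B" by auto
  obtain \<phi> where \<phi>: "\<phi> \<in> ae_bijections"
    "(\<integral>z. (u (cell m (fst z)) (cell m (snd z)) - v (cell m (\<phi> (fst z))) (cell m (\<phi> (snd z))))\<^sup>2 \<partial>unit_square) \<le> 4 * \<delta>"
    "(\<integral>x. \<bar>a (cell m x) - b (cell m (\<phi> x))\<bar> \<partial>unit_interval) \<le> 2 * \<delta>"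
    using fitting_graphs_common_imp_close[OF k_def m(1) K0 u(1) v(1) z] by blast
  note mp = ae_bijections_mp[OF \<phi>(1)]
  have cm: "cell m \<in> unit_interval \<rightarrow>\<^sub>M count_space UNIV" "(\<lambda>x. cell m (\<phi> x)) \<in> unit_interval \<rightarrow>\<^sub>M count_space UNIV"
    using mp_measurable[OF mp measurable_cell] by auto
  let ?U = "\<lambda>z. u (cell m (fst z)) (cell m (snd z))" and ?V = "\<lambda>z. v (cell m (fst z)) (cell m (snd z))"
  let ?V\<phi> = "\<lambda>z. v (cell m (\<phi> (fst z))) (cell m (\<phi> (snd z)))"
  have Um: "?U \<in> borel_measurable unit_square" by (rule borel_measurable_step2[OF cm(1)])
  have Vm: "?V \<in> borel_measurable unit_square" by (rule borel_measurable_step2[OF cm(1)])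
  have V\<phi>m: "?V\<phi> \<in> borel_measurable unit_square" by (rule borel_measurable_step2[OF cm(2)])
  have bU: "ess_bounded unit_square ?U" by (rule ess_boundedI[OF Um AE_I2[OF u(1)]])
  have bV\<phi>: "ess_bounded unit_square ?V\<phi>" by (rule ess_boundedI[OF V\<phi>m AE_I2[OF v(1)]])
  have bW: "ess_bounded unit_square W" by (rule ess_boundedI[OF WD(2,4)])
  have bVp: "ess_bounded unit_square (kernel_pullback V \<phi>)"
    using ess_bounded_mp[OF mp_square[OF mp] ess_boundedI[OF VD(2,4)]] by (simp add: kernel_pullback_eq[abs_def])
  have UV: "(\<integral>z. \<bar>?U z - ?V\<phi> z\<bar> \<partial>unit_square) < e / 2"
  proof (rule L1_less_of_L2)
    show "(\<lambda>z. ?U z - ?V\<phi> z) \<in> borel_measurable unit_square" using Um V\<phi>m by simp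
    show "AE z in unit_square. \<bar>?U z - ?V\<phi> z\<bar> \<le> 2"
    proof (rule AE_I2)
      fix z
      show "\<bar>?U z - ?V\<phi> z\<bar> \<le> 2"
        using u(1)[of "cell m (fst z)" "cell m (snd z)"] v(1)[of "cell m (\<phi> (fst z))" "cell m (\<phi> (snd z))"] by linarith
    qed
    have "0 < e\<^sup>2" "(e / 2)\<^sup>2 = e\<^sup>2 / 4" using e by (simp_all add: power_divide)
    then have "4 * \<delta> < (e / 2)\<^sup>2" using \<delta>(1) by linarith
    then show "(\<integral>z. (?U z - ?V\<phi> z)\<^sup>2 \<partial>unit_square) < (e / 2)\<^sup>2" using \<phi>(2) by linarith
  qed (use e in simp)
  have VV: "(\<integral>z. \<bar>kernel_pullback V \<phi> z - ?V\<phi> z\<bar> \<partial>unit_square) < \<eta>"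
  proof -
    have "(\<lambda>z. \<bar>V z - ?V z\<bar>) \<in> borel_measurable unit_square" using VD(2) Vm by simp
    from mp_integral[OF mp_square[OF mp] this] v(2) show ?thesis
      by (simp add: kernel_pullback_def case_prod_beta)
  qed
  have iW: "integrable unit_square (\<lambda>z. \<bar>W z - ?U z\<bar>)" "integrable unit_square (\<lambda>z. \<bar>?U z - ?V\<phi> z\<bar>)"
      "integrable unit_square (\<lambda>z. \<bar>kernel_pullback V \<phi> z - ?V\<phi> z\<bar>)"
    by (intro Q.ess_bounded_integrable ess_bounded_abs ess_bounded_diff bW bU bV\<phi> bVp)+
  have "(\<integral>z. \<bar>W z - kernel_pullback V \<phi> z\<bar> \<partial>unit_square) \<le>
      (\<integral>z. \<bar>W z - ?U z\<bar> + (\<bar>?U z - ?V\<phi> z\<bar> + \<bar>kernel_pullback V \<phi> z - ?V\<phi> z\<bar>) \<partial>unit_square)"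
    using iW by (intro integral_mono' Bochner_Integration.integrable_add) linarith+
  also have "\<dots> = (\<integral>z. \<bar>W z - ?U z\<bar> \<partial>unit_square) + ((\<integral>z. \<bar>?U z - ?V\<phi> z\<bar> \<partial>unit_square) +
      (\<integral>z. \<bar>kernel_pullback V \<phi> z - ?V\<phi> z\<bar> \<partial>unit_square))"
    using iW by simp
  also have "\<dots> < e" using u(2) UV VV \<eta>(2) by linarith
  finally have 1: "(\<integral>z. \<bar>W z - kernel_pullback V \<phi> z\<bar> \<partial>unit_square) < e" .
  let ?a = "\<lambda>x. a (cell m x)" and ?b = "\<lambda>x. b (cell m x)" and ?b\<phi> = "\<lambda>x. b (cell m (\<phi> x))"
  have am: "?a \<in> borel_measurable unit_interval" by (rule borel_measurable_step1[OF cm(1)])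
  have bm: "?b \<in> borel_measurable unit_interval" by (rule borel_measurable_step1[OF cm(1)])
  have b\<phi>m: "?b\<phi> \<in> borel_measurable unit_interval" by (rule borel_measurable_step1[OF cm(2)])
  have ba: "ess_bounded unit_interval ?a" by (rule ess_boundedI[OF am AE_I2[OF a(1)]])
  have bb: "ess_bounded unit_interval ?b\<phi>" by (rule ess_boundedI[OF b\<phi>m AE_I2[OF b(1)]])
  have bf: "ess_bounded unit_interval f" by (rule ess_boundedI[OF WD(5,6)])
  have bg: "ess_bounded unit_interval (signal_pullback g \<phi>)"
    using ess_bounded_mp[OF mp ess_boundedI[OF VD(5,6)]] by (simp add: signal_pullback_def)
  have gg: "(\<integral>x. \<bar>signal_pullback g \<phi> x - ?b\<phi> x\<bar> \<partial>unit_interval) < \<eta>"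
  proof -
    have "(\<lambda>x. \<bar>g x - ?b x\<bar>) \<in> borel_measurable unit_interval" using VD(5) bm by simp
    from mp_integral[OF mp this] b(2) show ?thesis by (simp add: signal_pullback_def)
  qed
  have ii: "integrable unit_interval (\<lambda>x. \<bar>f x - ?a x\<bar>)" "integrable unit_interval (\<lambda>x. \<bar>?a x - ?b\<phi> x\<bar>)"
      "integrable unit_interval (\<lambda>x. \<bar>signal_pullback g \<phi> x - ?b\<phi> x\<bar>)"
    by (intro I.ess_bounded_integrable ess_bounded_abs ess_bounded_diff ba bb bf bg)+
  have "(\<integral>x. \<bar>f x - signal_pullback g \<phi> x\<bar> \<partial>unit_interval) \<le>
      (\<integral>x. \<bar>f x - ?a x\<bar> + (\<bar>?a x - ?b\<phi> x\<bar> + \<bar>signal_pullback g \<phi> x - ?b\<phi> x\<bar>) \<partial>unit_interval)"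
    using ii by (intro integral_mono' Bochner_Integration.integrable_add) linarith+
  also have "\<dots> = (\<integral>x. \<bar>f x - ?a x\<bar> \<partial>unit_interval) + ((\<integral>x. \<bar>?a x - ?b\<phi> x\<bar> \<partial>unit_interval) +
      (\<integral>x. \<bar>signal_pullback g \<phi> x - ?b\<phi> x\<bar> \<partial>unit_interval))"
    using ii by simp
  also have "\<dots> < e" using a(2) \<phi>(3) gg \<eta>(2) \<delta>(2) e by linarith
  finally have 2: "(\<integral>x. \<bar>f x - signal_pullback g \<phi> x\<bar> \<partial>unit_interval) < e" .
  show "\<exists>\<phi>\<in>ae_bijections.
     (\<integral>z. \<bar>W z - kernel_pullback V \<phi> z\<bar> \<partial>unit_square) < e \<and>
     (\<integral>x. \<bar>f x - signal_pullback g \<phi> x\<bar> \<partial>unit_interval) < e"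
    using \<phi>(1) 1 2 by blast
qed

theorem theorem3p2:
  fixes r :: real and W V :: kernel and f g :: signal
  assumes "r > 1"
    and "(W, f) \<in> graphon_signals r"
    and "(V, g) \<in> graphon_signals r"
  shows
    "((\<forall>p::real. p \<ge> 1 \<longrightarrow> Lp_distance p (W, f) (V, g) = 0)
        \<longleftrightarrow> cut_distance (W, f) (V, g) = 0) \<and>
     (cut_distance (W, f) (V, g) = 0
        \<longleftrightarrow> (\<forall>k E d. is_multigraph k E \<longrightarrow>
              hom_density k E d (W, f) = hom_density k E d (V, g))) \<and>
     ((\<forall>k E d. is_multigraph k E \<longrightarrow>
              hom_density k E d (W, f) = hom_density k E d (V, g))
        \<longleftrightarrow> (\<forall>k E d. is_simple_graph k E \<longrightarrow>
              hom_density k E d (W, f) = hom_density k E d (V, g))) \<and>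
     ((\<forall>k E d. is_simple_graph k E \<longrightarrow>
              hom_density k E d (W, f) = hom_density k E d (V, g))
        \<longleftrightarrow> (\<forall>k\<ge>1. sampled_weighted_graph k (W, f) = sampled_weighted_graph k (V, g))) \<and>
     ((\<forall>k\<ge>1. sampled_weighted_graph k (W, f) = sampled_weighted_graph k (V, g))
        \<longleftrightarrow> (\<forall>k\<ge>1. sampled_simple_graph k (W, f) = sampled_simple_graph k (V, g)))"
proof -
  note Wf = assms(2) and Vg = assms(3)
  define P1 where "P1 \<longleftrightarrow> (\<forall>p::real. p \<ge> 1 \<longrightarrow> Lp_distance p (W, f) (V, g) = 0)"
  define P2 where "P2 \<longleftrightarrow> cut_distance (W, f) (V, g) = 0"
  define P3 where "P3 \<longleftrightarrow> (\<forall>k E d. is_multigraph k E \<longrightarrow> hom_density k E d (W, f) = hom_density k E d (V, g))"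
  define P4 where "P4 \<longleftrightarrow> (\<forall>k E d. is_simple_graph k E \<longrightarrow> hom_density k E d (W, f) = hom_density k E d (V, g))"
  define P5 where "P5 \<longleftrightarrow> (\<forall>k\<ge>1. sampled_weighted_graph k (W, f) = sampled_weighted_graph k (V, g))"
  define P6 where "P6 \<longleftrightarrow> (\<forall>k\<ge>1. sampled_simple_graph k (W, f) = sampled_simple_graph k (V, g))"
  \<comment> \<open>\<open>L1_close\<close>, \<open>P3\<close>, \<open>P4\<close> and
    \<open>P6\<close> form a cycle of implications; \<open>P1\<close> and \<open>P2\<close> are
    attached to it at \<open>L1_close\<close>, and \<open>P5\<close> at \<open>P3\<close>.\<close>
  have 1: "P1 \<longleftrightarrow> L1_close W f V g"
    unfolding P1_def by (rule Lp_iff_L1_close[OF Wf Vg])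
  have 2: "P2 \<longleftrightarrow> L1_close W f V g"
    unfolding P2_def by (rule cut_distance_iff_L1_close[OF Wf Vg])
  have 3: P3 if "L1_close W f V g"
    unfolding P3_def multigraph_densities_eq_iff
    using L1_close_imp_densities[OF Wf Vg less_imp_le[OF assms(1)] that] by blast
  have 4: P4 if P3
    using that unfolding P3_def P4_def is_simple_graph_def by blast
  have 5: "P3 \<longleftrightarrow> P5"
    unfolding P3_def P5_def by (rule multigraph_iff_weighted[OF Wf Vg])
  have 6: P6 if P4
    using that simple_imp_sampled_simple[OF Wf Vg] unfolding P4_def P6_def by blast
  have 7: "L1_close W f V g" if P6
    using that unfolding P6_def by (intro sampled_simple_imp_L1_close[OF Wf Vg]) simp
  show ?thesis
    unfolding P1_def[symmetric] P2_def[symmetric] P3_def[symmetric] P4_def[symmetric]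
      P5_def[symmetric] P6_def[symmetric]
    using 1 2 3 4 5 6 7 by blast
qed

end
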